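(* Let $1\le p<2<u\le\infty$, $1\le p_1\le\infty$ and $\alpha>1$, and let $X$ and $I:X\to\mathbb{K}$ be the space and operator defined in the context. Then there are constants $c_1,c_2>0$ and $n_0\in\mathbb{N}$ such that for all $n\ge n_0$ $$c_1n^{1/(2u)-1/4}+c_1n^{1/4-1/(2p)}\le\frac{e_n^{\mathrm{ran}}(I,B_X)}{e_n^{\mathrm{ran-non}}(I,B_X)}\le c_2n^{1/(2u)-1/4}(\log(n+1))^{1-1/u}+c_2n^{1/4-1/(2p)}(\log(n+1))^{1/2}.$$ For $p=1$, $u=\infty$ this gives, with (possibly different) constants $c_1,c_2>0$, for all $n\ge n_0$ $$c_1n^{1/4}(\log(n+1))^{-1}\le\frac{e_n^{\mathrm{ran-non}}(I,B_X)}{e_n^{\mathrm{ran}}(I,B_X)}\le c_2n^{1/4}.$$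
   Context: $\mathbb{N}=\{1,2,\dots\}$, $\mathbb{N}_0=\mathbb{N}\cup\{0\}$, $\mathbb{K}\in\{\mathbb{R},\mathbb{C}\}$, $\log=\log_2$, $1/\infty=0$, $B_X$ is the closed unit ball of a normed space $X$. Spaces and problem. For $N\in\mathbb{N}$, $1\le p\le\infty$, $L_p^N$ is the space of functions $f:\{1,\dots,N\}\to\mathbb{K}$ with norm $\big(\frac1N\sum_{i=1}^N|f(i)|^p\big)^{1/p}$ if $p<\infty$ and $\max_i|f(i)|$ if $p=\infty$. $L_p^{N_1}(L_u^{N_2})$ is the space of all $f:\{1,\dots,N_1\}\times\{1,\dots,N_2\}\to\mathbb{K}$ with norm $\big\|(\|f_i\|_{L_u^{N_2}})_{i=1}^{N_1}\big\|_{L_p^{N_1}}$, where $f_i=(f(i,j))_{j=1}^{N_2}$. The mean operator is $I^{N_1,N_2}f=\frac1{N_1N_2}\sum_{i=1}^{N_1}\sum_{j=1}^{N_2}f(i,j)$. Put $N_k=2^k$ for $k\in\mathbb{N}_0$. $X=\big(\bigoplus_{k=0}^\infty L_p^{N_k}(L_u^{N_k})\big)_{\ell_{p_1}}$ is the space of sequences $(f_k)_{k=0}^\infty$, $f_k\in L_p^{N_k}(L_u^{N_k})$, with finite norm $\big\|(\|f_k\|)_{k=0}^\infty\big\|_{\ell_{p_1}}$, and $$I:X\to\mathbb{K},\qquad I\big((f_k)_{k=0}^\infty\big)=\sum_{k=0}^\infty2^{-\alpha k}I^{N_k,N_k}f_k.$$ The numerical problem considered is $(B_X,\mathbb{K},I,\mathbb{K},\Lambda)$,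 where $\Lambda$ consists of all functionals $(f_l)_{l=0}^\infty\mapsto f_k(i,j)$ with $k\in\mathbb{N}_0$, $1\le i,j\le N_k$ (standard information). Algorithms and minimal errors. A numerical problem is a tuple $(F,G,S,K,\Lambda)$: $F$ a nonempty set, $G$ a Banach space, $S:F\to G$ a map, $K$ a nonempty set, $\Lambda$ a nonempty set of maps $F\to K$. A deterministic algorithm is a tuple $A=((L_i)_{i\ge1},(\tau_i)_{i\ge0},(\varphi_i)_{i\ge0})$ with $L_1\in\Lambda$, $\tau_0\in\{0,1\}$, $\varphi_0\in G$ and arbitrary maps $L_{i+1}:K^i\to\Lambda$, $\tau_i:K^i\to\{0,1\}$, $\varphi_i:K^i\to G$ $(i\ge1)$. For $f\in F$ let $\lambda_1=L_1$, $\lambda_i=L_i(\lambda_1(f),\dots,\lambda_{i-1}(f))$ $(i\ge2)$. $\mathrm{card}(A,f)$ is the smallest $n\ge0$ with $\tau_n(\lambda_1(f),\dots,\lambda_n(f))=1$ (for $n=0$: $\tau_0=1$), and $\infty$ if there is none. The output is $A(f)=\varphi_n(\lambda_1(f),\dots,\lambda_n(f))$ if $n=\mathrm{card}(A,f)<\infty$ (with $A(f)=\varphi_0$ for $n=0$) and $A(f)=\varphi_0$ if $\mathrm{card}(A,f)=\infty$. $A$ is non-adaptive if all $L_i$ and all $\tau_i$ are constant. A randomized algorithm is $A=((\Omega,\Sigma,\mathbb{P}),(A_\omega)_{\omega\in\Omega})$ with $(\Omega,\Sigma,\mathbb{P})$ a probability space and each $A_\omega$ a deterministic algorithm, such that for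 every $f\in F$ the map $\omega\mapsto\mathrm{card}(A_\omega,f)$ is measurable and $\omega\mapsto A_\omega(f)$ is Borel measurable and almost surely separably valued; it is non-adaptive if every $A_\omega$ is. For $n\in\mathbb{N}_0$, $e_n^{\mathrm{ran}}(S,F,G)$ (resp. $e_n^{\mathrm{ran-non}}(S,F,G)$) is the infimum of $\sup_{f\in F}\mathbb{E}\|S(f)-A_\omega(f)\|_G$ over all (resp. all non-adaptive) randomized algorithms with $\sup_{f\in F}\mathbb{E}\,\mathrm{card}(A_\omega,f)\le n$. If $G=\mathbb{K}$, $G$ is omitted from the notation. *)

theory Defs
  imports "HOL-Probability.Probability"
begin

section \<open>Deterministic and randomized algorithms\<close>

text \<open>
  A deterministic algorithm for a problem with inputs of type \<open>'f\<close>, information values in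
  \<open>'k\<close> and solutions in \<open>'g\<close>. The families \<open>L\<^sub>i\<^sub>+\<^sub>1 : K\<^sup>i \<rightarrow> \<Lambda>\<close>, \<open>\<tau>\<^sub>i : K\<^sup>i \<rightarrow> {0,1}\<close>,
  \<open>\<phi>\<^sub>i : K\<^sup>i \<rightarrow> G\<close> over all \<open>i \<ge> 0\<close> are each merged into one map on lists: \<open>L\<^sub>i\<^sub>+\<^sub>1\<close>, \<open>\<tau>\<^sub>i\<close>, \<open>\<phi>\<^sub>i\<close>
  are the restrictions of \<^term>\<open>query\<close>, \<^term>\<open>stop\<close>, \<^term>\<open>answer\<close> to lists of length \<open>i\<close>.
\<close>

datatype ('f, 'k, 'g) algorithm =
  Algorithm (query: "'k list \<Rightarrow> 'f \<Rightarrow> 'k") (stop: "'k list \<Rightarrow> bool") (answer: "'k list \<Rightarrow> 'g")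

definition det_algorithm :: "('f \<Rightarrow> 'k) set \<Rightarrow> ('f, 'k, 'g) algorithm \<Rightarrow> bool" where
  "det_algorithm \<Lambda> A \<longleftrightarrow> (\<forall>xs. query A xs \<in> \<Lambda>)"

definition nonadaptive :: "('f, 'k, 'g) algorithm \<Rightarrow> bool" where
  "nonadaptive A \<longleftrightarrow>
     (\<forall>xs ys. length xs = length ys \<longrightarrow> query A xs = query A ys \<and> stop A xs = stop A ys)"

primrec info :: "('f, 'k, 'g) algorithm \<Rightarrow> 'f \<Rightarrow> nat \<Rightarrow> 'k list" where
  "info A f 0 = []"
| "info A f (Suc n) = info A f n @ [query A (info A f n) f]"

definition cost :: "('f, 'k, 'g) algorithm \<Rightarrow> 'f \<Rightarrow> enat" where
  "cost A f = (if \<exists>n. stop A (info A f n) then enat (LEAST n. stop A (info A f n)) else \<infinity>)"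

definition result :: "('f, 'k, 'g) algorithm \<Rightarrow> 'f \<Rightarrow> 'g" where
  "result A f = (case cost A f of enat n \<Rightarrow> answer A (info A f n) | \<infinity> \<Rightarrow> answer A [])"

definition randomized_algorithm ::
    "'f set \<Rightarrow> ('f \<Rightarrow> 'k) set \<Rightarrow> 'w measure \<Rightarrow> ('w \<Rightarrow> ('f, 'k, 'g::banach) algorithm) \<Rightarrow> bool" where
  "randomized_algorithm F \<Lambda> M A \<longleftrightarrow>
     prob_space M \<and>
     (\<forall>\<omega>\<in>space M. det_algorithm \<Lambda> (A \<omega>)) \<and>
     (\<forall>f\<in>F. (\<lambda>\<omega>. cost (A \<omega>) f) \<in> measurable M (count_space UNIV) \<and>
            (\<lambda>\<omega>. result (A \<omega>) f) \<in> borel_measurable M \<and>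
            (\<exists>C. countable C \<and> (AE \<omega> in M. result (A \<omega>) f \<in> closure C)))"

definition expected_cost :: "'f set \<Rightarrow> 'w measure \<Rightarrow> ('w \<Rightarrow> ('f, 'k, 'g) algorithm) \<Rightarrow> ennreal" where
  "expected_cost F M A = (SUP f\<in>F. \<integral>\<^sup>+\<omega>. ennreal_of_enat (cost (A \<omega>) f) \<partial>M)"

definition expected_error ::
    "('f \<Rightarrow> 'g) \<Rightarrow> 'f set \<Rightarrow> 'w measure \<Rightarrow> ('w \<Rightarrow> ('f, 'k, 'g::banach) algorithm) \<Rightarrow> ennreal" where
  "expected_error S F M A = (SUP f\<in>F. \<integral>\<^sup>+\<omega>. ennreal (norm (S f - result (A \<omega>) f)) \<partial>M)"

text \<open>
  Minimal errors within the class of algorithms satisfying \<open>P\<close>. A definition cannot range over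
  probability spaces of all types, so sample points are taken from the type of deterministic
  algorithms; lemma \<open>min_error_le\<close> below shows that randomized algorithms over probability
  spaces of any other type do not give smaller errors.
\<close>

definition min_error ::
    "(('f, 'k, 'g) algorithm \<Rightarrow> bool) \<Rightarrow> ('f \<Rightarrow> 'g::banach) \<Rightarrow> 'f set \<Rightarrow> ('f \<Rightarrow> 'k) set \<Rightarrow> nat \<Rightarrow> ennreal"
  where
  "min_error P S F \<Lambda> n =
     Inf {expected_error S F M A |
            (M :: ('f, 'k, 'g) algorithm measure) (A :: _ \<Rightarrow> ('f, 'k, 'g) algorithm).
          randomized_algorithm F \<Lambda> M A \<and> (\<forall>\<omega>\<in>space M. P (A \<omega>)) \<and>
          expected_cost F M A \<le> of_nat n}"

definition e_ran ::
    "('f \<Rightarrow> 'g::banach) \<Rightarrow> 'f set \<Rightarrow> ('f \<Rightarrow> 'k) set \<Rightarrow> nat \<Rightarrow> ennreal" where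
  "e_ran = min_error (\<lambda>_. True)"

definition e_ran_non ::
    "('f \<Rightarrow> 'g::banach) \<Rightarrow> 'f set \<Rightarrow> ('f \<Rightarrow> 'k) set \<Rightarrow> nat \<Rightarrow> ennreal" where
  "e_ran_non = min_error nonadaptive"

text \<open>
  The proof pushes \<open>M\<close> forward along \<open>A\<close> to the finest \<open>\<sigma>\<close>-algebra making \<open>A\<close> measurable.
\<close>

lemma min_error_le:
  fixes M :: "'w measure" and A :: "'w \<Rightarrow> ('f, 'k, 'g::banach) algorithm"
  assumes ran: "randomized_algorithm F \<Lambda> M A" and P: "\<forall>\<omega>\<in>space M. P (A \<omega>)"
    and c: "expected_cost F M A \<le> of_nat n"
  shows "min_error P S F \<Lambda> n \<le> expected_error S F M A"
proof -
  define \<G> where "\<G> = {B. B \<subseteq> A ` space M \<and> A -` B \<inter> space M \<in> sets M}"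
  define N where "N = sigma (A ` space M) \<G>"
  have \<G>: "\<G> \<subseteq> Pow (A ` space M)" by (auto simp: \<G>_def)
  have spN: "space N = A ` space M" using \<G> by (simp add: N_def)
  have inN: "B \<in> sets N" if "B \<in> \<G>" for B using \<G> that by (simp add: N_def)
  have A: "A \<in> measurable M N"
    unfolding N_def by (rule measurable_measure_of) (use \<G> in \<open>auto simp: \<G>_def\<close>)
  have fromN: "h \<in> measurable N K" if h: "(\<lambda>\<omega>. h (A \<omega>)) \<in> measurable M K"
    for h and K :: "'z measure"
  proof (rule measurableI)
    show "h x \<in> space K" if "x \<in> space N" for x
      using that measurable_space[OF h] by (auto simp: spN)
    show "h -` B \<inter> space N \<in> sets N" if B: "B \<in> sets K" for B
    proof (rule inN)
      have "A -` (h -` B \<inter> space N) \<inter> space M = (\<lambda>\<omega>. h (A \<omega>)) -` B \<inter> space M"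
        by (auto simp: spN)
      then show "h -` B \<inter> space N \<in> \<G>"
        using measurable_sets[OF h B] by (auto simp: \<G>_def spN)
    qed
  qed
  define D where "D = distr M N A"
  have spD: "space D = A ` space M" by (simp add: D_def spN)
  have cost_m: "(\<lambda>a. cost a f) \<in> measurable N (count_space UNIV)" if "f \<in> F" for f
    using ran that by (intro fromN) (simp add: randomized_algorithm_def)
  have res_m: "(\<lambda>a. result a f) \<in> borel_measurable N" if "f \<in> F" for f
    using ran that by (intro fromN) (simp add: randomized_algorithm_def)
  have "\<exists>C. countable C \<and> (AE a in D. result a f \<in> closure C)" if f: "f \<in> F" for f
  proof -
    obtain C where C: "countable C" "AE \<omega> in M. result (A \<omega>) f \<in> closure C"
      using ran f unfolding randomized_algorithm_def by blast
    have "(\<lambda>a. result a f) -` closure C \<inter> space N \<in> sets N"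
      by (rule measurable_sets[OF res_m[OF f]]) simp
    moreover have "(\<lambda>a. result a f) -` closure C \<inter> space N
        = {a \<in> space N. result a f \<in> closure C}" by auto
    ultimately have "AE a in D. result a f \<in> closure C"
      unfolding D_def using C(2) by (subst AE_distr_iff[OF A]) auto
    with C(1) show ?thesis by blast
  qed
  moreover have "prob_space D"
    unfolding D_def using ran A by (auto simp: randomized_algorithm_def intro: prob_space.prob_space_distr)
  ultimately have "randomized_algorithm F \<Lambda> D (\<lambda>a. a)"
    using ran cost_m res_m unfolding randomized_algorithm_def spD by (auto simp: D_def)
  moreover have "expected_cost F D (\<lambda>a. a) = expected_cost F M A"
    unfolding expected_cost_def D_def
  proof (intro SUP_cong refl nn_integral_distr[OF A])
    fix f assume "f \<in> F"
    show "(\<lambda>a. ennreal_of_enat (cost a f)) \<in> borel_measurable (distr M N A)"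
      using measurable_compose[OF cost_m[OF \<open>f \<in> F\<close>], of ennreal_of_enat borel] by simp
  qed
  moreover have "expected_error S F D (\<lambda>a. a) = expected_error S F M A"
    unfolding expected_error_def D_def
  proof (intro SUP_cong refl nn_integral_distr[OF A])
    fix f assume "f \<in> F"
    have "(\<lambda>x. ennreal (norm (S f - x))) \<in> borel_measurable borel"
      by (intro measurable_compose[OF _ measurable_ennreal] borel_measurable_continuous_onI
          continuous_intros)
    then show "(\<lambda>a. ennreal (norm (S f - result a f))) \<in> borel_measurable (distr M N A)"
      using measurable_compose[OF res_m[OF \<open>f \<in> F\<close>]] by simp
  qed
  ultimately show ?thesis
    using P c unfolding min_error_def
    by (intro Inf_lower CollectI exI[of _ D] exI[of _ "\<lambda>a. a"]) (auto simp: spD)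
qed


section \<open>The spaces and the integration problem\<close>

text \<open>
  Norm of \<open>L\<^sub>p\<^sup>N\<close>; a function on \<open>{1,\<dots>,N}\<close> is given by its values there.
\<close>

definition L_norm :: "ennreal \<Rightarrow> nat \<Rightarrow> (nat \<Rightarrow> 'a::real_normed_vector) \<Rightarrow> real" where
  "L_norm p N f =
     (if p = \<infinity> then Max ((\<lambda>i. norm (f i)) ` {1..N})
      else ((1 / real N) * (\<Sum>i=1..N. norm (f i) powr enn2real p)) powr (1 / enn2real p))"

definition LL_norm ::
    "ennreal \<Rightarrow> ennreal \<Rightarrow> nat \<Rightarrow> nat \<Rightarrow> (nat \<Rightarrow> nat \<Rightarrow> 'a::real_normed_vector) \<Rightarrow> real" where
  "LL_norm p u N1 N2 f = L_norm p N1 (\<lambda>i. L_norm u N2 (f i))"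

definition in_ell :: "ennreal \<Rightarrow> (nat \<Rightarrow> real) \<Rightarrow> bool" where
  "in_ell p a \<longleftrightarrow>
     (if p = \<infinity> then bounded (range a) else summable (\<lambda>k. \<bar>a k\<bar> powr enn2real p))"

definition ell_norm :: "ennreal \<Rightarrow> (nat \<Rightarrow> real) \<Rightarrow> real" where
  "ell_norm p a =
     (if p = \<infinity> then (SUP k. \<bar>a k\<bar>)
      else (\<Sum>k. \<bar>a k\<bar> powr enn2real p) powr (1 / enn2real p))"

text \<open>
  Elements \<open>(f\<^sub>k)\<close> of \<open>X\<close>, where \<open>f\<^sub>k\<close> lives on \<open>{1,\<dots>,2\<^sup>k} \<times> {1,\<dots>,2\<^sup>k}\<close>; outside of these index
  ranges the values are normalised to \<open>0\<close>.
\<close>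

type_synonym 'k array_seq = "nat \<Rightarrow> nat \<Rightarrow> nat \<Rightarrow> 'k"

definition X_space :: "ennreal \<Rightarrow> ennreal \<Rightarrow> ennreal \<Rightarrow> 'k::real_normed_field array_seq set" where
  "X_space p u p1 =
     {f. (\<forall>k i j. \<not> (i \<in> {1..2^k} \<and> j \<in> {1..2^k}) \<longrightarrow> f k i j = 0) \<and>
         in_ell p1 (\<lambda>k. LL_norm p u (2^k) (2^k) (f k))}"

definition X_norm :: "ennreal \<Rightarrow> ennreal \<Rightarrow> ennreal \<Rightarrow> 'k::real_normed_field array_seq \<Rightarrow> real" where
  "X_norm p u p1 f = ell_norm p1 (\<lambda>k. LL_norm p u (2^k) (2^k) (f k))"

definition X_ball :: "ennreal \<Rightarrow> ennreal \<Rightarrow> ennreal \<Rightarrow> 'k::real_normed_field array_seq set" where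
  "X_ball p u p1 = {f \<in> X_space p u p1. X_norm p u p1 f \<le> 1}"

definition mean_op :: "nat \<Rightarrow> nat \<Rightarrow> (nat \<Rightarrow> nat \<Rightarrow> 'k::real_normed_field) \<Rightarrow> 'k" where
  "mean_op N1 N2 f = (\<Sum>i=1..N1. \<Sum>j=1..N2. f i j) / of_nat (N1 * N2)"

definition I_op :: "real \<Rightarrow> 'k::real_normed_field array_seq \<Rightarrow> 'k" where
  "I_op \<alpha> f = (\<Sum>k. (2 powr (- \<alpha> * real k)) *\<^sub>R mean_op (2^k) (2^k) (f k))"

definition std_info :: "('k array_seq \<Rightarrow> 'k) set" where
  "std_info = {(\<lambda>f. f k i j) | k i j. i \<in> {1..2^k} \<and> j \<in> {1..2^k}}"

end

theory Submission
  imports Defs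
begin

text \<open>
  Write \<open>a = 1/p\<close>, \<open>b = 1/u\<close>, so \<open>1/2 < a \<le> 1\<close> and \<open>0 \<le> b < 1/2\<close>, and \<open>N = 2^k\<close>. With \<open>n\<close> samples
  the levels with \<open>N\<^sup>2\<close> below a small multiple of \<open>n\<close> can be integrated exactly, and the first
  level that is too large to be read completely, \<open>N\<^sup>2 \<approx> n\<close>, decides the size of both minimal errors. Up to constants
  \<open>e_ran(n) \<approx> n^(-\<alpha>/2) (n^(-1/2) + n^((a+b)/2-1))\<close> and \<open>e_ran_non(n) \<approx> n^(-\<alpha>/2) n^(a/2-3/4)\<close>.
  The quotient of these orders is \<open>n^(1/4-a/2) + n^(b/2-1/4)\<close>, and multiplying terms by
  nonnegative powers of \<open>log (n+1) \<ge> 1\<close> only weakens an upper bound.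

  Lower bounds. An algorithm is tested on a finite family of inputs living on a single level
  (\<open>min_error_ge\<close>), and it has to leave half of the \<open>N\<^sup>2\<close> entries unread. If all entries are random
  signs, the unread signs contribute an error of about \<open>N\<close> to a sum that is divided by \<open>N\<^sup>2\<close>
  (\<open>adaptive_lower_bound_signs\<close>). A single spike of height \<open>N^(a+b)\<close> is missed with probability at
  least one half (\<open>adaptive_lower_bound_spike\<close>). Random signs of size \<open>N^a\<close> filling one random row defeat
  every nonadaptive algorithm, which leaves half of an average row unread
  (\<open>nonadaptive_lower_bound\<close>); an adaptive algorithm would find that row and read it
  completely, and this is the source of the gap.

  Upper bounds. Every entry is included independently with some probability \<open>r\<close> and weighted by
  \<open>1/r\<close>. On level \<open>k\<close> the variance is a multiple of the sum of \<open>|f(i,j)|\<^sup>2 (1/r - 1)\<close>. With a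
  constant rate \<open>r = q\<close> one obtains \<open>nonadaptive_upper_bound\<close>. The adaptive
  algorithm first takes a pilot sample with rate \<open>q\<close>, estimates the quadratic mean \<open>s\<^sub>i\<close> of each
  row, and then samples row \<open>i\<close> with rate \<open>q (1 + s\<^sub>i)\<close>. The mean of the row norms is at most \<open>1\<close>, so
  the cost stays of order \<open>q N\<^sup>2\<close>, while the squared row norms in the variance are divided by
  \<open>1 + s\<^sub>i\<close> and turn into first powers. Rows whose norm is underestimated must be spiky; their
  contribution is controlled by Chebyshev's inequality after truncating large entries
  (\<open>row_bias\<close>), and it has the order of the error caused by an unseen spike.

  Because \<open>\<alpha> > 1\<close>, the rates \<open>q\<close> may decay on the higher levels slightly faster than the number
  \<open>4^k\<close> of entries grows, and the contributions of these levels to cost and variance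
  still form convergent geometric series (\<open>sum_rate_le\<close>, \<open>level_decay\<close>).
\<close>

section \<open>Two-stage algorithms\<close>

text \<open>
  The points of \<open>L\<close> are observed first, and their values determine through \<open>G\<close> the list of points
  observed afterwards. Algorithms must also answer queries on lists that no run produces; the
  point \<open>dflt\<close> is asked there.
\<close>

definition two_stage ::
    "('x \<Rightarrow> 'f \<Rightarrow> 'k) \<Rightarrow> 'x \<Rightarrow> 'x list \<Rightarrow> ('k list \<Rightarrow> 'x list) \<Rightarrow> ('k list \<Rightarrow> 'k list \<Rightarrow> 'g)
      \<Rightarrow> ('f, 'k, 'g) algorithm" where
  "two_stage obs dflt L G \<phi> =
     (let total = (\<lambda>xs. L @ G (take (length L) xs)) in
      Algorithm
        (\<lambda>xs. obs (if length xs < length (total xs) then total xs ! length xs else dflt))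
        (\<lambda>xs. length (total xs) \<le> length xs)
        (\<lambda>xs. \<phi> (take (length L) xs) (drop (length L) xs)))"

lemma two_stage_sel:
  "query (two_stage obs dflt L G \<phi>) xs =
     (let ys = L @ G (take (length L) xs) in obs (if length xs < length ys then ys ! length xs else dflt))"
  "stop (two_stage obs dflt L G \<phi>) xs \<longleftrightarrow> length L + length (G (take (length L) xs)) \<le> length xs"
  "answer (two_stage obs dflt L G \<phi>) xs = \<phi> (take (length L) xs) (drop (length L) xs)"
  by (simp_all add: two_stage_def Let_def)

lemma info_two_stage:
  assumes "n \<le> length (L @ G (map (\<lambda>x. obs x f) L))"
  shows "info (two_stage obs dflt L G \<phi>) f n
    = map (\<lambda>x. obs x f) (take n (L @ G (map (\<lambda>x. obs x f) L)))"
  using assms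
proof (induction n)
  case 0
  then show ?case by simp
next
  case (Suc n)
  let ?ys = "L @ G (map (\<lambda>x. obs x f) L)"
  let ?A = "two_stage obs dflt L G \<phi>"
  have IH: "info ?A f n = map (\<lambda>x. obs x f) (take n ?ys)"
    using Suc by simp
  have n: "n < length ?ys" using Suc by simp
  have len: "length (info ?A f n) = n" using n by (simp add: IH)
  have "query ?A (info ?A f n) f = obs (?ys ! n) f"
  proof (cases "n < length L")
    case True
    then show ?thesis
      by (simp add: two_stage_sel Let_def nth_append len)
  next
    case False
    then have "take (length L) (info ?A f n) = map (\<lambda>x. obs x f) L"
      by (simp add: IH take_map)
    then show ?thesis
      using n by (simp add: len two_stage_sel Let_def)
  qed
  then show ?case
    using n by (simp only: info.simps IH take_Suc_conv_app_nth) simp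
qed

lemma cost_two_stage:
  "cost (two_stage obs dflt L G \<phi>) f = enat (length L + length (G (map (\<lambda>x. obs x f) L)))"
proof -
  let ?ys = "L @ G (map (\<lambda>x. obs x f) L)"
  let ?A = "two_stage obs dflt L G \<phi>"
  have tk: "take (length L) (info ?A f n) = map (\<lambda>x. obs x f) L"
    if "n \<le> length ?ys" "length L \<le> n" for n
    using that by (simp add: info_two_stage take_map)
  have st: "stop ?A (info ?A f (length ?ys))"
    using tk[of "length ?ys"] info_two_stage[of "length ?ys" L G obs f dflt \<phi>]
    by (simp add: two_stage_sel)
  have not: "length ?ys \<le> n" if "stop ?A (info ?A f n)" for n
  proof (rule ccontr)
    assume "\<not> length ?ys \<le> n"
    then have n: "n < length ?ys" by simp
    have len: "length (info ?A f n) = n"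
      using n by (simp add: info_two_stage)
    have s: "length L + length (G (take (length L) (info ?A f n))) \<le> length (info ?A f n)"
      using that by (simp add: two_stage_sel)
    then have "length L \<le> n" unfolding len by simp
    with tk[of n] n s len show False by simp
  qed
  have "(LEAST n. stop ?A (info ?A f n)) = length ?ys"
    by (rule Least_equality) (use st not in auto)
  then show ?thesis
    using st unfolding cost_def by auto
qed

lemma result_two_stage:
  "result (two_stage obs dflt L G \<phi>) f
    = \<phi> (map (\<lambda>x. obs x f) L) (map (\<lambda>x. obs x f) (G (map (\<lambda>x. obs x f) L)))"
  by (simp add: result_def cost_two_stage info_two_stage)
     (simp add: two_stage_sel)

lemma det_algorithm_two_stage:
  assumes "\<And>x. x \<in> set L \<Longrightarrow> obs x \<in> \<Lambda>" "\<And>vs x. x \<in> set (G vs) \<Longrightarrow> obs x \<in> \<Lambda>" "obs dflt \<in> \<Lambda>"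
  shows "det_algorithm \<Lambda> (two_stage obs dflt L G \<phi>)"
proof -
  have "obs (ys ! i) \<in> \<Lambda>" if "i < length ys" "ys = L @ G vs" for ys vs i
  proof -
    have "ys ! i \<in> set L \<union> set (G vs)" using nth_mem[OF that(1)] that(2) by simp
    then show ?thesis using assms by blast
  qed
  then show ?thesis
    using assms(3) unfolding det_algorithm_def two_stage_sel Let_def by auto
qed

lemma nonadaptive_two_stage: "nonadaptive (two_stage obs dflt L (\<lambda>_. ys) \<phi>)"
  by (simp add: nonadaptive_def two_stage_sel)


section \<open>Independent finite random variables\<close>

lemma expectation_pair_pmf_finite:
  fixes h :: "'a \<times> 'b \<Rightarrow> real"
  assumes "finite (set_pmf p)" "finite (set_pmf q)"
  shows "measure_pmf.expectation (pair_pmf p q) h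
    = measure_pmf.expectation p (\<lambda>x. measure_pmf.expectation q (\<lambda>y. h (x, y)))"
  unfolding pair_pmf_def using assms
  by (subst pmf_expectation_bind[of "set_pmf p"])
     (auto simp: pmf_expectation_bind[of "set_pmf q"] integral_measure_pmf[of "set_pmf p"]
        integral_measure_pmf[of "set_pmf q"])

lemma finite_set_Pi_pmf:
  assumes "finite A" "\<And>x. x \<in> A \<Longrightarrow> finite (set_pmf (p x))"
  shows "finite (set_pmf (Pi_pmf A d p))"
  by (rule finite_subset[OF set_Pi_pmf_subset'[OF assms(1)]])
     (use assms in \<open>auto intro!: finite_PiE_dflt\<close>)

text \<open>
  Independent centred variables are orthogonal, so the squares of a sum of vectors with such
  coefficients add up. This is the only use of independence.
\<close>

lemma expectation_norm_sum_sq_Pi_pmf: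
  fixes Z :: "'a \<Rightarrow> 'b \<Rightarrow> real" and v :: "'a \<Rightarrow> 'v::real_inner"
  assumes "finite A" "\<And>x. x \<in> A \<Longrightarrow> finite (set_pmf (p x))"
    "\<And>x. x \<in> A \<Longrightarrow> measure_pmf.expectation (p x) (Z x) = 0"
  shows "measure_pmf.expectation (Pi_pmf A d p) (\<lambda>\<omega>. (norm (\<Sum>x\<in>A. Z x (\<omega> x) *\<^sub>R v x))\<^sup>2)
    = (\<Sum>x\<in>A. measure_pmf.expectation (p x) (\<lambda>y. (Z x y)\<^sup>2) * (norm (v x))\<^sup>2)"
  using assms
proof (induction A rule: finite_induct)
  case empty
  then show ?case by simp
next
  case (insert a A)
  let ?P = "Pi_pmf A d p"
  let ?S = "\<lambda>\<omega>. \<Sum>x\<in>A. Z x (\<omega> x) *\<^sub>R v x"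
  have finP: "finite (set_pmf ?P)" using insert by (intro finite_set_Pi_pmf) auto
  have fina: "finite (set_pmf (p a))" using insert by auto
  note int = integrable_measure_pmf_finite[OF finP] integrable_measure_pmf_finite[OF fina]
  have S_upd: "(\<Sum>x\<in>insert a A. Z x (fun_upd \<omega> a y x) *\<^sub>R v x) = Z a y *\<^sub>R v a + ?S \<omega>" for \<omega> y
  proof -
    have "(\<Sum>x\<in>A. Z x (fun_upd \<omega> a y x) *\<^sub>R v x) = ?S \<omega>"
      using insert(2) by (intro sum.cong) auto
    then show ?thesis using insert(1,2) by simp
  qed
  have sq: "(norm (Z a y *\<^sub>R v a + ?S \<omega>))\<^sup>2
      = (Z a y)\<^sup>2 * (norm (v a))\<^sup>2 + Z a y * (2 * (v a \<bullet> ?S \<omega>)) + (norm (?S \<omega>))\<^sup>2" for y \<omega>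
    unfolding power2_norm_eq_inner
    by (simp add: inner_add_left inner_add_right inner_commute power2_eq_square algebra_simps)
  have "measure_pmf.expectation (Pi_pmf (insert a A) d p)
          (\<lambda>\<omega>. (norm (\<Sum>x\<in>insert a A. Z x (\<omega> x) *\<^sub>R v x))\<^sup>2)
      = measure_pmf.expectation (pair_pmf (p a) ?P)
          (\<lambda>(y, \<omega>). (norm (\<Sum>x\<in>insert a A. Z x (fun_upd \<omega> a y x) *\<^sub>R v x))\<^sup>2)"
    by (subst Pi_pmf_insert[OF insert(1,2)]) (simp add: case_prod_unfold)
  also have "\<dots> = measure_pmf.expectation (pair_pmf (p a) ?P)
          (\<lambda>(y, \<omega>). (norm (Z a y *\<^sub>R v a + ?S \<omega>))\<^sup>2)"
    unfolding S_upd ..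
  also have "\<dots> = measure_pmf.expectation (p a) (\<lambda>y. measure_pmf.expectation ?P
          (\<lambda>\<omega>. (Z a y)\<^sup>2 * (norm (v a))\<^sup>2 + Z a y * (2 * (v a \<bullet> ?S \<omega>)) + (norm (?S \<omega>))\<^sup>2))"
    by (subst expectation_pair_pmf_finite[OF fina finP]) (simp add: sq)
  also have "\<dots> = measure_pmf.expectation (p a) (\<lambda>y. (Z a y)\<^sup>2) * (norm (v a))\<^sup>2
      + measure_pmf.expectation ?P (\<lambda>\<omega>. (norm (?S \<omega>))\<^sup>2)"
    using insert.prems(2)[of a] by (simp add: int)
  also have "\<dots> = (\<Sum>x\<in>insert a A.
      measure_pmf.expectation (p x) (\<lambda>y. (Z x y)\<^sup>2) * (norm (v x))\<^sup>2)"
    using insert by simp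
  finally show ?case .
qed

lemma expectation_Pi_pmf_component:
  fixes h :: "'b \<Rightarrow> real"
  assumes "finite A" "x \<in> A"
  shows "measure_pmf.expectation (Pi_pmf A d p) (\<lambda>\<omega>. h (\<omega> x)) = measure_pmf.expectation (p x) h"
proof -
  have "measure_pmf.expectation (p x) h = measure_pmf.expectation (map_pmf (\<lambda>\<omega>. \<omega> x) (Pi_pmf A d p)) h"
    using assms by (simp add: Pi_pmf_component)
  then show ?thesis by simp
qed

section \<open>Sampling with random thresholds\<close>

lemma expectation_threshold:
  fixes h :: "bool \<Rightarrow> real"
  assumes "m \<le> M" "1 \<le> M"
  shows "measure_pmf.expectation (pmf_of_set {..<M}) (\<lambda>U::nat. h (U < m))
    = h True * (real m / real M) + h False * (1 - real m / real M)"
proof -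
  have "measure_pmf.expectation (pmf_of_set {..<M}) (\<lambda>U::nat. h (U < m))
      = (\<Sum>U<M. h (U < m)) / real M"
    using assms by (subst integral_pmf_of_set) (auto simp: lessThan_empty_iff)
  also have "(\<Sum>U<M. h (U < m)) = (\<Sum>U<m. h (U < m)) + (\<Sum>U=m..<M. h (U < m))"
    using assms by (subst sum.atLeastLessThan_concat[symmetric, of 0 m M, unfolded atLeast0LessThan])
      (auto simp: atLeast0LessThan)
  also have "(\<Sum>U<m. h (U < m)) = real m * h True" by simp
  also have "(\<Sum>U=m..<M. h (U < m)) = (real M - real m) * h False"
    using assms by (simp add: of_nat_diff)
  finally show ?thesis
    using assms by (simp add: field_simps)
qed

text \<open>
  The information available after the pilot sample \<open>B\<close>. Replacing unseen values by \<open>0\<close> turns it into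
  a function on all points, so that threshold rules need not mention lists of values.
\<close>

definition known :: "('x \<Rightarrow> 'f \<Rightarrow> 'k::zero) \<Rightarrow> ('x \<Rightarrow> bool) \<Rightarrow> 'f \<Rightarrow> 'x \<Rightarrow> 'k" where
  "known obs B f x = (if B x then obs x f else 0)"

text \<open>
  A pilot sample \<open>B\<close> is drawn and observed; it fixes a threshold \<open>t(x)\<close> between \<open>1\<close> and \<open>M\<close> for every
  point \<open>x\<close>. In the second stage \<open>x\<close> is observed if a uniform random number below \<open>M\<close> is less than
  \<open>t(x)\<close>, that is, with probability \<open>t(x)/M\<close>, and its value is multiplied by \<open>M/t(x)\<close>. Given \<open>B\<close>, the
  estimator is unbiased for the weighted sum, and its variance is the sum appearing in the
  hypothesis on \<open>\<epsilon>\<close>. Probabilities with the common denominator \<open>M\<close> keep the sample space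
  discrete, which makes all measurability conditions trivial. A threshold rule that ignores the
  observed values gives a nonadaptive algorithm.
\<close>

lemma sampling_scheme:
  fixes obs :: "'x \<Rightarrow> 'f \<Rightarrow> 'k::euclidean_space" and w :: "'x \<Rightarrow> real"
    and thr :: "('x \<Rightarrow> bool) \<Rightarrow> ('x \<Rightarrow> 'k) \<Rightarrow> 'x \<Rightarrow> nat" and P :: "('x \<Rightarrow> bool) pmf"
  assumes J: "finite J" "dflt \<in> J" "\<And>x. x \<in> J \<Longrightarrow> obs x \<in> \<Lambda>"
    and P: "finite (set_pmf P)" "\<And>B x. B \<in> set_pmf P \<Longrightarrow> B x \<Longrightarrow> x \<in> J"
    and thr: "\<And>B h x. 1 \<le> thr B h x \<and> thr B h x \<le> M"
    and Q: "Q = (\<lambda>_. True) \<or> Q = nonadaptive \<and> (\<forall>B h h'. thr B h = thr B h')"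
    and cost: "\<And>f. f \<in> F \<Longrightarrow> measure_pmf.expectation P
      (\<lambda>B. (\<Sum>x\<in>J. of_bool (B x)) + (\<Sum>x\<in>J. real (thr B (known obs B f) x) / real M)) \<le> real n"
    and var: "\<And>f. f \<in> F \<Longrightarrow> measure_pmf.expectation P
      (\<lambda>B. \<Sum>x\<in>J. (w x)\<^sup>2 * (norm (obs x f))\<^sup>2 * (real M / real (thr B (known obs B f) x) - 1)) \<le> \<epsilon>\<^sup>2"
    and \<epsilon>: "\<epsilon> > 0"
    and tail: "\<And>f. f \<in> F \<Longrightarrow> norm (S f - (\<Sum>x\<in>J. w x *\<^sub>R obs x f)) \<le> \<delta>"
    and \<delta>: "\<delta> \<ge> 0"
  shows "min_error Q S F \<Lambda> n \<le> ennreal (\<epsilon> + \<delta>)"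
proof -
  obtain Jl where Jl: "distinct Jl" "set Jl = J"
    using finite_distinct_list[OF J(1)] by auto
  have M: "1 \<le> M" using thr by (meson le_trans)
  have thr0: "0 < thr B h x" "thr B h x \<le> M" for B h x
    using thr[of B h x] by auto
  define L where "L = (\<lambda>B. filter B Jl)"
  define lookup where "lookup = (\<lambda>B vs x. case map_of (zip (L B) vs) x of None \<Rightarrow> (0::'k) | Some v \<Rightarrow> v)"
  define G where "G = (\<lambda>(B, U) vs. filter (\<lambda>x. U x < thr B (lookup B vs) x) Jl)"
  define \<phi> where "\<phi> = (\<lambda>(B, U) vs us. \<Sum>(x, v) \<leftarrow> zip (G (B, U) vs) us.
      (w x * real M / real (thr B (lookup B vs) x)) *\<^sub>R (v::'k))"
  define A where "A = (\<lambda>\<omega>. two_stage obs dflt (L (fst \<omega>)) (G \<omega>) (\<phi> \<omega>))"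
  define R where "R = Pi_pmf J 0 (\<lambda>_. pmf_of_set {..<M})"
  define D where "D = pair_pmf P R"
  have finM: "finite (set_pmf (pmf_of_set {..<M}))"
    using M by (subst set_pmf_of_set) (auto simp: lessThan_empty_iff)
  have finR: "finite (set_pmf R)"
    unfolding R_def by (intro finite_set_Pi_pmf J finM)
  have lookup: "lookup B (map (\<lambda>x. obs x f) (L B)) = known obs B f" if "B \<in> set_pmf P" for B f
    using P(2)[OF that] by (auto simp: lookup_def known_def L_def map_of_zip_map Jl fun_eq_iff)
  let ?t = "\<lambda>B f x. thr B (known obs B f) x"
  have cost_A: "cost (A (B, U)) f = enat (length (L B) + length (filter (\<lambda>x. U x < ?t B f x) Jl))"
    if "B \<in> set_pmf P" for B U f
    by (simp add: A_def cost_two_stage G_def lookup[OF that])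
  have result_A: "result (A (B, U)) f
      = (\<Sum>x\<in>J. (w x * real M / real (?t B f x) * of_bool (U x < ?t B f x)) *\<^sub>R obs x f)"
    if "B \<in> set_pmf P" for B U f
  proof -
    have "result (A (B, U)) f = (\<Sum>x \<leftarrow> filter (\<lambda>x. U x < ?t B f x) Jl.
        (w x * real M / real (?t B f x)) *\<^sub>R obs x f)"
      by (simp add: A_def result_two_stage G_def \<phi>_def lookup[OF that] zip_map2 o_def
          zip_same_conv_map case_prod_unfold)
    also have "\<dots> = (\<Sum>x \<in> {x \<in> J. U x < ?t B f x}. (w x * real M / real (?t B f x)) *\<^sub>R obs x f)"
      using Jl by (subst sum_list_distinct_conv_sum_set) auto
    also have "\<dots> = (\<Sum>x\<in>J. (w x * real M / real (?t B f x) * of_bool (U x < ?t B f x)) *\<^sub>R obs x f)"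
      using J(1) by (intro sum.mono_neutral_cong_left) auto
    finally show ?thesis .
  qed
  have ran: "randomized_algorithm F \<Lambda> (measure_pmf D) A"
    unfolding randomized_algorithm_def
  proof (intro conjI ballI)
    show "prob_space (measure_pmf D)" by (rule measure_pmf.prob_space_axioms)
    show "det_algorithm \<Lambda> (A \<omega>)" for \<omega>
      unfolding A_def using J Jl
      by (intro det_algorithm_two_stage) (auto simp: L_def G_def case_prod_unfold)
    show "\<exists>C. countable C \<and> (AE \<omega> in measure_pmf D. result (A \<omega>) f \<in> closure C)" for f
      by (intro exI[of _ "(\<lambda>\<omega>. result (A \<omega>) f) ` set_pmf D"])
         (auto simp: AE_measure_pmf_iff intro!: subsetD[OF closure_subset])
  qed auto
  have QA: "\<forall>\<omega>\<in>space (measure_pmf D). Q (A \<omega>)"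
    using Q
  proof
    assume Qn: "Q = nonadaptive \<and> (\<forall>B h h'. thr B h = thr B h')"
    have "G \<omega> vs = G \<omega> []" for \<omega> vs
      using Qn unfolding G_def case_prod_unfold by metis
    then have "G \<omega> = (\<lambda>_. G \<omega> [])" for \<omega>
      by blast
    then show ?thesis
      using Qn unfolding A_def by (metis nonadaptive_two_stage)
  qed auto
  have EU: "measure_pmf.expectation R (\<lambda>U. h (U x < m)) =
      h True * (real m / real M) + h False * (1 - real m / real M)"
    if "m \<le> M" "x \<in> J" for m x and h :: "bool \<Rightarrow> real"
    unfolding R_def using expectation_Pi_pmf_component[OF J(1) that(2), of 0 "\<lambda>_. pmf_of_set {..<M}" "\<lambda>U. h (U < m)"]
      expectation_threshold[OF that(1) M, of h] by simp
  note intR = integrable_measure_pmf_finite[OF finR] and intP = integrable_measure_pmf_finite[OF P(1)]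
  have ec: "expected_cost F (measure_pmf D) A \<le> of_nat n"
    unfolding expected_cost_def
  proof (rule SUP_least)
    fix f assume f: "f \<in> F"
    have 1: "(\<integral>\<^sup>+U. ennreal_of_enat (cost (A (B, U)) f) \<partial>R)
        = ennreal ((\<Sum>x\<in>J. of_bool (B x)) + (\<Sum>x\<in>J. real (?t B f x) / real M))"
      if B: "B \<in> set_pmf P" for B
    proof -
      have "real (length (filter q Jl)) = (\<Sum>x\<in>J. of_bool (q x))" for q
        using Jl J(1) by (simp add: distinct_length_filter Int_def sum_of_bool_eq conj_commute)
      then have c: "ennreal_of_enat (cost (A (B, U)) f)
          = ennreal ((\<Sum>x\<in>J. of_bool (B x)) + (\<Sum>x\<in>J. of_bool (U x < ?t B f x)))" for U
        unfolding cost_A[OF B] ennreal_of_enat_enat L_def ennreal_of_nat_eq_real_of_nat by simp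
      have "(\<integral>\<^sup>+U. ennreal_of_enat (cost (A (B, U)) f) \<partial>R)
        = ennreal (measure_pmf.expectation R (\<lambda>U. (\<Sum>x\<in>J. of_bool (B x)) + (\<Sum>x\<in>J. of_bool (U x < ?t B f x))))"
        unfolding c by (intro nn_integral_eq_integral intR) (auto intro!: AE_I2 add_nonneg_nonneg sum_nonneg)
      also have "measure_pmf.expectation R (\<lambda>U. (\<Sum>x\<in>J. of_bool (B x)) + (\<Sum>x\<in>J. of_bool (U x < ?t B f x)))
        = (\<Sum>x\<in>J. of_bool (B x) :: real) + (\<Sum>x\<in>J. measure_pmf.expectation R (\<lambda>U. of_bool (U x < ?t B f x)))"
        by (subst Bochner_Integration.integral_add[OF intR intR],
            subst Bochner_Integration.integral_sum[OF intR]) simp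
      also have "(\<Sum>x\<in>J. measure_pmf.expectation R (\<lambda>U. of_bool (U x < ?t B f x)))
        = (\<Sum>x\<in>J. real (?t B f x) / real M)"
        using EU[of _ _ of_bool] thr by (intro sum.cong) auto
      finally show ?thesis .
    qed
    have "(\<integral>\<^sup>+\<omega>. ennreal_of_enat (cost (A \<omega>) f) \<partial>D)
        = (\<integral>\<^sup>+B. \<integral>\<^sup>+U. ennreal_of_enat (cost (A (B, U)) f) \<partial>R \<partial>P)"
      unfolding D_def by (rule nn_integral_pair_pmf')
    also have "\<dots> = (\<integral>\<^sup>+B. ennreal ((\<Sum>x\<in>J. of_bool (B x)) + (\<Sum>x\<in>J. real (?t B f x) / real M)) \<partial>P)"
      by (intro nn_integral_cong_AE) (auto simp: AE_measure_pmf_iff 1)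
    also have "\<dots> = ennreal (measure_pmf.expectation P
        (\<lambda>B. (\<Sum>x\<in>J. of_bool (B x)) + (\<Sum>x\<in>J. real (?t B f x) / real M)))"
      by (intro nn_integral_eq_integral intP) (auto intro!: AE_I2 add_nonneg_nonneg sum_nonneg)
    also have "\<dots> \<le> ennreal (real n)" by (intro ennreal_leI cost f)
    finally show "(\<integral>\<^sup>+\<omega>. ennreal_of_enat (cost (A \<omega>) f) \<partial>D) \<le> of_nat n"
      by (simp add: ennreal_of_nat_eq_real_of_nat)
  qed
  have ee: "expected_error S F (measure_pmf D) A \<le> ennreal (\<epsilon> + \<delta>)"
    unfolding expected_error_def
  proof (rule SUP_least)
    fix f assume f: "f \<in> F"
    let ?V = "\<lambda>B. \<Sum>x\<in>J. (w x)\<^sup>2 * (norm (obs x f))\<^sup>2 * (real M / real (?t B f x) - 1)"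
    have Vpos: "?V B \<ge> 0" for B
      using thr0 by (intro sum_nonneg mult_nonneg_nonneg) (auto simp: le_divide_eq)
    \<comment> \<open>As \<open>y \<le> (y\<^sup>2/\<epsilon> + \<epsilon>)/2\<close>, this affine function of the variance bounds the mean error.\<close>
    define b where "b = (\<lambda>v. (v / \<epsilon> + \<epsilon>) / 2 + \<delta>)"
    have 1: "(\<integral>\<^sup>+U. ennreal (norm (S f - result (A (B, U)) f)) \<partial>R) \<le> ennreal (b (?V B))"
      if B: "B \<in> set_pmf P" for B
    proof -
      define Z where "Z = (\<lambda>x (U::nat). 1 - real M / real (?t B f x) * of_bool (U < ?t B f x))"
      let ?E = "\<lambda>U. \<Sum>x\<in>J. Z x (U x) *\<^sub>R (w x *\<^sub>R obs x f)"
      have t: "?t B f x \<noteq> 0" "?t B f x \<le> M" for x using thr0[of B "known obs B f" x] by auto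
      have pt: "norm (S f - result (A (B, U)) f) \<le> b ((norm (?E U))\<^sup>2)" for U
      proof -
        have "?E U = (\<Sum>x\<in>J. w x *\<^sub>R obs x f) - result (A (B, U)) f"
          unfolding result_A[OF B] Z_def sum_subtractf[symmetric]
          by (intro sum.cong refl) (simp add: algebra_simps scaleR_diff_left)
        then have "S f - result (A (B, U)) f = (S f - (\<Sum>x\<in>J. w x *\<^sub>R obs x f)) + ?E U"
          by simp
        then have "norm (S f - result (A (B, U)) f)
            \<le> norm (S f - (\<Sum>x\<in>J. w x *\<^sub>R obs x f)) + norm (?E U)"
          by (metis norm_triangle_ineq)
        with tail[OF f] have "norm (S f - result (A (B, U)) f) \<le> \<delta> + norm (?E U)"
          by linarith
        moreover have "norm (?E U) \<le> ((norm (?E U))\<^sup>2 / \<epsilon> + \<epsilon>) / 2"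
          using sum_squares_bound[of "norm (?E U)" \<epsilon>] \<epsilon> by (simp add: field_simps power2_eq_square)
        ultimately show ?thesis unfolding b_def by linarith
      qed
      have "measure_pmf.expectation R (\<lambda>U. (norm (?E U))\<^sup>2)
          = (\<Sum>x\<in>J. measure_pmf.expectation (pmf_of_set {..<M}) (\<lambda>y. (Z x y)\<^sup>2) * (norm (w x *\<^sub>R obs x f))\<^sup>2)"
        unfolding R_def
      proof (rule expectation_norm_sum_sq_Pi_pmf[OF J(1) finM])
        show "measure_pmf.expectation (pmf_of_set {..<M}) (Z x) = 0" for x
          using expectation_threshold[of "?t B f x" M "\<lambda>b. 1 - real M / real (?t B f x) * of_bool b"] t[of x] M
          unfolding Z_def by (simp add: field_simps)
      qed
      also have "\<dots> = ?V B"
      proof (rule sum.cong[OF refl])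
        fix x
        have "measure_pmf.expectation (pmf_of_set {..<M}) (\<lambda>y. (Z x y)\<^sup>2)
            = (1 - real M / real (?t B f x))\<^sup>2 * (real (?t B f x) / real M) + (1 - real (?t B f x) / real M)"
          using expectation_threshold[of "?t B f x" M "\<lambda>b. (1 - real M / real (?t B f x) * of_bool b)\<^sup>2"] t[of x] M
          unfolding Z_def by simp
        also have "\<dots> = real M / real (?t B f x) - 1"
          using t[of x] M by (simp add: divide_simps) (simp add: algebra_simps power2_eq_square)
        finally have "measure_pmf.expectation (pmf_of_set {..<M}) (\<lambda>y. (Z x y)\<^sup>2)
            = real M / real (?t B f x) - 1" .
        then show "measure_pmf.expectation (pmf_of_set {..<M}) (\<lambda>y. (Z x y)\<^sup>2) * (norm (w x *\<^sub>R obs x f))\<^sup>2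
          = (w x)\<^sup>2 * (norm (obs x f))\<^sup>2 * (real M / real (?t B f x) - 1)"
          by (simp add: power_mult_distrib)
      qed
      finally have EV: "measure_pmf.expectation R (\<lambda>U. (norm (?E U))\<^sup>2) = ?V B" .
      have "(\<integral>\<^sup>+U. ennreal (norm (S f - result (A (B, U)) f)) \<partial>R) \<le> (\<integral>\<^sup>+U. ennreal (b ((norm (?E U))\<^sup>2)) \<partial>R)"
        by (intro nn_integral_mono ennreal_leI pt)
      also have "\<dots> = ennreal (measure_pmf.expectation R (\<lambda>U. b ((norm (?E U))\<^sup>2)))"
        using \<epsilon> \<delta> by (intro nn_integral_eq_integral intR) (auto simp: b_def intro!: AE_I2)
      also have "measure_pmf.expectation R (\<lambda>U. b ((norm (?E U))\<^sup>2)) = b (?V B)"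
        unfolding b_def EV[symmetric] by (simp add: intR)
      finally show ?thesis .
    qed
    have "(\<integral>\<^sup>+\<omega>. ennreal (norm (S f - result (A \<omega>) f)) \<partial>D)
        = (\<integral>\<^sup>+B. \<integral>\<^sup>+U. ennreal (norm (S f - result (A (B, U)) f)) \<partial>R \<partial>P)"
      unfolding D_def by (rule nn_integral_pair_pmf')
    also have "\<dots> \<le> (\<integral>\<^sup>+B. ennreal (b (?V B)) \<partial>P)"
      by (intro nn_integral_mono_AE) (auto simp: AE_measure_pmf_iff 1)
    also have "\<dots> = ennreal (measure_pmf.expectation P (\<lambda>B. b (?V B)))"
      using \<epsilon> \<delta> Vpos by (intro nn_integral_eq_integral intP) (auto simp: b_def intro!: AE_I2 add_nonneg_nonneg divide_nonneg_pos)
    also have "measure_pmf.expectation P (\<lambda>B. b (?V B)) = b (measure_pmf.expectation P ?V)"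
      unfolding b_def by (simp add: intP)
    also have "\<dots> \<le> \<epsilon> + \<delta>"
      using var[OF f] \<epsilon> unfolding b_def by (simp add: field_simps power2_eq_square)
    finally show "(\<integral>\<^sup>+\<omega>. ennreal (norm (S f - result (A \<omega>) f)) \<partial>D) \<le> ennreal (\<epsilon> + \<delta>)"
      by (simp add: ennreal_leI)
  qed
  show ?thesis
    using min_error_le[where P=Q and S=S, OF ran QA ec] ee by (rule order_trans)
qed

section \<open>Mixed norms\<close>

lemma L_norm_infinity: "p = \<infinity> \<Longrightarrow> L_norm p N g = Max ((\<lambda>i. norm (g i)) ` {1..N})"
  by (simp add: L_norm_def)

lemma L_norm_nonneg:
  assumes "1 \<le> N"
  shows "0 \<le> L_norm p N g"
proof (cases "p = \<infinity>")
  case True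
  have "norm (g 1) \<le> Max ((\<lambda>i. norm (g i)) ` {1..N})"
    using assms by (intro Max_ge) auto
  then show ?thesis
    using norm_ge_zero[of "g 1"] unfolding L_norm_infinity[OF True] by linarith
qed (simp add: L_norm_def)

lemma norm_le_L_norm_infinity:
  assumes "i \<in> {1..N}"
  shows "norm (g i) \<le> L_norm \<infinity> N g"
  unfolding L_norm_infinity[OF refl] using assms by (intro Max_ge) auto

lemma sum_powr_L_norm:
  assumes "1 \<le> N" "1 \<le> p" "p \<noteq> \<infinity>"
  shows "(\<Sum>i=1..N. norm (g i) powr enn2real p) = real N * L_norm p N g powr enn2real p"
proof -
  have "enn2real p \<noteq> 0" using assms by (auto simp: enn2real_eq_0_iff)
  moreover have "0 \<le> (\<Sum>i=1..N. norm (g i) powr enn2real p)" by (intro sum_nonneg) auto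
  ultimately show ?thesis
    using assms by (simp add: L_norm_def powr_powr)
qed

lemma enn2real_ge_1: "1 \<le> p \<Longrightarrow> p \<noteq> \<infinity> \<Longrightarrow> 1 \<le> enn2real p"
  by (cases p rule: ennreal_cases) (auto simp flip: ennreal_1)

text \<open>
  The conventions \<open>1 / enn2real \<infinity> = 0\<close> and \<open>0 powr 0 = 0\<close> make one formula cover \<open>p = \<infinity>\<close> as well as
  an empty support.
\<close>

lemma L_norm_on_subset:
  assumes N: "1 \<le> N" "1 \<le> p" and I: "I \<subseteq> {1..N}" and v: "0 \<le> v"
    and g: "\<And>i. i \<in> {1..N} \<Longrightarrow> norm (g i) = (if i \<in> I then v else 0)"
  shows "L_norm p N g = v * (real (card I) / real N) powr (1 / enn2real p)"
proof (cases "p = \<infinity>")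
  case True
  show ?thesis
  proof (cases "I = {}")
    case True
    then have "(\<lambda>i. norm (g i)) ` {1..N} = {0}" using g N by (auto simp: image_iff)
    then show ?thesis unfolding L_norm_infinity[OF \<open>p = \<infinity>\<close>] using True by simp
  next
    case False
    then obtain i where i: "i \<in> I" by auto
    have "Max ((\<lambda>i. norm (g i)) ` {1..N}) = v"
    proof (rule Max_eqI)
      show "v \<in> (\<lambda>i. norm (g i)) ` {1..N}" using i I g[of i] by (auto simp: image_iff intro!: bexI[of _ i])
    qed (use g v in auto)
    moreover have "card I \<noteq> 0" using False finite_subset[OF I] by simp
    ultimately show ?thesis
      unfolding L_norm_infinity[OF \<open>p = \<infinity>\<close>] using \<open>p = \<infinity>\<close> N by simp
  qed
next
  case False
  define P where "P = enn2real p"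
  have P: "P \<ge> 1" using enn2real_ge_1[OF N(2) False] by (simp add: P_def)
  have "(\<Sum>i=1..N. norm (g i) powr P) = (\<Sum>i=1..N. if i \<in> I then v powr P else 0)"
    using g by (intro sum.cong) auto
  also have "\<dots> = real (card I) * v powr P"
    using I by (simp add: sum.If_cases Int_absorb1)
  finally have "L_norm p N g = (real (card I) / real N * v powr P) powr (1 / P)"
    using False by (simp add: L_norm_def P_def)
  also have "\<dots> = v * (real (card I) / real N) powr (1 / P)"
    using P v by (subst powr_mult) (auto simp: powr_powr)
  finally show ?thesis by (simp add: P_def)
qed

text \<open>
  Power means increase with the exponent: for \<open>0 < s \<le> p\<close> and a quotient \<open>t = (|g i| / y)^p\<close> with
  mean \<open>1\<close>, Young's inequality \<open>t^(s/p) \<le> s/p t + (1 - s/p)\<close> is averaged over \<open>i\<close>.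
\<close>

lemma mean_powr_le_L_norm:
  assumes N: "1 \<le> N" "1 \<le> p" and s: "0 < s" "p = \<infinity> \<or> s \<le> enn2real p"
  shows "(\<Sum>i=1..N. norm (g i) powr s) \<le> real N * L_norm p N g powr s"
proof (cases "p = \<infinity>")
  case True
  have "(\<Sum>i=1..N. norm (g i) powr s) \<le> (\<Sum>i=1..N. L_norm p N g powr s)"
    using s norm_le_L_norm_infinity[of _ N g] True by (intro sum_mono powr_mono2) auto
  then show ?thesis by simp
next
  case False
  define P y where "P = enn2real p" and "y = L_norm p N g"
  have P: "P \<ge> 1" "s \<le> P" using enn2real_ge_1[OF N(2) False] s False by (auto simp: P_def)
  have y: "y \<ge> 0" using L_norm_nonneg[OF N(1)] by (simp add: y_def)
  have S: "(\<Sum>i=1..N. norm (g i) powr P) = real N * y powr P"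
    using sum_powr_L_norm[OF N False] by (simp add: P_def y_def)
  show ?thesis
  proof (cases "y = 0")
    case True
    then have "\<forall>i\<in>{1..N}. norm (g i) powr P = 0"
      using S by (subst sum_nonneg_eq_0_iff[symmetric]) (use P in auto)
    then have "(\<Sum>i=1..N. norm (g i) powr s) = 0" by simp
    then show ?thesis using y by (simp add: y_def)
  next
    case False
    with y have y: "y > 0" by simp
    \<comment> \<open>Young's inequality with the second factor equal to \<open>1\<close>.\<close>
    have pt: "norm (g i) powr s \<le> y powr s * (s / P * (norm (g i) powr P / y powr P) + (1 - s / P))" for i
    proof (cases "g i = 0")
      case True
      then show ?thesis using P s y by simp
    next
      case False
      define t where "t = norm (g i) powr P / y powr P"
      have "t powr (s / P) * 1 powr (1 - s / P) \<le> s / P * t + (1 - s / P) * 1"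
        using P s False y by (intro Youngs_inequality_0) (auto simp: t_def)
      moreover have "t powr (s / P) = norm (g i) powr s / y powr s"
        using P y by (simp add: t_def powr_divide powr_powr)
      ultimately have "norm (g i) powr s / y powr s \<le> s / P * t + (1 - s / P)" by simp
      then show ?thesis
        using y by (simp add: t_def pos_divide_le_eq mult.commute)
    qed
    have "(\<Sum>i=1..N. norm (g i) powr s)
        \<le> (\<Sum>i=1..N. y powr s * (s / P * (norm (g i) powr P / y powr P) + (1 - s / P)))"
      by (intro sum_mono pt)
    also have "\<dots> = y powr s * (s / P * ((\<Sum>i=1..N. norm (g i) powr P) / y powr P) + real N * (1 - s / P))"
      unfolding sum_distrib_left[symmetric] sum.distrib sum_divide_distrib[symmetric] by simp
    also have "\<dots> = real N * y powr s"
      unfolding S using y by (simp add: algebra_simps)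
    finally show ?thesis by (simp add: y_def)
  qed
qed

lemma sum_sq_le_L_norm:
  assumes N: "1 \<le> N" "2 \<le> p"
  shows "(\<Sum>i=1..N. (norm (g i))\<^sup>2) \<le> real N * (L_norm p N g)\<^sup>2"
proof -
  have "1 \<le> p" using N(2) by (rule order_trans[rotated]) simp
  moreover have "p = \<infinity> \<or> 2 \<le> enn2real p"
    using N(2) by (cases p rule: ennreal_cases) (auto simp flip: ennreal_numeral)
  ultimately show ?thesis
    using mean_powr_le_L_norm[of N p 2 g] N L_norm_nonneg[of N p g] by simp
qed

lemma sum_le_L_norm:
  assumes N: "1 \<le> N" "1 \<le> p"
  shows "(\<Sum>i=1..N. norm (g i)) \<le> real N * L_norm p N g"
  using mean_powr_le_L_norm[of N p 1 g] assms enn2real_ge_1[of p] L_norm_nonneg[of N p g]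
  by (cases "p = \<infinity>") simp_all

text \<open>
  For \<open>p \<le> 2\<close> sums of squares are estimated by the embedding of \<open>\<ell>\<^sub>p\<close> into \<open>\<ell>\<^sub>2\<close>; this is where a
  single heavy row costs the factor \<open>N^(2/p)\<close>.
\<close>

lemma sum_sq_le_L_norm_small:
  assumes N: "1 \<le> N" "1 \<le> p" "p \<le> 2"
  shows "(\<Sum>i=1..N. (norm (g i))\<^sup>2) \<le> real N powr (2 / enn2real p) * (L_norm p N g)\<^sup>2"
proof -
  define P y where "P = enn2real p" and "y = L_norm p N g"
  have fin: "p \<noteq> \<infinity>" using N(3) by (auto simp: top_unique)
  have P: "1 \<le> P" "P \<le> 2"
    using enn2real_ge_1[OF N(2) fin] N(3) enn2real_leI[of 2 p] by (auto simp: P_def)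
  have y: "y \<ge> 0" using L_norm_nonneg[OF N(1)] by (simp add: y_def)
  define Y where "Y = (\<Sum>i=1..N. norm (g i) powr P)"
  have YN: "Y = real N * y powr P"
    using sum_powr_L_norm[OF N(1,2) fin] by (simp add: Y_def P_def y_def)
  have Y0: "Y \<ge> 0" by (simp add: YN)
  have pt: "(norm (g i))\<^sup>2 \<le> norm (g i) powr P * Y powr (2 / P - 1)" if "i \<in> {1..N}" for i
  proof -
    have le: "norm (g i) powr P \<le> Y"
      unfolding Y_def using that by (intro member_le_sum) auto
    have "(norm (g i))\<^sup>2 = norm (g i) powr P * (norm (g i) powr P) powr (2 / P - 1)"
      using P by (cases "g i = 0") (simp_all add: powr_powr powr_add[symmetric] algebra_simps)
    also have "\<dots> \<le> norm (g i) powr P * Y powr (2 / P - 1)"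
      using P le by (intro mult_left_mono powr_mono2) auto
    finally show ?thesis .
  qed
  have "(\<Sum>i=1..N. (norm (g i))\<^sup>2) \<le> (\<Sum>i=1..N. norm (g i) powr P * Y powr (2 / P - 1))"
    by (intro sum_mono pt)
  also have "\<dots> = Y * Y powr (2 / P - 1)" by (simp add: Y_def sum_distrib_right)
  also have "\<dots> = Y powr (2 / P)"
    using Y0 by (cases "Y = 0") (simp_all add: powr_mult_base)
  also have "\<dots> = real N powr (2 / P) * y\<^sup>2"
    using P y by (cases "y = 0") (simp_all add: YN powr_mult powr_powr)
  finally show ?thesis by (simp add: P_def y_def)
qed

text \<open>
  For \<open>u > 2\<close> large entries are rare: above a height \<open>\<theta>\<close>, \<open>|g|\<^sup>2 \<le> |g|^u \<theta>^(2-u)\<close>. The height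
  \<open>T^(1/u)\<close> times the norm is the value of an entry that uses up a fraction \<open>T/N\<close> of the
  \<open>u\<close>-th power of the norm; for \<open>u = \<infinity>\<close> no entry exceeds it.
\<close>

lemma sum_sq_large_entries:
  assumes N: "1 \<le> N" "2 < p" and T: "0 < T"
  defines "b \<equiv> 1 / enn2real p"
  shows "(\<Sum>i | i \<in> {1..N} \<and> norm (g i) > T powr b * L_norm p N g. (norm (g i))\<^sup>2)
    \<le> real N * T powr (2 * b - 1) * (L_norm p N g)\<^sup>2"
proof (cases "p = \<infinity>")
  case True
  have "{i. i \<in> {1..N} \<and> norm (g i) > T powr b * L_norm p N g} = {}"
    using norm_le_L_norm_infinity[of _ N g] True T by (force simp: b_def)
  then show ?thesis by (simp only: sum.empty) simp
next
  case False
  define P y where "P = enn2real p" and "y = L_norm p N g"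
  have P: "2 < P" using N(2) False
    by (cases p rule: ennreal_cases) (auto simp: P_def ennreal_less_iff simp flip: ennreal_numeral)
  have p1: "1 \<le> p" using N(2) by (metis one_le_numeral order_less_imp_le order_trans)
  have y0: "y \<ge> 0" using L_norm_nonneg[OF N(1)] by (simp add: y_def)
  have S: "(\<Sum>i=1..N. norm (g i) powr P) = real N * y powr P"
    using sum_powr_L_norm[OF N(1) p1 False] by (simp add: P_def y_def)
  show ?thesis
  proof (cases "y = 0")
    case True
    then have "\<forall>i\<in>{1..N}. norm (g i) powr P = 0"
      using S P by (subst sum_nonneg_eq_0_iff[symmetric]) auto
    then have "{i. i \<in> {1..N} \<and> norm (g i) > T powr b * y} = {}" using True by auto
    then show ?thesis unfolding y_def[symmetric] by (simp only: sum.empty) simp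
  next
    case False
    with y0 have y: "y > 0" by simp
    let ?I = "{i. i \<in> {1..N} \<and> norm (g i) > T powr b * y}"
    define \<theta> where "\<theta> = T powr b * y"
    have \<theta>: "\<theta> > 0" using T y by (simp add: \<theta>_def)
    have pt: "(norm (g i))\<^sup>2 \<le> norm (g i) powr P * \<theta> powr (2 - P)" if "i \<in> ?I" for i
    proof -
      have gt: "norm (g i) > \<theta>" using that by (simp add: \<theta>_def)
      then have "(norm (g i))\<^sup>2 = norm (g i) powr P * norm (g i) powr (2 - P)"
        using \<theta> by (simp add: powr_add[symmetric])
      also have "\<dots> \<le> norm (g i) powr P * \<theta> powr (2 - P)"
        using P \<theta> gt by (intro mult_left_mono powr_mono2') auto
      finally show ?thesis .
    qed
    have "(\<Sum>i\<in>?I. (norm (g i))\<^sup>2) \<le> (\<Sum>i\<in>?I. norm (g i) powr P * \<theta> powr (2 - P))"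
      by (intro sum_mono pt)
    also have "\<dots> \<le> (\<Sum>i=1..N. norm (g i) powr P * \<theta> powr (2 - P))"
      by (intro sum_mono2) auto
    also have "\<dots> = real N * (y powr P * \<theta> powr (2 - P))"
      unfolding sum_distrib_right[symmetric] S by simp
    also have "y powr P * \<theta> powr (2 - P) = T powr (2 * b - 1) * y\<^sup>2"
    proof -
      have "b * (2 - P) = 2 * b - 1" using P by (simp add: b_def P_def field_simps)
      then show ?thesis
        using T y by (simp add: \<theta>_def powr_mult powr_powr powr_add[symmetric])
    qed
    finally show ?thesis by (simp add: y_def)
  qed
qed

section \<open>The unit ball and the integration operator\<close>

lemma abs_le_ell_norm:
  assumes "1 \<le> p" "in_ell p a"
  shows "\<bar>a k\<bar> \<le> ell_norm p a"
proof (cases "p = \<infinity>")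
  case True
  then obtain b where "\<And>k. \<bar>a k\<bar> \<le> b"
    using assms(2) by (auto simp: in_ell_def bounded_iff)
  then have "bdd_above (range (\<lambda>k. \<bar>a k\<bar>))"
    by (auto intro!: bdd_aboveI)
  then show ?thesis using True by (auto simp: ell_norm_def intro: cSUP_upper)
next
  case False
  define P where "P = enn2real p"
  have P: "P \<ge> 1" using enn2real_ge_1[OF assms(1) False] by (simp add: P_def)
  have s: "summable (\<lambda>k. \<bar>a k\<bar> powr P)" using assms(2) False by (simp add: in_ell_def P_def)
  have "\<bar>a k\<bar> powr P = (\<Sum>k\<in>{k}. \<bar>a k\<bar> powr P)" by simp
  also have "\<dots> \<le> (\<Sum>k. \<bar>a k\<bar> powr P)" by (intro sum_le_suminf s) auto
  finally have "(\<bar>a k\<bar> powr P) powr (1 / P) \<le> (\<Sum>k. \<bar>a k\<bar> powr P) powr (1 / P)"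
    using P by (intro powr_mono2) auto
  then show ?thesis using P False by (simp add: powr_powr ell_norm_def P_def)
qed

lemma ell_norm_single:
  assumes "1 \<le> p" "\<And>k'. k' \<noteq> k \<Longrightarrow> a k' = 0"
  shows "in_ell p a" "ell_norm p a = \<bar>a k\<bar>"
proof -
  have le: "\<bar>a k'\<bar> \<le> \<bar>a k\<bar>" for k' using assms(2)[of k'] by (cases "k' = k") auto
  have "bounded (range a)"
    by (rule boundedI[of _ "\<bar>a k\<bar>"]) (use le in auto)
  moreover have "(SUP k. \<bar>a k\<bar>) = \<bar>a k\<bar>"
    by (rule cSup_eq_maximum) (use le in auto)
  moreover have "(\<lambda>k. \<bar>a k\<bar> powr enn2real p) sums (\<bar>a k\<bar> powr enn2real p)"
  proof -
    have "(\<lambda>k. \<bar>a k\<bar> powr enn2real p) = (\<lambda>k'. if k' = k then \<bar>a k'\<bar> powr enn2real p else 0)"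
      using assms(2) by auto
    then show ?thesis using sums_single[of k "\<lambda>k. \<bar>a k\<bar> powr enn2real p"] by simp
  qed
  moreover have "p \<noteq> \<infinity> \<Longrightarrow> (\<bar>a k\<bar> powr enn2real p) powr (1 / enn2real p) = \<bar>a k\<bar>"
    using enn2real_ge_1[of p] assms(1) by (simp add: powr_powr)
  ultimately show "in_ell p a" "ell_norm p a = \<bar>a k\<bar>"
    by (auto simp: in_ell_def ell_norm_def sums_iff)
qed

lemma LL_norm_nonneg: "1 \<le> N1 \<Longrightarrow> 0 \<le> LL_norm p u N1 N2 f"
  unfolding LL_norm_def by (rule L_norm_nonneg)

lemma LL_norm_le_1:
  assumes "f \<in> X_ball p u p1" "1 \<le> p1"
  shows "LL_norm p u (2^k) (2^k) (f k) \<le> 1"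
  using abs_le_ell_norm[of p1 "\<lambda>k. LL_norm p u (2^k) (2^k) (f k)" k] assms
  by (auto simp: X_ball_def X_space_def X_norm_def)

lemma LL_norm_on_rectangle:
  assumes "1 \<le> N" "1 \<le> p" "1 \<le> u" "I \<subseteq> {1..N}" "J \<subseteq> {1..N}" "0 \<le> v"
    "\<And>i j. i \<in> {1..N} \<Longrightarrow> j \<in> {1..N} \<Longrightarrow> norm (f i j) = (if i \<in> I \<and> j \<in> J then v else 0)"
  shows "LL_norm p u N N f = v * (real (card J) / real N) powr (1 / enn2real u)
      * (real (card I) / real N) powr (1 / enn2real p)"
  unfolding LL_norm_def
proof (rule L_norm_on_subset)
  fix i assume i: "i \<in> {1..N}"
  have "L_norm u N (f i) = (if i \<in> I then v else 0) * (real (card J) / real N) powr (1 / enn2real u)"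
    using assms i by (intro L_norm_on_subset) auto
  then show "norm (L_norm u N (f i)) = (if i \<in> I then v * (real (card J) / real N) powr (1 / enn2real u) else 0)"
    using assms(6) by (simp add: abs_mult)
qed (use assms in auto)

text \<open>
  All test inputs of the lower bounds live on one level and have constant modulus on a rectangle.
\<close>

lemma rectangle_in_X_ball:
  assumes "1 \<le> p" "1 \<le> u" "1 \<le> p1" "I \<subseteq> {1..2^k}" "J \<subseteq> {1..2^k}" "0 \<le> v"
    "\<And>i j. norm (c i j) = (if i \<in> I \<and> j \<in> J then v else 0)"
    "v * (real (card J) / 2^k) powr (1 / enn2real u) * (real (card I) / 2^k) powr (1 / enn2real p) \<le> 1"
  shows "(\<lambda>k' i j. if k' = k then c i j else 0) \<in> X_ball p u p1"
proof -
  let ?f = "\<lambda>k' i j. if k' = k then c i j else 0"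
  let ?a = "\<lambda>k'. LL_norm p u (2^k') (2^k') (?f k')"
  have "?a k' = 0" if "k' \<noteq> k" for k'
    using LL_norm_on_rectangle[where N = "2^k'" and I = "{}" and J = "{}" and v = 0 and f = "?f k'"] assms that by simp
  note ell = ell_norm_single[where a = ?a and k = k, OF \<open>1 \<le> p1\<close> this]
  have "?a k \<le> 1"
    using LL_norm_on_rectangle[where N = "2^k" and I = I and J = J and v = v and f = "?f k"] assms by simp
  moreover have "0 \<le> ?a k" by (rule LL_norm_nonneg) simp
  moreover have "c i j = 0" if "\<not> (i \<in> {1..2^k} \<and> j \<in> {1..2^k})" for i j
  proof -
    have "norm (c i j) = 0" using assms(4,5) assms(7)[of i j] that by auto
    then show ?thesis by simp
  qed
  ultimately show ?thesis
    using ell unfolding X_ball_def X_space_def X_norm_def by auto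
qed

definition entry :: "nat \<times> nat \<times> nat \<Rightarrow> 'k array_seq \<Rightarrow> 'k" where
  "entry = (\<lambda>(k, i, j) f. f k i j)"

definition levels :: "nat \<Rightarrow> (nat \<times> nat \<times> nat) set" where
  "levels K = (SIGMA k:{..K}. {1..2^k} \<times> {1..2^k})"

definition weight :: "real \<Rightarrow> nat \<times> nat \<times> nat \<Rightarrow> real" where
  "weight \<alpha> = (\<lambda>(k, i, j). 2 powr (- \<alpha> * real k) / 4 ^ k)"

lemma entry_simp [simp]: "entry (k, i, j) f = f k i j"
  by (simp add: entry_def)

lemma finite_levels [simp]: "finite (levels K)"
  unfolding levels_def by auto

lemma entry_std_info: "x \<in> levels K \<Longrightarrow> entry x \<in> std_info"
  by (cases x) (auto simp: levels_def std_info_def entry_def)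

lemma sum_levels: "(\<Sum>x\<in>levels K. g x) = (\<Sum>k\<le>K. \<Sum>i=1..2^k. \<Sum>j=1..2^k. g (k, i, j))"
  unfolding levels_def by (simp add: sum.Sigma)

lemma norm_mean_op_le:
  fixes f :: "nat \<Rightarrow> nat \<Rightarrow> 'k::real_normed_field"
  assumes "1 \<le> N" "1 \<le> p" "1 \<le> u"
  shows "norm (mean_op N N f) \<le> LL_norm p u N N f"
proof -
  have "norm (\<Sum>i=1..N. \<Sum>j=1..N. f i j) \<le> (\<Sum>i=1..N. \<Sum>j=1..N. norm (f i j))"
    by (intro order_trans[OF norm_sum] sum_mono norm_sum)
  also have "\<dots> \<le> (\<Sum>i=1..N. real N * L_norm u N (f i))"
    by (intro sum_mono sum_le_L_norm assms)
  also have "\<dots> = real N * (\<Sum>i=1..N. norm (L_norm u N (f i)))"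
    using L_norm_nonneg[OF assms(1), of u "f _"] by (simp add: sum_distrib_left abs_of_nonneg)
  also have "\<dots> \<le> real N * (real N * LL_norm p u N N f)"
    unfolding LL_norm_def by (intro mult_left_mono sum_le_L_norm assms) auto
  finally show ?thesis
    using assms(1) by (simp add: mean_op_def norm_divide norm_mult field_simps)
qed

lemma powr_level: "2 powr (- \<alpha> * real k) = (2 powr - \<alpha>) ^ k"
  by (simp add: powr_powr powr_realpow[symmetric] mult.commute)

text \<open>
  The mean over a level is bounded by its norm, hence by \<open>1\<close>, and for \<open>\<alpha> \<ge> 1\<close> the geometric tail
  beyond level \<open>K\<close> is at most the term \<open>2^(-\<alpha> K)\<close> that precedes it.
\<close>

lemma I_op_truncate:
  fixes f :: "'k::{real_normed_field, banach} array_seq"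
  assumes f: "f \<in> X_ball p u p1" and p: "1 \<le> p" "1 \<le> u" "1 \<le> p1" and \<alpha>: "1 \<le> \<alpha>"
  shows "norm (I_op \<alpha> f - (\<Sum>x\<in>levels K. weight \<alpha> x *\<^sub>R entry x f)) \<le> 2 powr (- \<alpha> * real K)"
proof -
  define r where "r = 2 powr - \<alpha>"
  have "r \<le> 2 powr - 1" unfolding r_def using \<alpha> by (intro powr_mono) auto
  then have r: "0 < r" "r \<le> 1/2" by (simp_all add: r_def powr_minus)
  define g where "g k = (2 powr (- \<alpha> * real k)) *\<^sub>R mean_op (2^k) (2^k) (f k)" for k
  have g: "norm (g k) \<le> r ^ k" for k
  proof -
    have "norm (mean_op (2^k) (2^k) (f k)) \<le> 1"
      using norm_mean_op_le[of "2^k" p u "f k"] LL_norm_le_1[OF f p(3), of k] p by simp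
    then have "norm (g k) \<le> 2 powr (- \<alpha> * real k) * 1"
      unfolding g_def norm_scaleR by (intro mult_mono) auto
    then show ?thesis unfolding powr_level r_def by simp
  qed
  have sr: "summable (\<lambda>k. r ^ k)" using r by (intro summable_geometric) auto
  have sg: "summable g" by (rule summable_comparison_test'[OF sr g])
  have "(\<Sum>x\<in>levels K. weight \<alpha> x *\<^sub>R entry x f) = (\<Sum>k\<le>K. g k)"
    unfolding sum_levels
  proof (rule sum.cong[OF refl])
    fix k
    have "(4::'k) ^ k = of_real (4 ^ k)" by simp
    then have "g k = (2 powr (- \<alpha> * real k) / 4 ^ k) *\<^sub>R (\<Sum>i=1..2^k. \<Sum>j=1..2^k. f k i j)"
      by (simp add: g_def mean_op_def scaleR_conv_of_real power_mult_distrib[symmetric])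
    then show "(\<Sum>i=1..2^k. \<Sum>j=1..2^k. weight \<alpha> (k, i, j) *\<^sub>R entry (k, i, j) f) = g k"
      by (simp add: weight_def scaleR_sum_right)
  qed
  moreover have "I_op \<alpha> f = (\<Sum>k. g (k + Suc K)) + (\<Sum>k\<le>K. g k)"
    using suminf_split_initial_segment[OF sg, of "Suc K"]
    by (simp add: I_op_def g_def[abs_def] lessThan_Suc_atMost)
  ultimately have "norm (I_op \<alpha> f - (\<Sum>x\<in>levels K. weight \<alpha> x *\<^sub>R entry x f)) = norm (\<Sum>k. g (k + Suc K))"
    by simp
  also have "\<dots> \<le> (\<Sum>k. r ^ (k + Suc K))"
    by (rule norm_suminf_le[OF g summable_ignore_initial_segment[OF sr]])
  also have "\<dots> = (\<Sum>k. r ^ k * r ^ Suc K)" by (simp only: power_add)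
  also have "\<dots> = (\<Sum>k. r ^ k) * r ^ Suc K" by (rule suminf_mult2[OF sr, symmetric])
  also have "\<dots> = r / (1 - r) * r ^ K" using r suminf_geometric[of r] by simp
  also have "\<dots> \<le> 1 * r ^ K" using r by (intro mult_right_mono) auto
  finally show ?thesis unfolding powr_level r_def by simp
qed

lemma I_op_single_level:
  fixes c :: "nat \<Rightarrow> nat \<Rightarrow> 'k::{real_normed_field, banach}"
  shows "I_op \<alpha> (\<lambda>k' i j. if k' = k then c i j else 0)
    = (2 powr (- \<alpha> * real k) / 4 ^ k) *\<^sub>R (\<Sum>i=1..2^k. \<Sum>j=1..2^k. c i j)"
proof -
  let ?g = "\<lambda>k'. (2 powr (- \<alpha> * real k')) *\<^sub>R mean_op (2^k') (2^k') (\<lambda>i j. if k' = k then c i j else 0)"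
  have "(\<lambda>k'. if k' = k then ?g k' else 0) sums ?g k" by (rule sums_single)
  moreover have "(\<lambda>k'. if k' = k then ?g k' else 0) = ?g" by (auto simp: mean_op_def)
  ultimately have "I_op \<alpha> (\<lambda>k' i j. if k' = k then c i j else 0) = ?g k"
    by (simp add: I_op_def sums_iff)
  also have "\<dots> = (2 powr (- \<alpha> * real k) / 4 ^ k) *\<^sub>R (\<Sum>i=1..2^k. \<Sum>j=1..2^k. c i j)"
  proof -
    have "(4::'k) ^ k = of_real (4 ^ k)" by simp
    then show ?thesis
      by (simp add: mean_op_def scaleR_conv_of_real power_mult_distrib[symmetric])
  qed
  finally show ?thesis .
qed

section \<open>Estimating a row norm from Bernoulli samples\<close>

text \<open>
  The probability \<open>r\<close>, cut off at \<open>1\<close> and rounded up to a positive multiple of \<open>1/M\<close>.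
\<close>

definition threshold :: "nat \<Rightarrow> real \<Rightarrow> nat" where
  "threshold M r = min M (max 1 (nat \<lceil>real M * r\<rceil>))"

lemma threshold_bounds:
  assumes "1 \<le> M"
  shows "1 \<le> threshold M r" "threshold M r \<le> M"
  using assms by (auto simp: threshold_def)

lemma threshold_le:
  assumes "1 \<le> M" "0 \<le> r"
  shows "real (threshold M r) / real M \<le> r + 1 / real M"
proof -
  have "real (nat \<lceil>real M * r\<rceil>) \<le> real M * r + 1"
  proof -
    have "0 \<le> real M * r" using assms by simp
    then have "real (nat \<lceil>real M * r\<rceil>) = of_int \<lceil>real M * r\<rceil>" by simp
    then show ?thesis using of_int_ceiling_le_add_one[of "real M * r"] by simp
  qed
  moreover have "1 \<le> real M * r + 1" using assms by simp
  moreover have "real (threshold M r) \<le> max 1 (real (nat \<lceil>real M * r\<rceil>))"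
    by (simp add: threshold_def min_def max_def)
  ultimately have "real (threshold M r) \<le> real M * r + 1" by linarith
  then show ?thesis using assms by (simp add: field_simps)
qed

lemma threshold_inverse_le:
  assumes "1 \<le> M" "0 < r"
  shows "real M / real (threshold M r) - 1 \<le> (if 1 \<le> r then 0 else 1 / r)"
proof -
  have le: "real M * r \<le> real (nat \<lceil>real M * r\<rceil>)"
    by (rule of_nat_ceiling)
  show ?thesis
  proof (cases "1 \<le> r")
    case True
    have "real M * 1 \<le> real M * r" using True by (intro mult_left_mono) auto
    with le have "M \<le> nat \<lceil>real M * r\<rceil>" by linarith
    then have "threshold M r = M" using assms by (simp add: threshold_def)
    then show ?thesis using assms True by simp
  next
    case False
    have "real M * r \<le> real M * 1" using False by (intro mult_left_mono) auto
    then have t: "real M * r \<le> real (threshold M r)"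
      using le by (auto simp: threshold_def min_def max_def)
    have "real M / real (threshold M r) \<le> real M / (real M * r)"
      using assms t by (intro divide_left_mono mult_pos_pos) (auto simp: threshold_def)
    also have "\<dots> = 1 / r" using assms by simp
    finally show ?thesis using False by simp
  qed
qed

text \<open>
  A row \<open>R\<close> with entries of modulus \<open>g\<close> is sampled with rate \<open>q\<close>. The statistic \<open>S\<close> is the unbiased
  estimate of the sum of squares \<open>h\<close> from the sampled entries. The sample runs over a larger index
  set \<open>J\<close>, since the same sample serves all rows.
\<close>

context
  fixes J R :: "'a set" and Q :: "'a \<Rightarrow> real" and q :: real and g :: "'a \<Rightarrow> real"
    and P :: "('a \<Rightarrow> bool) pmf" and h :: real and S :: "('a \<Rightarrow> bool) \<Rightarrow> real"
  assumes J: "finite J" and R: "R \<subseteq> J" and Q: "\<And>x. x \<in> R \<Longrightarrow> Q x = q" and q: "0 < q" "q \<le> 1"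
  defines "P \<equiv> Pi_pmf J False (\<lambda>x. bernoulli_pmf (Q x))"
    and "h \<equiv> \<Sum>x\<in>R. (g x)\<^sup>2"
    and "S \<equiv> \<lambda>B. \<Sum>x\<in>R. of_bool (B x) * (g x)\<^sup>2 / q"
begin

lemma finite_set_row_sample: "finite (set_pmf P)"
  unfolding P_def by (rule finite_set_Pi_pmf[OF J]) (rule finite_subset[OF subset_UNIV], simp)

lemma integrable_row_sample: "integrable (measure_pmf P) (X :: _ \<Rightarrow> real)"
  by (rule integrable_measure_pmf_finite[OF finite_set_row_sample])

lemma row_mean: "measure_pmf.expectation P S = h"
proof -
  have "measure_pmf.expectation P (\<lambda>B. of_bool (B x) * (g x)\<^sup>2 / q) = (g x)\<^sup>2" if "x \<in> R" for x
  proof -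
    have "measure_pmf.expectation P (\<lambda>B. of_bool (B x) * (g x)\<^sup>2 / q)
        = measure_pmf.expectation (bernoulli_pmf (Q x)) (\<lambda>b. of_bool b * (g x)\<^sup>2 / q)"
      unfolding P_def using R that
      by (intro expectation_Pi_pmf_component[OF J, where h = "\<lambda>b. of_bool b * (g x)\<^sup>2 / q"]) auto
    also have "\<dots> = (g x)\<^sup>2"
      unfolding Q[OF that] using q by simp
    finally show ?thesis .
  qed
  then show ?thesis
    unfolding S_def h_def by (subst Bochner_Integration.integral_sum[OF integrable_row_sample]) simp
qed

lemma row_sum_nonneg: "0 \<le> S B"
  unfolding S_def using q by (intro sum_nonneg) auto

lemma row_total_nonneg: "0 \<le> h"
  unfolding h_def by (intro sum_nonneg) auto

text \<open>
  Jensen's inequality for the square root, obtained from the tangents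
  \<open>sqrt x \<le> (x/e + e)/2\<close>.
\<close>

lemma row_estimate_mean:
  assumes N: "0 < N"
  shows "measure_pmf.expectation P (\<lambda>B. sqrt (S B / N)) \<le> sqrt (h / N)"
proof -
  have bound: "measure_pmf.expectation P (\<lambda>B. sqrt (S B / N)) \<le> (h / N / e + e) / 2" if e: "e > 0" for e
  proof -
    have "sqrt (S B / N) \<le> (S B / N / e + e) / 2" for B
    proof -
      have "2 * sqrt (S B / N) * e \<le> (sqrt (S B / N))\<^sup>2 + e\<^sup>2" by (rule sum_squares_bound)
      also have "(sqrt (S B / N))\<^sup>2 = S B / N" using row_sum_nonneg N by simp
      finally have "sqrt (S B / N) * (2 * e) \<le> S B / N + e\<^sup>2" by (simp only: mult_ac)
      then have "sqrt (S B / N) \<le> (S B / N + e\<^sup>2) / (2 * e)"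
        using e by (subst pos_le_divide_eq) auto
      also have "\<dots> = (S B / N / e + e) / 2"
        using e by (simp add: add_divide_distrib power2_eq_square)
      finally show ?thesis .
    qed
    then have "measure_pmf.expectation P (\<lambda>B. sqrt (S B / N))
        \<le> measure_pmf.expectation P (\<lambda>B. (S B / N / e + e) / 2)"
      by (intro integral_mono integrable_row_sample)
    also have "\<dots> = (h / N / e + e) / 2"
      using integrable_row_sample by (simp add: row_mean)
    finally show ?thesis .
  qed
  show ?thesis
  proof (cases "h = 0")
    case True
    show ?thesis
    proof (rule field_le_epsilon)
      fix e :: real assume "e > 0"
      then show "measure_pmf.expectation P (\<lambda>B. sqrt (S B / N)) \<le> sqrt (h / N) + e"
        using bound[of e] True by simp
    qed
  next
    case False
    then have "0 < sqrt (h / N)" using row_total_nonneg N by simp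
    moreover have "h / N / sqrt (h / N) = sqrt (h / N)"
      using row_total_nonneg N real_div_sqrt[of "h / N"] by simp
    ultimately show ?thesis using bound[of "sqrt (h / N)"] by simp
  qed
qed

text \<open>
  Only entries bounded by \<open>\<theta>\<close> are counted, so that fourth powers in the variance are bounded by
  \<open>\<theta>\<^sup>2\<close> times squares.
\<close>

lemma row_variance:
  assumes "D \<subseteq> R" and \<theta>: "\<And>x. x \<in> D \<Longrightarrow> \<bar>g x\<bar> \<le> \<theta>"
  shows "measure_pmf.expectation P (\<lambda>B. (\<Sum>x\<in>D. (of_bool (B x) / q - 1) * (g x)\<^sup>2)\<^sup>2) \<le> \<theta>\<^sup>2 * h / q"
proof -
  define v where "v x = (if x \<in> D then (g x)\<^sup>2 else 0)" for x
  have finR: "finite R" using R J finite_subset by auto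
  have DJ: "D \<subseteq> J" using assms(1) R by auto
  have "(\<Sum>x\<in>D. (of_bool (B x) / q - 1) * (g x)\<^sup>2) = (\<Sum>x\<in>D. (of_bool (B x) / Q x - 1) * v x)" for B
    using Q assms(1) by (intro sum.cong) (auto simp: v_def)
  moreover have "\<dots> B = (\<Sum>x\<in>J. (if x \<in> D then of_bool (B x) / q - 1 else 0) *\<^sub>R v x)" for B
    using Q assms(1) DJ J by (intro sum.mono_neutral_cong_left) (auto simp: v_def)
  ultimately have "measure_pmf.expectation P (\<lambda>B. (\<Sum>x\<in>D. (of_bool (B x) / q - 1) * (g x)\<^sup>2)\<^sup>2)
     = measure_pmf.expectation P (\<lambda>B. (norm (\<Sum>x\<in>J. (if x \<in> D then of_bool (B x) / q - 1 else 0) *\<^sub>R v x))\<^sup>2)"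
    by simp
  also have "\<dots> = (\<Sum>x\<in>J. measure_pmf.expectation (bernoulli_pmf (Q x))
      (\<lambda>b. (if x \<in> D then of_bool b / q - 1 else 0)\<^sup>2) * (norm (v x))\<^sup>2)"
    unfolding P_def
  proof (rule expectation_norm_sum_sq_Pi_pmf[OF J])
    show "finite (set_pmf (bernoulli_pmf (Q x)))" for x by (rule finite_subset[OF subset_UNIV]) simp
    show "measure_pmf.expectation (bernoulli_pmf (Q x)) (\<lambda>b. if x \<in> D then of_bool b / q - 1 else 0) = 0" for x
      using Q[of x] assms(1) q by (cases "x \<in> D") (auto simp: field_simps)
  qed
  also have "\<dots> = (\<Sum>x\<in>D. (1 / q - 1) * (g x) ^ 4)"
  proof (rule sum.mono_neutral_cong_right[OF J DJ])
    show "measure_pmf.expectation (bernoulli_pmf (Q x))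
        (\<lambda>b. (if x \<in> D then of_bool b / q - 1 else 0)\<^sup>2) * (norm (v x))\<^sup>2 = (1 / q - 1) * g x ^ 4"
      if "x \<in> D" for x
    proof -
      have "Q x = q" using that assms(1) Q by auto
      moreover have "(1 / q - 1)\<^sup>2 * q + (1 - q) = 1 / q - 1"
        using q by (simp add: field_simps power2_eq_square)
      ultimately show ?thesis using that q by (simp add: v_def)
    qed
  qed (auto simp: v_def)
  also have "\<dots> \<le> (\<Sum>x\<in>D. (1 / q) * (\<theta>\<^sup>2 * (g x)\<^sup>2))"
  proof (intro sum_mono mult_mono)
    fix x assume x: "x \<in> D"
    have "(g x)\<^sup>2 \<le> \<theta>\<^sup>2" using \<theta>[OF x] by (metis abs_ge_zero power2_abs power_mono)
    then show "g x ^ 4 \<le> \<theta>\<^sup>2 * (g x)\<^sup>2"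
      using mult_right_mono[of "(g x)\<^sup>2" "\<theta>\<^sup>2" "(g x)\<^sup>2"] by (simp flip: power_add)
  qed (use q in auto)
  also have "\<dots> = 1 / q * \<theta>\<^sup>2 * (\<Sum>x\<in>D. (g x)\<^sup>2)" by (simp add: sum_distrib_left mult.assoc)
  also have "\<dots> \<le> 1 / q * \<theta>\<^sup>2 * h"
    unfolding h_def using assms(1) q finR by (intro mult_left_mono sum_mono2) auto
  finally show ?thesis by (simp add: mult_ac)
qed

text \<open>
  With the true value in place of the estimate, \<open>h / (1 + sqrt (h/N)) \<le> sqrt (N h)\<close>. An estimate
  that is too large does no harm here. If it is too small, then either the entries above \<open>\<theta>\<close>
  carry half of \<open>h\<close>, or the estimate restricted to the entries below \<open>\<theta>\<close>, which is smaller still,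
  deviates from its mean by more than \<open>h/4\<close>. In the latter case \<open>h\<close> is at most \<open>16/h\<close> times the
  squared deviation, whose expectation is at most \<open>\<theta>\<^sup>2 h / q\<close>.
\<close>

lemma row_bias:
  assumes N: "0 < N"
  shows "measure_pmf.expectation P (\<lambda>B. h / (1 + sqrt (S B / N)))
    \<le> 2 * sqrt (N * h) + 2 * (\<Sum>x | x \<in> R \<and> \<theta> < \<bar>g x\<bar>. (g x)\<^sup>2) + 16 * \<theta>\<^sup>2 / q"
proof -
  define D where "D = {x \<in> R. \<bar>g x\<bar> \<le> \<theta>}"
  define big where "big = (\<Sum>x | x \<in> R \<and> \<theta> < \<bar>g x\<bar>. (g x)\<^sup>2)"
  define small where "small = (\<Sum>x\<in>D. (g x)\<^sup>2)"
  have finR: "finite R" using R J finite_subset by auto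
  have split: "h = small + big"
  proof -
    have "R - D = {x. x \<in> R \<and> \<theta> < \<bar>g x\<bar>}" by (auto simp: D_def)
    moreover have "D \<subseteq> R" by (auto simp: D_def)
    ultimately show ?thesis
      unfolding h_def small_def big_def using sum.subset_diff[OF _ finR, of D "\<lambda>x. (g x)\<^sup>2"] by simp
  qed
  have big0: "big \<ge> 0" unfolding big_def by (intro sum_nonneg) auto
  have s0: "0 \<le> sqrt (S B / N)" for B using row_sum_nonneg N by simp
  have le_h: "h / (1 + sqrt (S B / N)) \<le> h" for B
  proof -
    have "h / (1 + sqrt (S B / N)) \<le> h / 1"
      using row_total_nonneg s0[of B] by (intro divide_left_mono mult_pos_pos) (simp_all add: add_pos_nonneg)
    then show ?thesis by simp
  qed
  have Nh: "0 \<le> sqrt (N * h)" using N row_total_nonneg by simp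
  have \<theta>q: "0 \<le> 16 * \<theta>\<^sup>2 / q" using q by simp
  show ?thesis
  proof (cases "h / 2 \<le> big")
    case True
    have "measure_pmf.expectation P (\<lambda>B. h / (1 + sqrt (S B / N))) \<le> measure_pmf.expectation P (\<lambda>B. h)"
      by (intro integral_mono integrable_row_sample le_h)
    then have "measure_pmf.expectation P (\<lambda>B. h / (1 + sqrt (S B / N))) \<le> h" by simp
    then show ?thesis using True Nh \<theta>q unfolding big_def[symmetric] by linarith
  next
    case False
    then have h: "h > 0" using big0 row_total_nonneg by linarith
    let ?X = "\<lambda>B. (\<Sum>x\<in>D. (of_bool (B x) / q - 1) * (g x)\<^sup>2)\<^sup>2"
    \<comment> \<open>Pointwise form of Chebyshev's inequality, ready for taking expectations.\<close>
    have pt: "h / (1 + sqrt (S B / N)) \<le> 2 * sqrt (N * h) + 16 / h * ?X B" for B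
    proof (cases "h / 4 \<le> S B")
      case True
      have "sqrt (h / N) / 2 = sqrt (h / 4 / N)" by (simp add: real_sqrt_divide real_sqrt_mult)
      also have "\<dots> \<le> sqrt (S B / N)"
        using True N by (intro real_sqrt_le_mono divide_right_mono) auto
      finally have "sqrt (h / N) / 2 \<le> 1 + sqrt (S B / N)" by simp
      then have "h / (1 + sqrt (S B / N)) \<le> h / (sqrt (h / N) / 2)"
        using h N s0[of B] by (intro divide_left_mono mult_pos_pos) (auto intro: add_pos_nonneg)
      also have "\<dots> = 2 * sqrt (N * h)"
      proof -
        have "sqrt (N * h) * sqrt (h / N) = h"
          using h N by (simp add: real_sqrt_mult[symmetric])
        moreover have "sqrt (h / N) \<noteq> 0" using h N by simp
        ultimately have "h / sqrt (h / N) = sqrt (N * h)"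
          by (subst nonzero_divide_eq_eq) auto
        then have "2 * (h / sqrt (h / N)) = 2 * sqrt (N * h)" by (rule arg_cong)
        then show ?thesis by (simp add: mult.commute)
      qed
      finally show ?thesis using h by (simp add: add_increasing2)
    next
      case False
      let ?s = "\<Sum>x\<in>D. of_bool (B x) * (g x)\<^sup>2 / q"
      have "?s \<le> S B"
        unfolding S_def using finR q by (intro sum_mono2) (auto simp: D_def)
      moreover have "(\<Sum>x\<in>D. (of_bool (B x) / q - 1) * (g x)\<^sup>2) = ?s - small"
        unfolding small_def sum_subtractf[symmetric] by (intro sum.cong) (auto simp: algebra_simps)
      ultimately have "h / 4 \<le> \<bar>\<Sum>x\<in>D. (of_bool (B x) / q - 1) * (g x)\<^sup>2\<bar>"
        using False split \<open>\<not> h / 2 \<le> big\<close> by linarith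
      then have "(h / 4)\<^sup>2 \<le> \<bar>\<Sum>x\<in>D. (of_bool (B x) / q - 1) * (g x)\<^sup>2\<bar>\<^sup>2"
        using h by (intro power_mono) auto
      then have "(h / 4)\<^sup>2 \<le> ?X B" unfolding power2_abs .
      then have "16 / h * (h / 4)\<^sup>2 \<le> 16 / h * ?X B"
        using h by (intro mult_left_mono) auto
      moreover have "16 / h * (h / 4)\<^sup>2 = h" using h by (simp add: power2_eq_square)
      ultimately show ?thesis using le_h[of B] Nh by linarith
    qed
    define X where "X = ?X"
    have EX: "measure_pmf.expectation P X \<le> \<theta>\<^sup>2 * h / q"
      unfolding X_def by (rule row_variance) (auto simp: D_def)
    have "measure_pmf.expectation P (\<lambda>B. h / (1 + sqrt (S B / N)))
        \<le> measure_pmf.expectation P (\<lambda>B. 2 * sqrt (N * h) + 16 / h * X B)"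
      unfolding X_def by (intro integral_mono integrable_row_sample pt)
    also have "\<dots> = 2 * sqrt (N * h) + 16 / h * measure_pmf.expectation P X"
      by (subst Bochner_Integration.integral_add[OF integrable_row_sample integrable_row_sample]) simp
    also have "\<dots> \<le> 2 * sqrt (N * h) + 16 / h * (\<theta>\<^sup>2 * h / q)"
      using EX h by (intro add_left_mono mult_left_mono) simp_all
    also have "16 / h * (\<theta>\<^sup>2 * h / q) = 16 * \<theta>\<^sup>2 / q" using h by simp
    finally show ?thesis unfolding big_def[symmetric] using big0 by linarith
  qed
qed

end

section \<open>Upper bounds\<close>

lemma four_powr: "(4::real) ^ k = 2 powr (2 * real k)"
  using powr_realpow[of 4 k] powr_powr[of 2 2 "real k"] by simp

lemma two_powr: "(2::real) ^ k = 2 powr (real k)"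
  using powr_realpow[of 2 k] by simp

text \<open>
  Up to level \<open>k0\<close> everything is read. Beyond it the rate falls by \<open>2^(2+\<beta>)\<close> per level, slightly
  more than the factor \<open>4\<close> by which the number of entries grows.
\<close>

definition rate :: "real \<Rightarrow> nat \<Rightarrow> nat \<Rightarrow> real" where
  "rate \<beta> k0 k = (if k \<le> k0 then 1 else 2 powr (- (2 + \<beta>) * real (k - k0)))"

text \<open>
  The common geometric series that dominates the contributions of the incompletely read levels.
\<close>

definition decay :: "real \<Rightarrow> nat \<Rightarrow> nat \<Rightarrow> real" where
  "decay \<beta> k0 k = (if k \<le> k0 then 0 else 2 powr (- \<beta> * real (k - k0)))"

lemma rate_pos [simp]: "0 < rate \<beta> k0 k"
  by (simp add: rate_def)

lemma rate_le_1: "0 < \<beta> \<Longrightarrow> rate \<beta> k0 k \<le> 1"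
proof -
  assume "0 < \<beta>"
  then have "- (2 + \<beta>) * real (k - k0) \<le> 0" by (intro mult_nonpos_nonneg) auto
  then have "2 powr (- (2 + \<beta>) * real (k - k0)) \<le> 2 powr 0" by (intro powr_mono) auto
  then show ?thesis unfolding rate_def by (cases "k \<le> k0") auto
qed

lemma sum_decay_le:
  assumes "0 < \<beta>"
  shows "(\<Sum>k\<le>K. decay \<beta> k0 k) \<le> 1 / (1 - 2 powr - \<beta>)"
proof -
  define r where "r = 2 powr - \<beta>"
  have r: "0 < r" "r < 1" using assms by (simp_all add: r_def powr_less_one)
  have d: "decay \<beta> k0 k = (if k \<le> k0 then 0 else r ^ (k - k0))" for k
    unfolding decay_def r_def powr_level ..
  have "(\<Sum>k\<le>K. decay \<beta> k0 k) = (r - r ^ Suc (K - k0)) / (1 - r)"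
  proof (induction K)
    case 0
    then show ?case by (simp add: d)
  next
    case (Suc K)
    show ?case
    proof (cases "Suc K \<le> k0")
      case True
      then show ?thesis using Suc by (simp add: d)
    next
      case False
      then have "Suc K - k0 = Suc (K - k0)" by simp
      have "(\<Sum>k\<le>Suc K. decay \<beta> k0 k) = (r - r ^ Suc (K - k0)) / (1 - r) + r ^ Suc (K - k0)"
        using Suc False d[of "Suc K"] \<open>Suc K - k0 = Suc (K - k0)\<close> by simp
      also have "\<dots> = (r - r ^ Suc (K - k0) + r ^ Suc (K - k0) * (1 - r)) / (1 - r)"
        using r by (simp add: add_divide_distrib)
      also have "\<dots> = (r - r ^ Suc (Suc K - k0)) / (1 - r)"
        unfolding \<open>Suc K - k0 = Suc (K - k0)\<close> by (simp add: algebra_simps)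
      finally show ?thesis .
    qed
  qed
  also have "\<dots> \<le> 1 / (1 - r)"
  proof (rule divide_right_mono)
    have "0 \<le> r ^ Suc (K - k0)" using r by simp
    then show "r - r ^ Suc (K - k0) \<le> 1" using r by linarith
  qed (use r in simp)
  finally show ?thesis by (simp add: r_def)
qed

lemma sum_rate_le:
  assumes "0 < \<beta>"
  shows "(\<Sum>k\<le>K. rate \<beta> k0 k * 4 ^ k) \<le> (2 + 1 / (1 - 2 powr - \<beta>)) * 4 ^ k0"
proof -
  have le: "rate \<beta> k0 k * 4 ^ k \<le> (if k \<le> k0 then 4 ^ k else 0) + 4 ^ k0 * decay \<beta> k0 k" for k
  proof (cases "k \<le> k0")
    case False
    then show ?thesis
      by (simp add: four_powr rate_def decay_def powr_add[symmetric] of_nat_diff algebra_simps)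
  qed (simp add: rate_def decay_def)
  have geo: "(\<Sum>k\<le>k0. (4::real) ^ k) \<le> 2 * 4 ^ k0" for k0
  proof (induction k0)
    case (Suc k0)
    have "(\<Sum>k\<le>Suc k0. (4::real) ^ k) \<le> 2 * 4 ^ k0 + 4 * 4 ^ k0" using Suc by simp
    also have "\<dots> \<le> 2 * 4 ^ Suc k0" by simp
    finally show ?case .
  qed simp
  have "(\<Sum>k\<le>K. if k \<le> k0 then (4::real) ^ k else 0) = (\<Sum>k\<in>{..K} \<inter> {..k0}. 4 ^ k)"
    by (simp add: sum.If_cases atMost_def)
  also have "\<dots> \<le> (\<Sum>k\<le>k0. (4::real) ^ k)" by (intro sum_mono2) auto
  finally have s: "(\<Sum>k\<le>K. if k \<le> k0 then (4::real) ^ k else 0) \<le> 2 * 4 ^ k0"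
    using geo[of k0] by linarith
  have "(\<Sum>k\<le>K. rate \<beta> k0 k * 4 ^ k)
      \<le> (\<Sum>k\<le>K. (if k \<le> k0 then 4 ^ k else 0) + 4 ^ k0 * decay \<beta> k0 k)"
    by (intro sum_mono le)
  also have "\<dots> \<le> 2 * 4 ^ k0 + 4 ^ k0 * (1 / (1 - 2 powr - \<beta>))"
    unfolding sum.distrib sum_distrib_left[symmetric]
    using s sum_decay_le[OF assms, of k0 K] by (intro add_mono mult_left_mono) auto
  finally show ?thesis by (simp add: algebra_simps)
qed

definition row :: "nat \<Rightarrow> nat \<Rightarrow> (nat \<times> nat \<times> nat) set" where
  "row k i = (\<lambda>j. (k, i, j)) ` {1..2^k}"

definition row_estimate :: "real \<Rightarrow> (nat \<times> nat \<times> nat \<Rightarrow> 'k::real_normed_vector) \<Rightarrow> nat \<Rightarrow> nat \<Rightarrow> real" where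
  "row_estimate q g k i = sqrt ((\<Sum>x\<in>row k i. (norm (g x))\<^sup>2 / q) / 2 ^ k)"

lemma sum_row: "(\<Sum>x\<in>row k i. g x) = (\<Sum>j=1..2^k. g (k, i, j))"
  unfolding row_def by (subst sum.reindex) (auto simp: inj_on_def)

lemma row_levels: "k \<le> K \<Longrightarrow> i \<in> {1..2^k} \<Longrightarrow> row k i \<subseteq> levels K"
  by (auto simp: row_def levels_def)

context
  fixes p u p1 :: ennreal and a b :: real
  assumes p: "1 \<le> p" "p < 2" and u: "2 < u" and p1: "1 \<le> p1"
  defines "a \<equiv> 1 / enn2real p" and "b \<equiv> 1 / enn2real u"
begin

lemma exponents: "1 / 2 < a" "a \<le> 1" "0 \<le> b" "b < 1 / 2"
proof -
  have "p \<noteq> \<infinity>" using p(2) by auto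
  then have "1 \<le> enn2real p" "enn2real p < 2"
    using p enn2real_ge_1[of p] by (auto simp: enn2real_less_iff less_top[symmetric])
  then show "1 / 2 < a" "a \<le> 1" by (auto simp: a_def field_simps)
  show "0 \<le> b" by (simp add: b_def)
  show "b < 1 / 2"
  proof (cases "u = \<infinity>")
    case False
    then have "2 < enn2real u"
      using u by (cases u rule: ennreal_cases) (auto simp: ennreal_less_iff simp flip: ennreal_numeral)
    then show ?thesis by (simp add: b_def field_simps)
  qed (simp add: b_def)
qed

lemma u_ge: "1 \<le> u" "2 \<le> u"
  using u by (auto intro: order_trans[of _ 2])

abbreviation rnorm :: "'k::real_normed_field array_seq \<Rightarrow> nat \<Rightarrow> nat \<Rightarrow> real" where
  "rnorm f k i \<equiv> L_norm u (2 ^ k) (f k i)"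

lemma rnorm_nonneg: "0 \<le> rnorm f k i"
  by (rule L_norm_nonneg) simp

lemma row_sq_le: "(\<Sum>x\<in>row k i. (norm (entry x f))\<^sup>2) \<le> 2 ^ k * (rnorm f k i)\<^sup>2"
  unfolding sum_row using sum_sq_le_L_norm[of "2 ^ k" u "f k i"] u_ge by simp

lemma sum_rnorm_le:
  assumes "f \<in> X_ball p u p1"
  shows "(\<Sum>i=1..2^k. rnorm f k i) \<le> 2 ^ k"
proof -
  have "(\<Sum>i=1..2^k. norm (rnorm f k i)) \<le> 2 ^ k * LL_norm p u (2^k) (2^k) (f k)"
    unfolding LL_norm_def using sum_le_L_norm[of "2 ^ k" p "rnorm f k"] p
    by (simp del: real_norm_def)
  also have "\<dots> \<le> 2 ^ k * 1"
    by (intro mult_left_mono LL_norm_le_1[OF assms p1]) auto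
  finally show ?thesis by (simp add: rnorm_nonneg)
qed

lemma sum_rnorm_sq_le:
  assumes "f \<in> X_ball p u p1"
  shows "(\<Sum>i=1..2^k. (rnorm f k i)\<^sup>2) \<le> 2 powr (2 * a * real k)"
proof -
  have "(\<Sum>i=1..2^k. (norm (rnorm f k i))\<^sup>2)
      \<le> real (2 ^ k) powr (2 / enn2real p) * (LL_norm p u (2^k) (2^k) (f k))\<^sup>2"
    unfolding LL_norm_def using p by (intro sum_sq_le_L_norm_small) auto
  also have "\<dots> \<le> real (2 ^ k) powr (2 / enn2real p) * 1\<^sup>2"
    using LL_norm_le_1[OF assms p1] LL_norm_nonneg[of "2 ^ k" p u "2 ^ k" "f k"]
    by (intro mult_left_mono power_mono) auto
  also have "\<dots> = 2 powr (2 * a * real k)"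
    by (simp add: two_powr powr_powr a_def mult.commute)
  finally show ?thesis by simp
qed

lemma row_estimate_known:
  "row_estimate q (known entry B f) k i
    = sqrt ((\<Sum>x\<in>row k i. of_bool (B x) * (norm (entry x f))\<^sup>2 / q) / 2 ^ k)"
proof -
  have "(norm (known entry B f x))\<^sup>2 / q = of_bool (B x) * (norm (entry x f))\<^sup>2 / q" for x
    by (simp add: known_def)
  then show ?thesis unfolding row_estimate_def by (simp only:)
qed

text \<open>
  The first stage of the adaptive algorithm.
\<close>

abbreviation pilot :: "real \<Rightarrow> nat \<Rightarrow> nat \<Rightarrow> (nat \<times> nat \<times> nat \<Rightarrow> bool) pmf" where
  "pilot \<beta> k0 K \<equiv> Pi_pmf (levels K) False (\<lambda>x. bernoulli_pmf (rate \<beta> k0 (fst x)))"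

lemma pilot_row_estimate:
  assumes "k \<le> K" "i \<in> {1..2^k}" "0 < \<beta>"
  shows "measure_pmf.expectation (pilot \<beta> k0 K)
      (\<lambda>B. row_estimate (rate \<beta> k0 k) (known entry B f) k i) \<le> rnorm f k i"
proof -
  have "measure_pmf.expectation (pilot \<beta> k0 K)
      (\<lambda>B. row_estimate (rate \<beta> k0 k) (known entry B f) k i)
    \<le> sqrt ((\<Sum>x\<in>row k i. (norm (entry x f))\<^sup>2) / 2 ^ k)"
    unfolding row_estimate_known using assms
    by (intro row_estimate_mean row_levels) (auto simp: row_def rate_le_1)
  also have "\<dots> \<le> sqrt ((rnorm f k i)\<^sup>2)"
    using row_sq_le[where k = k and i = i and f = f] by (intro real_sqrt_le_mono) (simp add: field_simps)
  finally show ?thesis by (simp add: rnorm_nonneg)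
qed

text \<open>
  The truncation height belongs to \<open>T = q N\<close>, the expected number of samples in the row: it balances
  the contribution of the large entries against the variance coming from the small ones.
\<close>

lemma pilot_row_bias:
  fixes k0 :: nat
  assumes "k \<le> K" "i \<in> {1..2^k}" "0 < \<beta>"
  defines "q \<equiv> rate \<beta> k0 k"
  shows "measure_pmf.expectation (pilot \<beta> k0 K)
      (\<lambda>B. (\<Sum>x\<in>row k i. (norm (entry x f))\<^sup>2) / (1 + row_estimate q (known entry B f) k i))
    \<le> 2 * 2 ^ k * rnorm f k i + 18 * (q powr (2 * b - 1) * 2 powr (2 * b * real k)) * (rnorm f k i)\<^sup>2"
proof -
  define y where "y = rnorm f k i"
  define T where "T = q * 2 ^ k"
  have T: "T > 0" by (simp add: T_def q_def)
  have y: "0 \<le> y" by (simp add: y_def rnorm_nonneg)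
  let ?h = "\<Sum>x\<in>row k i. (norm (entry x f))\<^sup>2"
  have "measure_pmf.expectation (pilot \<beta> k0 K)
      (\<lambda>B. ?h / (1 + row_estimate q (known entry B f) k i))
    \<le> 2 * sqrt (2 ^ k * ?h)
      + 2 * (\<Sum>x | x \<in> row k i \<and> T powr b * y < \<bar>norm (entry x f)\<bar>. (norm (entry x f))\<^sup>2)
      + 16 * (T powr b * y)\<^sup>2 / q"
    unfolding row_estimate_known using assms
    by (intro row_bias row_levels) (auto simp: row_def rate_le_1)
  also have "\<dots> \<le> 2 * (2 ^ k * y) + 2 * (2 ^ k * T powr (2 * b - 1) * y\<^sup>2)
      + 16 * (2 ^ k * T powr (2 * b - 1) * y\<^sup>2)"
  proof (intro add_mono mult_left_mono)
    have "sqrt (2 ^ k * ?h) \<le> sqrt ((2 ^ k * y)\<^sup>2)"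
      using row_sq_le[where k = k and i = i and f = f] unfolding y_def
      by (intro real_sqrt_le_mono) (simp add: power2_eq_square mult_ac)
    then show "sqrt (2 ^ k * ?h) \<le> 2 ^ k * y" using y by simp
    have "(\<Sum>x | x \<in> row k i \<and> T powr b * y < \<bar>norm (entry x f)\<bar>. (norm (entry x f))\<^sup>2)
      = (\<Sum>j | j \<in> {1..2^k} \<and> norm (f k i j) > T powr b * y. (norm (f k i j))\<^sup>2)"
      by (rule sum.reindex_bij_witness[of _ "\<lambda>j. (k, i, j)" "\<lambda>x. snd (snd x)"]) (auto simp: row_def)
    also have "\<dots> \<le> real (2 ^ k) * T powr (2 * b - 1) * y\<^sup>2"
      unfolding y_def b_def using u T by (intro sum_sq_large_entries) auto
    finally show "(\<Sum>x | x \<in> row k i \<and> T powr b * y < \<bar>norm (entry x f)\<bar>. (norm (entry x f))\<^sup>2)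
      \<le> 2 ^ k * T powr (2 * b - 1) * y\<^sup>2" by simp
    have "(T powr b * y)\<^sup>2 / q = 2 ^ k * (T powr (2 * b) / T) * y\<^sup>2"
      using T by (simp add: T_def power_mult_distrib powr_powr[symmetric] field_simps)
    also have "T powr (2 * b) / T = T powr (2 * b - 1)"
      using T by (simp add: powr_diff)
    finally show "16 * (T powr b * y)\<^sup>2 / q \<le> 16 * (2 ^ k * T powr (2 * b - 1) * y\<^sup>2)" by simp
  qed auto
  also have "2 ^ k * T powr (2 * b - 1) = q powr (2 * b - 1) * 2 powr (2 * b * real k)"
    by (simp add: T_def q_def powr_mult two_powr powr_powr powr_add[symmetric] algebra_simps)
  finally show ?thesis by (simp add: y_def algebra_simps)
qed

lemma sum_levels_rows: "(\<Sum>x\<in>levels K. g x) = (\<Sum>k\<le>K. \<Sum>i=1..2^k. \<Sum>x\<in>row k i. g x)"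
  unfolding sum_levels sum_row ..

lemma weighted_row_sum_le:
  assumes M: "1 \<le> M" and r: "0 < r" "r \<le> s"
    and t: "\<And>x. x \<in> row k i \<Longrightarrow> t x = threshold M s"
    and w: "w = 2 powr (- \<alpha> * real k) / 4 ^ k"
  shows "(\<Sum>x\<in>row k i. (weight \<alpha> x)\<^sup>2 * (norm (entry x f))\<^sup>2 * (real M / real (t x) - 1))
    \<le> (if 1 \<le> r then 0 else w\<^sup>2 * ((\<Sum>x\<in>row k i. (norm (entry x f))\<^sup>2) / s))"
proof -
  have s: "0 < s" using r by simp
  have "(\<Sum>x\<in>row k i. (weight \<alpha> x)\<^sup>2 * (norm (entry x f))\<^sup>2 * (real M / real (t x) - 1))
    = w\<^sup>2 * (\<Sum>x\<in>row k i. (norm (entry x f))\<^sup>2) * (real M / real (threshold M s) - 1)"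
    unfolding sum_distrib_left sum_distrib_right
    by (intro sum.cong) (auto simp: t row_def weight_def w)
  also have "\<dots> \<le> w\<^sup>2 * (\<Sum>x\<in>row k i. (norm (entry x f))\<^sup>2) * (if 1 \<le> r then 0 else 1 / s)"
  proof (intro mult_left_mono)
    show "real M / real (threshold M s) - 1 \<le> (if 1 \<le> r then 0 else 1 / s)"
    proof (cases "1 \<le> s")
      case True
      have "(0::real) \<le> (if 1 \<le> r then 0 else 1 / s)" using s by simp
      then show ?thesis using threshold_inverse_le[OF M s] True by simp
    next
      case False
      then show ?thesis using threshold_inverse_le[OF M s] r by simp
    qed
  qed (auto intro!: mult_nonneg_nonneg sum_nonneg)
  finally show ?thesis by (auto split: if_splits)
qed

lemma e_bound_from_level_bounds:
  fixes thr :: "(nat \<times> nat \<times> nat \<Rightarrow> bool) \<Rightarrow> (nat \<times> nat \<times> nat \<Rightarrow> 'k::{real_normed_field, euclidean_space})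
      \<Rightarrow> nat \<times> nat \<times> nat \<Rightarrow> nat"
  assumes \<alpha>: "1 \<le> \<alpha>" and e: "0 < e"
    and P: "finite (set_pmf P)" "\<And>B x. B \<in> set_pmf P \<Longrightarrow> B x \<Longrightarrow> x \<in> levels K"
    and thr: "\<And>B h x. 1 \<le> thr B h x \<and> thr B h x \<le> M"
    and Q: "Q = (\<lambda>_. True) \<or> Q = nonadaptive \<and> (\<forall>B h h'. thr B h = thr B h')"
    and cost: "\<And>f. f \<in> X_ball p u p1 \<Longrightarrow> measure_pmf.expectation P
      (\<lambda>B. (\<Sum>x\<in>levels K. of_bool (B x))
        + (\<Sum>x\<in>levels K. real (thr B (known entry B f) x) / real M)) \<le> real n"
    and var: "\<And>f. f \<in> X_ball p u p1 \<Longrightarrow> measure_pmf.expectation P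
      (\<lambda>B. \<Sum>x\<in>levels K. (weight \<alpha> x)\<^sup>2 * (norm (entry x f))\<^sup>2
        * (real M / real (thr B (known entry B f) x) - 1)) \<le> e\<^sup>2"
  shows "min_error Q (I_op \<alpha>) (X_ball p u p1 :: 'k array_seq set) std_info n
    \<le> ennreal (e + 2 powr (- \<alpha> * real K))"
proof (rule sampling_scheme[where J = "levels K" and obs = entry and w = "weight \<alpha>" and dflt = "(0, 1, 1)"
      and P = P and thr = thr and M = M])
  show "norm (I_op \<alpha> f - (\<Sum>x\<in>levels K. weight \<alpha> x *\<^sub>R entry x f)) \<le> 2 powr (- \<alpha> * real K)"
    if "f \<in> X_ball p u p1" for f :: "'k array_seq"
    by (rule I_op_truncate[OF that p(1) u_ge(1) p1 \<alpha>])
  show "x \<in> levels K" if "B \<in> set_pmf P" "B x" for B x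
    using P(2) that .
  show "1 \<le> thr B h x \<and> thr B h x \<le> M" for B h x by (rule thr)
  show "entry x \<in> std_info" if "x \<in> levels K" for x using that by (rule entry_std_info)
qed (use P(1) Q cost var e in \<open>auto simp: levels_def\<close>)

text \<open>
  Rounding probabilities up to multiples of \<open>1/M\<close> at most doubles them if \<open>1/M\<close> is below all rates.
\<close>

lemma obtain_resolution:
  obtains M :: nat where "1 \<le> M" "\<And>k. k \<le> K \<Longrightarrow> 1 / real M \<le> rate \<beta> k0 k"
proof
  define M where "M = Suc (nat \<lceil>\<Sum>k\<le>K. 1 / rate \<beta> k0 k\<rceil>)"
  show "1 \<le> M" by (simp add: M_def)
  fix k assume "k \<le> K"
  then have "1 / rate \<beta> k0 k \<le> (\<Sum>k\<le>K. 1 / rate \<beta> k0 k)"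
    by (intro member_le_sum) (auto simp: less_imp_le)
  also have "\<dots> \<le> real M" unfolding M_def by linarith
  finally show "1 / real M \<le> rate \<beta> k0 k"
    using \<open>1 \<le> M\<close> by (simp add: field_simps)
qed

context
  fixes \<alpha> \<beta> G :: real
  assumes \<alpha>: "1 < \<alpha>"
  defines "\<beta> \<equiv> (\<alpha> - 1) / 2" and "G \<equiv> 1 / (1 - 2 powr - \<beta>)"
begin

lemma \<beta>_pos: "0 < \<beta>"
  using \<alpha> by (simp add: \<beta>_def)

text \<open>
  A contribution \<open>q^(-d) N^c\<close> to the variance of level \<open>k\<close>, taken with the squared weight of that
  level, is at most its size at level \<open>k0\<close> times a geometric factor. The condition on \<open>c\<close> and \<open>d\<close>
  compares the growth of \<open>N^c\<close> and \<open>q^(-d)\<close> per level with the decay \<open>2^(-2\<alpha>-4)\<close> of the squared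
  weights; for the exponents that occur below it follows from \<open>\<alpha> > 1\<close>.
\<close>

lemma level_decay:
  fixes c d :: real
  assumes k: "k0 < k" and c: "c + (2 + \<beta>) * d \<le> 2 * \<alpha> + 4 - \<beta>" and d: "d \<ge> 0"
  shows "(2 powr (- \<alpha> * real k) / 4 ^ k)\<^sup>2 * rate \<beta> k0 k powr - d * 2 powr (c * real k)
    \<le> 2 powr ((c - 2 * \<alpha> - 4) * real k0) * decay \<beta> k0 k"
proof -
  define t where "t = real (k - k0)"
  have k': "real k = real k0 + t" "0 \<le> t" using k by (auto simp: t_def)
  have "(2 powr (- \<alpha> * real k) / 4 ^ k)\<^sup>2 * rate \<beta> k0 k powr - d * 2 powr (c * real k)
    = 2 powr (2 * (- \<alpha> * real k - 2 * real k) + (2 + \<beta>) * t * d + c * real k)"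
    using k unfolding t_def[symmetric]
    by (simp add: rate_def four_powr powr_diff[symmetric] power2_eq_square powr_add[symmetric] powr_powr
        algebra_simps flip: t_def)
  also have "\<dots> \<le> 2 powr ((c - 2 * \<alpha> - 4) * real k0 + - \<beta> * t)"
  proof (rule powr_mono)
    have "(c + (2 + \<beta>) * d) * t \<le> (2 * \<alpha> + 4 - \<beta>) * t" using c k' by (intro mult_right_mono) auto
    then show "2 * (- \<alpha> * real k - 2 * real k) + (2 + \<beta>) * t * d + c * real k
        \<le> (c - 2 * \<alpha> - 4) * real k0 + - \<beta> * t"
      by (simp add: k' algebra_simps)
  qed simp
  also have "\<dots> = 2 powr ((c - 2 * \<alpha> - 4) * real k0) * decay \<beta> k0 k"
    using k unfolding powr_add decay_def t_def by simp
  finally show ?thesis .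
qed

lemma G_pos: "0 < G"
  using \<beta>_pos by (simp add: G_def powr_less_one)

lemma sum_level_variances_le:
  assumes "\<And>k. k0 < k \<Longrightarrow> V k \<le> C * decay \<beta> k0 k" "0 \<le> C"
  shows "(\<Sum>k\<le>K. if k \<le> k0 then 0 else V k) \<le> C * G"
proof -
  have "(\<Sum>k\<le>K. if k \<le> k0 then 0 else V k) \<le> (\<Sum>k\<le>K. C * decay \<beta> k0 k)"
    using assms by (intro sum_mono) (auto simp: decay_def)
  also have "\<dots> = C * (\<Sum>k\<le>K. decay \<beta> k0 k)" by (simp add: sum_distrib_left)
  also have "\<dots> \<le> C * G"
    unfolding G_def by (intro mult_left_mono sum_decay_le \<beta>_pos assms(2))
  finally show ?thesis .
qed

text \<open>
  The sum of the squares over a level is at most \<open>N^(1+2a)\<close>, the worst case being one row that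
  carries the whole norm. Hence the standard deviation at level \<open>k0\<close> is of order
  \<open>N^(-\<alpha>) N^(-2) N^(1/2+a)\<close>.
\<close>

lemma nonadaptive_upper_bound:
  assumes n: "2 * (2 + G) * 4 ^ k0 \<le> real n"
  shows "e_ran_non (I_op \<alpha>) (X_ball p u p1 :: 'k::{real_normed_field, euclidean_space} array_seq set) std_info n
    \<le> ennreal ((sqrt G + 1) * 2 powr ((a - 3 / 2 - \<alpha>) * real k0))"
proof -
  \<comment> \<open>Beyond level \<open>2 k0\<close> even the zero estimate is good enough.\<close>
  define K where "K = 2 * k0"
  obtain M where M: "1 \<le> M" "\<And>k. k \<le> K \<Longrightarrow> 1 / real M \<le> rate \<beta> k0 k"
    using obtain_resolution by blast
  define thr :: "(nat \<times> nat \<times> nat \<Rightarrow> bool) \<Rightarrow> (nat \<times> nat \<times> nat \<Rightarrow> 'k) \<Rightarrow> nat \<times> nat \<times> nat \<Rightarrow> nat"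
    where "thr = (\<lambda>_ _ x. threshold M (rate \<beta> k0 (fst x)))"
  define A where "A = 2 powr ((a - 3 / 2 - \<alpha>) * real k0)"
  have A2: "A\<^sup>2 = 2 powr ((1 + 2 * a - 2 * \<alpha> - 4) * real k0)"
    by (simp add: A_def power2_eq_square powr_add[symmetric] algebra_simps)
  have "e_ran_non (I_op \<alpha>) (X_ball p u p1 :: 'k array_seq set) std_info n
      \<le> ennreal (sqrt G * A + 2 powr (- \<alpha> * real K))"
    unfolding e_ran_non_def
  proof (rule e_bound_from_level_bounds[where P = "return_pmf (\<lambda>_. False)" and thr = thr and M = M])
    show "0 < sqrt G * A" using G_pos by (simp add: A_def)
    show "1 \<le> thr B h x \<and> thr B h x \<le> M" for B h x
      using threshold_bounds[OF M(1)] by (simp add: thr_def)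
    fix f :: "'k array_seq" assume f: "f \<in> X_ball p u p1"
    have "(\<Sum>x\<in>levels K. real (thr B h x) / real M) \<le> (\<Sum>x\<in>levels K. 2 * rate \<beta> k0 (fst x))" for B h
    proof (rule sum_mono)
      fix x assume "x \<in> levels K"
      then have "1 / real M \<le> rate \<beta> k0 (fst x)" using M(2) by (auto simp: levels_def)
      then show "real (thr B h x) / real M \<le> 2 * rate \<beta> k0 (fst x)"
        using threshold_le[OF M(1), of "rate \<beta> k0 (fst x)"] by (simp add: thr_def less_imp_le)
    qed
    also have "(\<Sum>x\<in>levels K. 2 * rate \<beta> k0 (fst x)) = 2 * (\<Sum>k\<le>K. rate \<beta> k0 k * 4 ^ k)"
      unfolding sum_levels by (simp add: sum_distrib_left power_mult_distrib[symmetric] mult_ac)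
    also have "\<dots> \<le> 2 * ((2 + G) * 4 ^ k0)"
      unfolding G_def by (intro mult_left_mono sum_rate_le \<beta>_pos) auto
    also have "\<dots> \<le> real n" using n by (simp only: mult.assoc)
    finally show "measure_pmf.expectation (return_pmf (\<lambda>_. False)) (\<lambda>B. (\<Sum>x\<in>levels K. of_bool (B x))
        + (\<Sum>x\<in>levels K. real (thr B (known entry B f) x) / real M)) \<le> real n"
      by simp
    let ?w = "\<lambda>k. 2 powr (- \<alpha> * real k) / 4 ^ k"
    let ?h = "\<lambda>k i. \<Sum>x\<in>row k i. (norm (entry x f))\<^sup>2"
    let ?q = "rate \<beta> k0"
    have "(\<Sum>x\<in>levels K. (weight \<alpha> x)\<^sup>2 * (norm (entry x f))\<^sup>2 * (real M / real (thr B h x) - 1))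
      \<le> (\<Sum>k\<le>K. \<Sum>i=1..2^k. if 1 \<le> ?q k then 0 else (?w k)\<^sup>2 * (?h k i / ?q k))" for B h
      unfolding sum_levels_rows
      by (intro sum_mono weighted_row_sum_le M) (auto simp: thr_def row_def)
    also have "\<dots> \<le> (\<Sum>k\<le>K. if k \<le> k0 then 0 else (?w k)\<^sup>2 * ?q k powr - 1 * 2 powr ((1 + 2 * a) * real k))"
    proof (rule sum_mono)
      fix k
      show "(\<Sum>i=1..2^k. if 1 \<le> ?q k then 0 else (?w k)\<^sup>2 * (?h k i / ?q k))
        \<le> (if k \<le> k0 then 0 else (?w k)\<^sup>2 * ?q k powr - 1 * 2 powr ((1 + 2 * a) * real k))"
      proof (cases "k \<le> k0")
        case True
        then show ?thesis by (simp add: rate_def)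
      next
        case False
        have "(\<Sum>i=1..2^k. if 1 \<le> ?q k then 0 else (?w k)\<^sup>2 * (?h k i / ?q k))
          \<le> (\<Sum>i=1..2^k. (?w k)\<^sup>2 * (2 ^ k * (rnorm f k i)\<^sup>2 / ?q k))"
          by (intro sum_mono) (auto intro!: mult_left_mono divide_right_mono row_sq_le mult_nonneg_nonneg
              divide_nonneg_pos simp: less_imp_le)
        also have "\<dots> = (?w k)\<^sup>2 * (2 ^ k * (\<Sum>i=1..2^k. (rnorm f k i)\<^sup>2) / ?q k)"
          by (simp add: sum_distrib_left sum_divide_distrib)
        also have "\<dots> \<le> (?w k)\<^sup>2 * (2 ^ k * 2 powr (2 * a * real k) / ?q k)"
          using sum_rnorm_sq_le[OF f, of k]
          by (intro mult_left_mono divide_right_mono) (auto simp: less_imp_le)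
        also have "\<dots> = (?w k)\<^sup>2 * ?q k powr - 1 * 2 powr ((1 + 2 * a) * real k)"
          by (simp add: two_powr powr_add[symmetric] powr_minus divide_inverse algebra_simps less_imp_le)
        finally show ?thesis using False by simp
      qed
    qed
    also have "\<dots> \<le> A\<^sup>2 * G"
    proof (rule sum_level_variances_le)
      fix k assume "k0 < k"
      then show "(?w k)\<^sup>2 * ?q k powr - 1 * 2 powr ((1 + 2 * a) * real k) \<le> A\<^sup>2 * decay \<beta> k0 k"
        unfolding A2 using exponents \<alpha> by (intro level_decay) (auto simp: \<beta>_def field_simps)
    qed simp
    also have "\<dots> = (sqrt G * A)\<^sup>2" using G_pos by (simp add: power_mult_distrib)
    finally show "measure_pmf.expectation (return_pmf (\<lambda>_. False)) (\<lambda>B. \<Sum>x\<in>levels K.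
        (weight \<alpha> x)\<^sup>2 * (norm (entry x f))\<^sup>2 * (real M / real (thr B (known entry B f) x) - 1))
      \<le> (sqrt G * A)\<^sup>2"
      by simp
  qed (use \<alpha> in \<open>auto simp: thr_def\<close>)
  also have "2 powr (- \<alpha> * real K) \<le> A"
    unfolding A_def K_def
  proof (rule powr_mono)
    have "(3 / 2 - a) * real k0 \<le> \<alpha> * real k0" using exponents \<alpha> by (intro mult_right_mono) auto
    then show "- \<alpha> * real (2 * k0) \<le> (a - 3 / 2 - \<alpha>) * real k0" by (simp add: algebra_simps)
  qed simp
  then have "ennreal (sqrt G * A + 2 powr (- \<alpha> * real K)) \<le> ennreal ((sqrt G + 1) * A)"
    by (intro ennreal_leI) (simp add: algebra_simps)
  finally show ?thesis by (simp add: A_def)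
qed

text \<open>
  Here \<open>s\<^sub>i\<close> denotes the pilot estimate for row \<open>i\<close>. The expected cost of the second stage is bounded
  through \<open>E s\<^sub>i \<le> \<parallel>f\<^sub>i\<parallel>\<close> and the fact that these norms have mean at most \<open>1\<close>. In the variance,
  \<open>pilot_row_bias\<close> splits every row into a part linear in \<open>\<parallel>f\<^sub>i\<parallel>\<close>, which sums to \<open>2 N\<^sup>2\<close> and yields
  the first term of the bound, and a part quadratic in \<open>\<parallel>f\<^sub>i\<parallel>\<close>, which sums to a multiple of
  \<open>N^(2a+2b)\<close> and yields the second term.
\<close>

lemma adaptive_upper_bound:
  assumes n: "4 * (2 + G) * 4 ^ k0 \<le> real n"
  shows "e_ran (I_op \<alpha>) (X_ball p u p1 :: 'k::{real_normed_field, euclidean_space} array_seq set) std_info n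
    \<le> ennreal ((sqrt (18 * G) + 1)
        * (2 powr ((- 1 - \<alpha>) * real k0) + 2 powr ((a + b - 2 - \<alpha>) * real k0)))"
proof -
  \<comment> \<open>Beyond level \<open>2 k0\<close> even the zero estimate is good enough.\<close>
  define K where "K = 2 * k0"
  obtain M where M: "1 \<le> M" "\<And>k. k \<le> K \<Longrightarrow> 1 / real M \<le> rate \<beta> k0 k"
    using obtain_resolution by blast
  let ?q = "rate \<beta> k0"
  let ?P = "pilot \<beta> k0 K"
  define s :: "(nat \<times> nat \<times> nat \<Rightarrow> 'k) \<Rightarrow> nat \<Rightarrow> nat \<Rightarrow> real"
    where "s h k i = row_estimate (?q k) h k i" for h k i
  have s0: "0 \<le> s h k i" for h k i
    unfolding s_def row_estimate_def by (auto intro!: sum_nonneg divide_nonneg_pos)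
  define thr :: "(nat \<times> nat \<times> nat \<Rightarrow> bool) \<Rightarrow> (nat \<times> nat \<times> nat \<Rightarrow> 'k) \<Rightarrow> nat \<times> nat \<times> nat \<Rightarrow> nat"
    where "thr = (\<lambda>_ h (k, i, j). threshold M (?q k * (1 + s h k i)))"
  define A where "A = 2 powr ((- 1 - \<alpha>) * real k0)"
  define B' where "B' = 2 powr ((a + b - 2 - \<alpha>) * real k0)"
  have A2: "A\<^sup>2 = 2 powr ((2 - 2 * \<alpha> - 4) * real k0)"
    by (simp add: A_def power2_eq_square powr_add[symmetric] algebra_simps)
  have B2: "B'\<^sup>2 = 2 powr ((2 * a + 2 * b - 2 * \<alpha> - 4) * real k0)"
    by (simp add: B'_def power2_eq_square powr_add[symmetric] algebra_simps)
  have finP: "finite (set_pmf ?P)"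
    by (rule finite_set_Pi_pmf[OF finite_levels]) (rule finite_subset[OF subset_UNIV], simp)
  note int = integrable_measure_pmf_finite[OF finP]
  have "e_ran (I_op \<alpha>) (X_ball p u p1 :: 'k array_seq set) std_info n
      \<le> ennreal (sqrt (18 * G) * (A + B') + 2 powr (- \<alpha> * real K))"
    unfolding e_ran_def
  proof (rule e_bound_from_level_bounds[where P = ?P and thr = thr and M = M])
    show "0 < sqrt (18 * G) * (A + B')" using G_pos by (simp add: A_def B'_def add_pos_pos)
    show "1 \<le> thr B h x \<and> thr B h x \<le> M" for B h x
      using threshold_bounds[OF M(1)] by (simp add: thr_def case_prod_unfold)
    show "finite (set_pmf ?P)" by (rule finP)
    show "x \<in> levels K" if "B \<in> set_pmf ?P" "B x" for B x
      using subsetD[OF set_Pi_pmf_subset[OF finite_levels] that(1)] that(2) by blast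
    fix f :: "'k array_seq" assume f: "f \<in> X_ball p u p1"
    let ?s = "\<lambda>B k i. s (known entry B f) k i"
    have Es: "measure_pmf.expectation ?P (\<lambda>B. ?s B k i) \<le> rnorm f k i"
      if "k \<le> K" "i \<in> {1..2^k}" for k i
      unfolding s_def by (rule pilot_row_estimate[OF that \<beta>_pos])
    have thr_le: "(\<Sum>x\<in>levels K. real (thr B (known entry B f) x) / real M)
      \<le> (\<Sum>k\<le>K. \<Sum>i=1..2^k. 2 ^ k * (?q k * (2 + ?s B k i)))" for B
      unfolding sum_levels
    proof (intro sum_mono)
      fix k i assume k: "k \<in> {..K}" "i \<in> {1..2 ^ k :: nat}"
      have "(\<Sum>j=1..2^k. real (thr B (known entry B f) (k, i, j)) / real M)
        = 2 ^ k * (real (threshold M (?q k * (1 + ?s B k i))) / real M)"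
        by (simp add: thr_def)
      also have "\<dots> \<le> 2 ^ k * (?q k * (1 + ?s B k i) + 1 / real M)"
        using s0[of "known entry B f" k i]
        by (intro mult_left_mono threshold_le M mult_nonneg_nonneg) (auto simp: less_imp_le)
      also have "\<dots> \<le> 2 ^ k * (?q k * (1 + ?s B k i) + ?q k)"
        using M(2)[of k] k by (intro mult_left_mono add_left_mono) auto
      finally show "(\<Sum>j=1..2^k. real (thr B (known entry B f) (k, i, j)) / real M)
        \<le> 2 ^ k * (?q k * (2 + ?s B k i))" by (simp add: algebra_simps)
    qed
    have pilot_cost: "measure_pmf.expectation ?P (\<lambda>B. \<Sum>x\<in>levels K. of_bool (B x)) = (\<Sum>k\<le>K. ?q k * 4 ^ k)"
    proof -
      have "measure_pmf.expectation ?P (\<lambda>B. \<Sum>x\<in>levels K. of_bool (B x))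
        = (\<Sum>x\<in>levels K. measure_pmf.expectation ?P (\<lambda>B. of_bool (B x) :: real))"
        by (rule Bochner_Integration.integral_sum[OF int])
      also have "\<dots> = (\<Sum>x\<in>levels K. ?q (fst x))"
      proof (rule sum.cong[OF refl])
        fix x assume "x \<in> levels K"
        then show "measure_pmf.expectation ?P (\<lambda>B. of_bool (B x)) = ?q (fst x)"
          using rate_le_1[OF \<beta>_pos, of k0 "fst x"]
          by (subst expectation_Pi_pmf_component[where h = of_bool]) (auto simp: less_imp_le)
      qed
      also have "\<dots> = (\<Sum>k\<le>K. ?q k * 4 ^ k)"
        unfolding sum_levels by (simp add: sum_distrib_left power_mult_distrib[symmetric] mult_ac)
      finally show ?thesis .
    qed
    have "measure_pmf.expectation ?P (\<lambda>B. (\<Sum>x\<in>levels K. of_bool (B x))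
        + (\<Sum>x\<in>levels K. real (thr B (known entry B f) x) / real M))
      \<le> measure_pmf.expectation ?P (\<lambda>B. (\<Sum>x\<in>levels K. of_bool (B x))
        + (\<Sum>k\<le>K. \<Sum>i=1..2^k. 2 ^ k * (?q k * (2 + ?s B k i))))"
      by (intro integral_mono int add_left_mono thr_le)
    also have "\<dots> = (\<Sum>k\<le>K. ?q k * 4 ^ k)
        + (\<Sum>k\<le>K. \<Sum>i=1..2^k. 2 ^ k * (?q k * (2 + measure_pmf.expectation ?P (\<lambda>B. ?s B k i))))"
      by (subst Bochner_Integration.integral_add[OF int int], subst pilot_cost)
         (simp add: Bochner_Integration.integral_sum[OF int] Bochner_Integration.integral_add[OF int int])
    also have "(\<Sum>k\<le>K. \<Sum>i=1..2^k. 2 ^ k * (?q k * (2 + measure_pmf.expectation ?P (\<lambda>B. ?s B k i))))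
      \<le> (\<Sum>k\<le>K. 3 * (?q k * 4 ^ k))"
    proof (rule sum_mono)
      fix k assume k: "k \<in> {..K}"
      have "(\<Sum>i=1..2^k. 2 ^ k * (?q k * (2 + measure_pmf.expectation ?P (\<lambda>B. ?s B k i))))
        \<le> (\<Sum>i=1..2^k. 2 ^ k * (?q k * (2 + rnorm f k i)))"
        using k by (intro sum_mono mult_left_mono add_left_mono Es) (auto simp: less_imp_le)
      also have "\<dots> = 2 ^ k * (?q k * (2 * 2 ^ k + (\<Sum>i=1..2^k. rnorm f k i)))"
        by (simp add: sum_distrib_left[symmetric] sum.distrib)
      also have "\<dots> \<le> 2 ^ k * (?q k * (2 * 2 ^ k + 2 ^ k))"
        by (intro mult_left_mono add_left_mono sum_rnorm_le f) (auto simp: less_imp_le)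
      also have "\<dots> = 3 * (?q k * 4 ^ k)"
        by (simp add: power_mult_distrib[symmetric] algebra_simps)
      finally show "(\<Sum>i=1..2^k. 2 ^ k * (?q k * (2 + measure_pmf.expectation ?P (\<lambda>B. ?s B k i))))
        \<le> 3 * (?q k * 4 ^ k)" .
    qed
    also have "(\<Sum>k\<le>K. ?q k * 4 ^ k) + (\<Sum>k\<le>K. 3 * (?q k * 4 ^ k)) = 4 * (\<Sum>k\<le>K. ?q k * 4 ^ k)"
      by (simp add: sum_distrib_left[symmetric])
    also have "\<dots> \<le> 4 * ((2 + G) * 4 ^ k0)"
      unfolding G_def by (intro mult_left_mono sum_rate_le \<beta>_pos) auto
    also have "\<dots> \<le> real n" using n by (simp only: mult.assoc)
    finally show "measure_pmf.expectation ?P (\<lambda>B. (\<Sum>x\<in>levels K. of_bool (B x))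
        + (\<Sum>x\<in>levels K. real (thr B (known entry B f) x) / real M)) \<le> real n"
      by simp
    let ?w = "\<lambda>k. 2 powr (- \<alpha> * real k) / 4 ^ k"
    let ?h = "\<lambda>k i. \<Sum>x\<in>row k i. (norm (entry x f))\<^sup>2"
    let ?r = "\<lambda>k i. 2 * 2 ^ k * rnorm f k i
        + 18 * (?q k powr (2 * b - 1) * 2 powr (2 * b * real k)) * (rnorm f k i)\<^sup>2"
    let ?V1 = "\<lambda>k. (?w k)\<^sup>2 * ?q k powr - 1 * 2 powr (2 * real k)"
    let ?V2 = "\<lambda>k. (?w k)\<^sup>2 * ?q k powr - (2 - 2 * b) * 2 powr ((2 * a + 2 * b) * real k)"
    have row_var: "(\<Sum>x\<in>levels K. (weight \<alpha> x)\<^sup>2 * (norm (entry x f))\<^sup>2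
          * (real M / real (thr B (known entry B f) x) - 1))
      \<le> (\<Sum>k\<le>K. \<Sum>i=1..2^k. if 1 \<le> ?q k then 0 else (?w k)\<^sup>2 / ?q k * (?h k i / (1 + ?s B k i)))" for B
      unfolding sum_levels_rows
    proof (intro sum_mono)
      fix k i
      have "?q k * 1 \<le> ?q k * (1 + ?s B k i)"
        using s0[of "known entry B f" k i] by (intro mult_left_mono) (auto simp: less_imp_le)
      then have "(\<Sum>x\<in>row k i. (weight \<alpha> x)\<^sup>2 * (norm (entry x f))\<^sup>2
          * (real M / real (thr B (known entry B f) x) - 1))
        \<le> (if 1 \<le> ?q k then 0 else (?w k)\<^sup>2 * (?h k i / (?q k * (1 + ?s B k i))))"
        by (intro weighted_row_sum_le M) (auto simp: thr_def row_def)
      then show "(\<Sum>x\<in>row k i. (weight \<alpha> x)\<^sup>2 * (norm (entry x f))\<^sup>2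
          * (real M / real (thr B (known entry B f) x) - 1))
        \<le> (if 1 \<le> ?q k then 0 else (?w k)\<^sup>2 / ?q k * (?h k i / (1 + ?s B k i)))"
        by (cases "1 \<le> ?q k") simp_all
    qed
    have "measure_pmf.expectation ?P (\<lambda>B. \<Sum>x\<in>levels K. (weight \<alpha> x)\<^sup>2 * (norm (entry x f))\<^sup>2
          * (real M / real (thr B (known entry B f) x) - 1))
      \<le> measure_pmf.expectation ?P (\<lambda>B. \<Sum>k\<le>K. \<Sum>i=1..2^k.
          if 1 \<le> ?q k then 0 else (?w k)\<^sup>2 / ?q k * (?h k i / (1 + ?s B k i)))"
      by (intro integral_mono int row_var)
    also have "\<dots> = (\<Sum>k\<le>K. \<Sum>i=1..2^k. measure_pmf.expectation ?P (\<lambda>B.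
          if 1 \<le> ?q k then 0 else (?w k)\<^sup>2 / ?q k * (?h k i / (1 + ?s B k i))))"
      by (simp only: Bochner_Integration.integral_sum[OF int])
    also have "\<dots> \<le> (\<Sum>k\<le>K. if k \<le> k0 then 0 else 2 * ?V1 k + 18 * ?V2 k)"
    proof (rule sum_mono)
      fix k assume k: "k \<in> {..K}"
      show "(\<Sum>i=1..2^k. measure_pmf.expectation ?P (\<lambda>B.
          if 1 \<le> ?q k then 0 else (?w k)\<^sup>2 / ?q k * (?h k i / (1 + ?s B k i))))
        \<le> (if k \<le> k0 then 0 else 2 * ?V1 k + 18 * ?V2 k)"
      proof (cases "k \<le> k0")
        case True
        then show ?thesis by (simp add: rate_def)
      next
        case False
        have "(\<Sum>i=1..2^k. measure_pmf.expectation ?P (\<lambda>B.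
            if 1 \<le> ?q k then 0 else (?w k)\<^sup>2 / ?q k * (?h k i / (1 + ?s B k i))))
          \<le> (\<Sum>i=1..2^k. (?w k)\<^sup>2 / ?q k * ?r k i)"
        proof (rule sum_mono)
          fix i assume i: "i \<in> {1..2 ^ k :: nat}"
          have h0: "0 \<le> ?h k i / (1 + ?s B k i)" for B
            using s0[of "known entry B f" k i] by (intro divide_nonneg_nonneg sum_nonneg) auto
          have "measure_pmf.expectation ?P (\<lambda>B.
              if 1 \<le> ?q k then 0 else (?w k)\<^sup>2 / ?q k * (?h k i / (1 + ?s B k i)))
            \<le> measure_pmf.expectation ?P (\<lambda>B. (?w k)\<^sup>2 / ?q k * (?h k i / (1 + ?s B k i)))"
            using h0 by (intro integral_mono int)
              (auto intro!: mult_nonneg_nonneg divide_nonneg_pos simp del: times_divide_eq_right times_divide_eq_left)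
          also have "\<dots> = (?w k)\<^sup>2 / ?q k * measure_pmf.expectation ?P (\<lambda>B. ?h k i / (1 + ?s B k i))"
            by (rule integral_mult_right_zero)
          also have "\<dots> \<le> (?w k)\<^sup>2 / ?q k * ?r k i"
            unfolding s_def using k i pilot_row_bias[OF _ i \<beta>_pos, of K k0 f]
            by (intro mult_left_mono) (auto intro!: divide_nonneg_pos)
          finally show "measure_pmf.expectation ?P (\<lambda>B.
              if 1 \<le> ?q k then 0 else (?w k)\<^sup>2 / ?q k * (?h k i / (1 + ?s B k i)))
            \<le> (?w k)\<^sup>2 / ?q k * ?r k i" .
        qed
        also have "\<dots> = (?w k)\<^sup>2 / ?q k * (2 * 2 ^ k * (\<Sum>i=1..2^k. rnorm f k i)
            + 18 * (?q k powr (2 * b - 1) * 2 powr (2 * b * real k)) * (\<Sum>i=1..2^k. (rnorm f k i)\<^sup>2))"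
          unfolding sum_distrib_left[symmetric] sum.distrib ..
        also have "\<dots> \<le> (?w k)\<^sup>2 / ?q k * (2 * 2 ^ k * 2 ^ k
            + 18 * (?q k powr (2 * b - 1) * 2 powr (2 * b * real k)) * 2 powr (2 * a * real k))"
          by (intro mult_left_mono add_mono sum_rnorm_le sum_rnorm_sq_le f)
             (auto intro!: divide_nonneg_pos)
        also have "\<dots> = 2 * ((?w k)\<^sup>2 * (1 / ?q k) * (2 ^ k * 2 ^ k))
            + 18 * ((?w k)\<^sup>2 * (?q k powr (2 * b - 1) * (1 / ?q k)) * (2 powr (2 * b * real k) * 2 powr (2 * a * real k)))"
          by (simp add: distrib_left mult_ac)
        also have "(2::real) ^ k * 2 ^ k = 2 powr (2 * real k)"
          by (simp add: two_powr powr_add[symmetric])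
        also have "1 / ?q k = ?q k powr - 1"
          by (simp add: powr_minus divide_inverse less_imp_le)
        also have "?q k powr (2 * b - 1) * ?q k powr - 1 = ?q k powr - (2 - 2 * b)"
          unfolding powr_add[symmetric] by (rule arg_cong[where f = "(powr) (?q k)"]) simp
        also have "2 powr (2 * b * real k) * 2 powr (2 * a * real k) = 2 powr ((2 * a + 2 * b) * real k)"
          by (simp add: powr_add[symmetric] algebra_simps)
        finally show ?thesis using False by simp
      qed
    qed
    also have "\<dots> \<le> (2 * A\<^sup>2 + 18 * B'\<^sup>2) * G"
    proof (rule sum_level_variances_le)
      fix k assume k: "k0 < k"
      have 1: "?V1 k \<le> A\<^sup>2 * decay \<beta> k0 k"
        unfolding A2 using k \<alpha> by (intro level_decay) (auto simp: \<beta>_def field_simps)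
      have "0 \<le> \<beta> * b" using \<beta>_pos exponents by simp
      moreover have "2 * a + 3 * \<beta> \<le> 2 * \<alpha>" using exponents \<alpha> by (simp add: \<beta>_def field_simps)
      moreover have "2 * a + 2 * b + (2 + \<beta>) * (2 - 2 * b) = 2 * a + 4 - 2 * b + 2 * \<beta> - 2 * (\<beta> * b)"
        by (simp add: algebra_simps)
      ultimately have c: "2 * a + 2 * b + (2 + \<beta>) * (2 - 2 * b) \<le> 2 * \<alpha> + 4 - \<beta>"
        using exponents by linarith
      have 2: "?V2 k \<le> B'\<^sup>2 * decay \<beta> k0 k"
        unfolding B2 using k exponents by (intro level_decay c) auto
      show "2 * ?V1 k + 18 * ?V2 k \<le> (2 * A\<^sup>2 + 18 * B'\<^sup>2) * decay \<beta> k0 k"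
      proof -
        have "2 * ?V1 k + 18 * ?V2 k
            \<le> 2 * (A\<^sup>2 * decay \<beta> k0 k) + 18 * (B'\<^sup>2 * decay \<beta> k0 k)"
          using 1 2 by (intro add_mono mult_left_mono) simp_all
        then show ?thesis by (simp only: distrib_right mult.assoc)
      qed
    qed simp
    also have "\<dots> \<le> 18 * (A + B')\<^sup>2 * G"
    proof (rule mult_right_mono)
      have "0 \<le> A * B'" by (simp add: A_def B'_def)
      then show "2 * A\<^sup>2 + 18 * B'\<^sup>2 \<le> 18 * (A + B')\<^sup>2"
        by (simp add: power2_sum)
    qed (use G_pos in simp)
    also have "\<dots> = (sqrt (18 * G) * (A + B'))\<^sup>2"
      using G_pos by (simp only: power_mult_distrib) (simp add: mult_ac)
    finally show "measure_pmf.expectation ?P (\<lambda>B. \<Sum>x\<in>levels K. (weight \<alpha> x)\<^sup>2 * (norm (entry x f))\<^sup>2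
          * (real M / real (thr B (known entry B f) x) - 1)) \<le> (sqrt (18 * G) * (A + B'))\<^sup>2" .
  qed (use \<alpha> in auto)
  also have "2 powr (- \<alpha> * real K) \<le> A"
    unfolding A_def K_def
  proof (rule powr_mono)
    have "1 * real k0 \<le> \<alpha> * real k0" using \<alpha> by (intro mult_right_mono) auto
    then show "- \<alpha> * real (2 * k0) \<le> (- 1 - \<alpha>) * real k0" by (simp add: algebra_simps)
  qed simp
  then have "2 powr (- \<alpha> * real K) \<le> A + B'" by (simp add: B'_def add_increasing2)
  then have "ennreal (sqrt (18 * G) * (A + B') + 2 powr (- \<alpha> * real K))
      \<le> ennreal ((sqrt (18 * G) + 1) * (A + B'))"
    by (intro ennreal_leI) (simp add: distrib_right)
  finally show ?thesis by (simp add: A_def B'_def)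
qed

end

end

section \<open>Sums of random signs\<close>

text \<open>
  A choice of signs on \<open>D\<close> is represented by the set \<open>T\<close> of points with sign \<open>+1\<close>, so an expectation
  over random signs is an average over \<open>Pow D\<close>.
\<close>

definition sign_sum :: "'a set \<Rightarrow> 'a set \<Rightarrow> real" where
  "sign_sum D T = (\<Sum>x\<in>D. if x \<in> T then 1 else -1)"

lemma sum_Pow_insert:
  assumes "finite D" "x \<notin> D"
  shows "(\<Sum>T\<in>Pow (insert x D). F (sign_sum (insert x D) T))
    = (\<Sum>T\<in>Pow D. F (sign_sum D T + 1) + F (sign_sum D T - 1))"
proof -
  have out: "sign_sum (insert x D) T = sign_sum D T - 1" if "T \<subseteq> D" for T
    using assms that by (auto simp: sign_sum_def)
  have "sign_sum D (insert x T) = sign_sum D T" for T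
    unfolding sign_sum_def using assms by (intro sum.cong) auto
  then have "sign_sum (insert x D) (insert x T) = sign_sum D T + 1" for T
    using assms by (simp add: sign_sum_def)
  moreover have "inj_on (insert x) (Pow D)"
    using assms by (intro inj_onI) auto
  ultimately have ins: "(\<Sum>T\<in>insert x ` Pow D. F (sign_sum (insert x D) T)) = (\<Sum>T\<in>Pow D. F (sign_sum D T + 1))"
    by (simp add: sum.reindex)
  have "(\<Sum>T\<in>Pow (insert x D). F (sign_sum (insert x D) T))
    = (\<Sum>T\<in>Pow D. F (sign_sum (insert x D) T)) + (\<Sum>T\<in>insert x ` Pow D. F (sign_sum (insert x D) T))"
    unfolding Pow_insert using assms by (intro sum.union_disjoint) auto
  also have "(\<Sum>T\<in>Pow D. F (sign_sum (insert x D) T)) = (\<Sum>T\<in>Pow D. F (sign_sum D T - 1))"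
    by (intro sum.cong) (auto simp: out)
  finally show ?thesis unfolding ins by (simp add: sum.distrib add.commute)
qed

lemma sign_sum_second_moment:
  "finite D \<Longrightarrow> (\<Sum>T\<in>Pow D. (sign_sum D T)\<^sup>2) = 2 ^ card D * real (card D)"
proof (induction D rule: finite_induct)
  case (insert x D)
  have "(\<Sum>T\<in>Pow (insert x D). (sign_sum (insert x D) T)\<^sup>2) = (\<Sum>T\<in>Pow D. 2 * (sign_sum D T)\<^sup>2 + 2)"
    by (subst sum_Pow_insert[where F = "\<lambda>y. y\<^sup>2", OF insert(1,2)])
       (simp add: power2_eq_square algebra_simps)
  also have "\<dots> = 2 * (2 ^ card D * real (card D)) + 2 * 2 ^ card D"
    using insert by (simp add: sum.distrib sum_distrib_left[symmetric] card_Pow)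
  finally show ?case using insert by (simp add: algebra_simps)
qed (simp add: sign_sum_def)

lemma sign_sum_fourth_moment:
  "finite D \<Longrightarrow> (\<Sum>T\<in>Pow D. (sign_sum D T) ^ 4) = 2 ^ card D * (3 * (real (card D))\<^sup>2 - 2 * real (card D))"
proof (induction D rule: finite_induct)
  case (insert x D)
  have "(y + 1) ^ 4 + (y - 1) ^ 4 = 2 * y ^ 4 + 12 * y\<^sup>2 + 2" for y :: real
    by (simp add: power4_eq_xxxx power2_eq_square algebra_simps)
  then have "(\<Sum>T\<in>Pow (insert x D). (sign_sum (insert x D) T) ^ 4)
      = (\<Sum>T\<in>Pow D. 2 * (sign_sum D T) ^ 4 + 12 * (sign_sum D T)\<^sup>2 + 2)"
    by (subst sum_Pow_insert[where F = "\<lambda>y. y ^ 4", OF insert(1,2)]) simp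
  also have "\<dots> = 2 * (2 ^ card D * (3 * (real (card D))\<^sup>2 - 2 * real (card D)))
      + 12 * (2 ^ card D * real (card D)) + 2 * 2 ^ card D"
    using insert by (simp add: sum.distrib sum_distrib_left[symmetric] card_Pow sign_sum_second_moment)
  finally show ?case using insert by (simp add: algebra_simps power2_eq_square)
qed (simp add: sign_sum_def)

text \<open>
  After scaling \<open>y = |x| / l\<close> this is \<open>y \<ge> y\<^sup>2 - y^4/4\<close>. It bounds first absolute moments from below by
  second and fourth moments.
\<close>

lemma abs_ge_moments:
  fixes x l :: real
  assumes "0 < l"
  shows "x\<^sup>2 / l - x ^ 4 / (4 * l ^ 3) \<le> \<bar>x\<bar>"
proof -
  define y where "y = \<bar>x\<bar> / l"
  have y: "0 \<le> y" using assms by (simp add: y_def)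
  have "0 \<le> y ^ 3 - 4 * y + 4"
  proof (cases "y \<le> 2")
    case True
    have "y ^ 3 - 4 * y + 4 = (y - 1)\<^sup>2 * (y + 2) + (2 - y)"
      by (simp add: power2_eq_square power3_eq_cube algebra_simps)
    also have "\<dots> \<ge> 0" using True y by simp
    finally show ?thesis .
  next
    case False
    then have "2 * 2 \<le> y * y" by (intro mult_mono) auto
    then have "y * (2 * 2) \<le> y * (y * y)" using y by (intro mult_left_mono) auto
    then show ?thesis by (simp add: power3_eq_cube)
  qed
  then have "0 \<le> l * y / 4 * (y ^ 3 - 4 * y + 4)" using y assms by simp
  then have "l * (y\<^sup>2 - y ^ 4 / 4) \<le> l * y"
    by (simp add: algebra_simps power2_eq_square power3_eq_cube power4_eq_xxxx)
  moreover have "l * y = \<bar>x\<bar>" "l * y\<^sup>2 = x\<^sup>2 / l" "l * y ^ 4 = x ^ 4 / l ^ 3"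
    using assms by (simp_all add: y_def power_divide power2_eq_square power3_eq_cube power4_eq_xxxx)
  ultimately show ?thesis by (simp add: algebra_simps)
qed

text \<open>
  Khintchine's inequality for the first moment, with the scale \<open>l = sqrt (card D)\<close> in
  \<open>abs_ge_moments\<close>.
\<close>

lemma sum_abs_sign_sum_ge:
  assumes "finite D"
  shows "2 ^ card D * (sqrt (real (card D)) / 4) \<le> (\<Sum>T\<in>Pow D. \<bar>sign_sum D T\<bar>)"
proof (cases "card D = 0")
  case True
  then show ?thesis by (simp add: sum_nonneg)
next
  case False
  define m l where "m = real (card D)" and "l = sqrt m"
  have m: "0 < m" using False by (simp add: m_def)
  have l: "0 < l" "l\<^sup>2 = m" using m by (simp_all add: l_def)
  have "2 ^ card D * (l / 4) \<le> 2 ^ card D * (m / l - (3 * m\<^sup>2 - 2 * m) / (4 * l ^ 3))"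
  proof (intro mult_left_mono)
    have "m / l = l" "m\<^sup>2 / l ^ 3 = l" "0 \<le> m / l ^ 3"
      using l m by (simp_all add: l(2)[symmetric] power2_eq_square power3_eq_cube)
    moreover have "(3 * m\<^sup>2 - 2 * m) / (4 * l ^ 3) = 3 / 4 * (m\<^sup>2 / l ^ 3) - 1 / 2 * (m / l ^ 3)"
      by (simp add: diff_divide_distrib)
    ultimately show "l / 4 \<le> m / l - (3 * m\<^sup>2 - 2 * m) / (4 * l ^ 3)" by linarith
  qed simp
  also have "\<dots> = (\<Sum>T\<in>Pow D. (sign_sum D T)\<^sup>2 / l - (sign_sum D T) ^ 4 / (4 * l ^ 3))"
    using assms by (simp add: sum_subtractf sum_divide_distrib[symmetric] sign_sum_second_moment
        sign_sum_fourth_moment m_def right_diff_distrib)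
  also have "\<dots> \<le> (\<Sum>T\<in>Pow D. \<bar>sign_sum D T\<bar>)"
    by (intro sum_mono abs_ge_moments l)
  finally show ?thesis by (simp add: l_def m_def)
qed

text \<open>
  The distribution of the sign sum is symmetric and \<open>|x - c| + |-x - c| \<ge> 2 |x|\<close>, so no constant is a
  better guess than \<open>0\<close>.
\<close>

lemma sum_abs_shifted_sign_sum_ge:
  assumes "finite D"
  shows "2 ^ card D * (sqrt (real (card D)) / 4) \<le> (\<Sum>T\<in>Pow D. \<bar>sign_sum D T - c\<bar>)"
proof -
  have flip: "sign_sum D (D - T) = - sign_sum D T" for T
    unfolding sign_sum_def sum_negf[symmetric] by (intro sum.cong) auto
  have "(\<Sum>T\<in>Pow D. \<bar>sign_sum D T - c\<bar>) = (\<Sum>T\<in>Pow D. \<bar>- sign_sum D T - c\<bar>)"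
    by (rule sum.reindex_bij_witness[of _ "\<lambda>T. D - T" "\<lambda>T. D - T"]) (auto simp: flip double_diff)
  then have "2 * (\<Sum>T\<in>Pow D. \<bar>sign_sum D T - c\<bar>)
      = (\<Sum>T\<in>Pow D. \<bar>sign_sum D T - c\<bar> + \<bar>- sign_sum D T - c\<bar>)"
    by (simp add: sum.distrib)
  also have "\<dots> \<ge> (\<Sum>T\<in>Pow D. 2 * \<bar>sign_sum D T\<bar>)"
    by (intro sum_mono) linarith
  finally have "(\<Sum>T\<in>Pow D. \<bar>sign_sum D T\<bar>) \<le> (\<Sum>T\<in>Pow D. \<bar>sign_sum D T - c\<bar>)"
    by (simp add: sum_distrib_left[symmetric])
  with sum_abs_sign_sum_ge[OF assms] show ?thesis by linarith
qed

text \<open>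
  Here \<open>Q T\<close> is the set of signs read on input \<open>T\<close> and \<open>r T\<close> the output. Inputs that agree with \<open>T\<close>
  on \<open>Q T\<close> form a subcube \<open>C T\<close> on which the algorithm behaves identically; the subcubes partition
  \<open>Pow D\<close>, and on each of them the output is a constant while the signs outside \<open>Q T\<close> are still
  random. The sum over the cube is compared with the sum of the averages over \<open>C T\<close> by double
  counting.
\<close>

lemma sum_abs_adaptive_ge:
  fixes Q :: "'a set \<Rightarrow> 'a set" and r :: "'a set \<Rightarrow> real"
  assumes D: "finite D" and Q: "\<And>T. T \<subseteq> D \<Longrightarrow> Q T \<subseteq> D"
    and agree: "\<And>T T'. T \<subseteq> D \<Longrightarrow> T' \<subseteq> D \<Longrightarrow> T' \<inter> Q T = T \<inter> Q T \<Longrightarrow> Q T' = Q T \<and> r T' = r T"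
  shows "(\<Sum>T\<in>Pow D. sqrt (real (card (D - Q T))) / 4) \<le> (\<Sum>T\<in>Pow D. \<bar>sign_sum D T - r T\<bar>)"
proof -
  \<comment> \<open>The subcube of inputs that look like \<open>T\<close> to the algorithm.\<close>
  define C where "C T = {T' \<in> Pow D. T' \<inter> Q T = T \<inter> Q T}" for T
  have finC: "finite (C T)" for T using D by (simp add: C_def)
  have C_eq: "C T' = C T" if "T \<in> Pow D" "T' \<in> C T" for T T'
  proof -
    have T: "T \<subseteq> D" "T' \<subseteq> D" "T' \<inter> Q T = T \<inter> Q T"
      using that unfolding C_def by blast+
    then have "Q T' = Q T" using agree by blast
    then show ?thesis unfolding C_def using T(3) by simp
  qed
  have self: "T \<in> C T" if "T \<in> Pow D" for T using that by (simp add: C_def)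
  have C_sym: "T \<in> C T'" if "T \<in> Pow D" "T' \<in> C T" for T T'
    using C_eq[OF that] self[OF that(1)] by simp
  let ?h = "\<lambda>T. \<bar>sign_sum D T - r T\<bar>"
  have cube: "real (card (C T)) * (sqrt (real (card (D - Q T))) / 4) \<le> (\<Sum>T'\<in>C T. ?h T')"
    if T: "T \<in> Pow D" for T
  proof -
    let ?E = "D - Q T"
    have QT: "Q T \<subseteq> D" "T \<subseteq> D" using Q T by auto
    have bij: "bij_betw (\<lambda>R. (T \<inter> Q T) \<union> R) (Pow ?E) (C T)"
      by (rule bij_betw_byWitness[where f' = "\<lambda>T'. T' - Q T"]) (use QT in \<open>auto simp: C_def\<close>)
    \<comment> \<open>The contribution of the signs already read is constant on the subcube.\<close>
    define c where "c = (\<Sum>x\<in>Q T. if x \<in> T then 1 else -1 :: real)"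
    have split: "sign_sum D ((T \<inter> Q T) \<union> R) = sign_sum ?E R + c" if "R \<subseteq> ?E" for R
    proof -
      have "sign_sum D ((T \<inter> Q T) \<union> R)
          = (\<Sum>x\<in>?E. if x \<in> (T \<inter> Q T) \<union> R then 1 else -1) + (\<Sum>x\<in>Q T. if x \<in> (T \<inter> Q T) \<union> R then 1 else -1)"
        unfolding sign_sum_def by (rule sum.subset_diff[OF QT(1) D])
      also have "(\<Sum>x\<in>?E. if x \<in> (T \<inter> Q T) \<union> R then 1 else -1 :: real) = sign_sum ?E R"
        unfolding sign_sum_def by (intro sum.cong) auto
      also have "(\<Sum>x\<in>Q T. if x \<in> (T \<inter> Q T) \<union> R then 1 else -1 :: real) = c"
        unfolding c_def using that by (intro sum.cong) auto
      finally show ?thesis .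
    qed
    have "card (C T) = 2 ^ card ?E"
      using bij_betw_same_card[OF bij] D by (simp add: card_Pow)
    then have "real (card (C T)) * (sqrt (real (card ?E)) / 4) \<le> (\<Sum>R\<in>Pow ?E. \<bar>sign_sum ?E R - (r T - c)\<bar>)"
      using sum_abs_shifted_sign_sum_ge[of ?E "r T - c"] D by simp
    also have "\<dots> = (\<Sum>R\<in>Pow ?E. ?h ((T \<inter> Q T) \<union> R))"
    proof (rule sum.cong[OF refl])
      fix R assume R: "R \<in> Pow ?E"
      then have "(T \<inter> Q T) \<union> R \<subseteq> D" "((T \<inter> Q T) \<union> R) \<inter> Q T = T \<inter> Q T"
        using QT by blast+
      then have "r ((T \<inter> Q T) \<union> R) = r T" using agree[OF QT(2)] by blast
      then show "\<bar>sign_sum ?E R - (r T - c)\<bar> = ?h ((T \<inter> Q T) \<union> R)"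
        using split[of R] R by simp
    qed
    also have "\<dots> = (\<Sum>T'\<in>C T. ?h T')" by (rule sum.reindex_bij_betw[OF bij])
    finally show ?thesis .
  qed
  have "(\<Sum>T\<in>Pow D. sqrt (real (card (D - Q T))) / 4) \<le> (\<Sum>T\<in>Pow D. \<Sum>T'\<in>C T. ?h T' / real (card (C T)))"
  proof (rule sum_mono)
    fix T assume T: "T \<in> Pow D"
    have "card (C T) \<noteq> 0" using self[OF T] finC by auto
    then show "sqrt (real (card (D - Q T))) / 4 \<le> (\<Sum>T'\<in>C T. ?h T' / real (card (C T)))"
      using cube[OF T] unfolding sum_divide_distrib[symmetric] by (simp add: pos_le_divide_eq mult.commute)
  qed
  also have "\<dots> = (\<Sum>T\<in>Pow D. \<Sum>T'\<in>{T' \<in> Pow D. T' \<in> C T}. ?h T' / real (card (C T)))"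
    by (intro sum.cong) (auto simp: C_def)
  also have "\<dots> = (\<Sum>T'\<in>Pow D. \<Sum>T\<in>{T \<in> Pow D. T' \<in> C T}. ?h T' / real (card (C T)))"
    by (rule sum.swap_restrict) (use D in auto)
  also have "\<dots> = (\<Sum>T'\<in>Pow D. \<Sum>T\<in>C T'. ?h T' / real (card (C T')))"
  proof (rule sum.cong[OF refl])
    fix T' assume T': "T' \<in> Pow D"
    have "{T \<in> Pow D. T' \<in> C T} = C T'"
    proof (intro set_eqI iffI)
      show "T \<in> C T'" if "T \<in> {T \<in> Pow D. T' \<in> C T}" for T
        using that C_sym[of T T'] by simp
      show "T \<in> {T \<in> Pow D. T' \<in> C T}" if "T \<in> C T'" for T
        using C_sym[OF T' that] that by (simp add: C_def)
    qed
    moreover have "C T = C T'" if "T \<in> C T'" for T using C_eq[OF T' that] .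
    ultimately show "(\<Sum>T\<in>{T \<in> Pow D. T' \<in> C T}. ?h T' / real (card (C T)))
        = (\<Sum>T\<in>C T'. ?h T' / real (card (C T')))" by simp
  qed
  also have "\<dots> = (\<Sum>T'\<in>Pow D. ?h T')"
  proof (rule sum.cong[OF refl])
    fix T' assume "T' \<in> Pow D"
    then have "card (C T') \<noteq> 0" using self finC by auto
    then show "(\<Sum>T\<in>C T'. ?h T' / real (card (C T'))) = ?h T'" by simp
  qed
  finally show ?thesis .
qed

section \<open>Lower bounds\<close>

text \<open>
  Queries are functionals; the choice operator recovers a point that represents the functional.
\<close>

definition queried :: "('k array_seq, 'k, 'g) algorithm \<Rightarrow> 'k array_seq \<Rightarrow> (nat \<times> nat \<times> nat) set" where
  "queried A f = {x. \<exists>i. enat i < cost A f \<and> x = (SOME x. query A (info A f i) = entry x)}"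

lemma length_info [simp]: "length (info A f n) = n"
  by (induction n) auto

lemma query_queried:
  fixes A :: "('k array_seq, 'k, 'g) algorithm"
  assumes "det_algorithm std_info A" "enat i < cost A f"
  obtains x where "x \<in> queried A f" "query A (info A f i) = entry x"
proof -
  have "query A (info A f i) \<in> std_info" using assms(1) by (simp add: det_algorithm_def)
  then obtain k i' j where "query A (info A f i) = (\<lambda>f. f k i' j)"
    unfolding std_info_def by blast
  then have "query A (info A f i) = entry (k, i', j)" by (simp add: entry_def)
  then have "query A (info A f i) = entry (SOME x. query A (info A f i) = entry x)" by (rule someI)
  then show ?thesis using assms(2) that unfolding queried_def by blast
qed

lemma card_queried_le: "cost A f = enat n \<Longrightarrow> finite (queried A f) \<and> card (queried A f) \<le> n"
proof -
  assume c: "cost A f = enat n"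
  have "queried A f = (\<lambda>i. SOME x. query A (info A f i) = entry x) ` {..<n}"
    by (auto simp: queried_def c)
  then show ?thesis using card_image_le[of "{..<n}"] by simp
qed

text \<open>
  By induction along the run on \<open>f\<close>: as long as all observed values coincide, so do the next query
  and the decision to stop.
\<close>

lemma indistinguishable:
  assumes A: "det_algorithm std_info A" and fg: "\<And>x. x \<in> queried A f \<Longrightarrow> entry x g = entry x f"
  shows "cost A g = cost A f" "result A g = result A f" "queried A g = queried A f"
proof -
  have info: "info A g i = info A f i" if "enat i \<le> cost A f" for i
    using that
  proof (induction i)
    case (Suc i)
    then have i: "enat i < cost A f" by (simp add: Suc_ile_eq)
    then have IH: "info A g i = info A f i" using Suc by simp
    obtain x where "x \<in> queried A f" "query A (info A f i) = entry x"
      using query_queried[OF A i] .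
    then show ?case using fg by (simp add: IH)
  qed simp
  show c: "cost A g = cost A f"
  proof (cases "cost A f")
    case infinity
    then have "info A g i = info A f i" for i using info by simp
    then show ?thesis by (simp add: cost_def)
  next
    case (enat n)
    have st: "stop A (info A f n)"
      using enat LeastI_ex[of "\<lambda>n. stop A (info A f n)"] by (auto simp: cost_def split: if_splits)
    have nst: "\<not> stop A (info A f m)" if "m < n" for m
      using enat that not_less_Least[of m "\<lambda>n. stop A (info A f n)"] by (auto simp: cost_def split: if_splits)
    have "(LEAST n. stop A (info A g n)) = n"
    proof (rule Least_equality)
      show "stop A (info A g n)" using st info[of n] enat by simp
      show "n \<le> m" if "stop A (info A g m)" for m
        using that nst[of m] info[of m] enat by (metis enat_ord_simps(1) linorder_not_le less_imp_le)
    qed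
    moreover have "stop A (info A g n)" using st info[of n] enat by simp
    ultimately show ?thesis unfolding enat by (auto simp: cost_def)
  qed
  show "result A g = result A f"
    unfolding result_def c using info by (auto split: enat.split)
  show "queried A g = queried A f"
    unfolding queried_def c
    by (intro Collect_cong ex_cong1 conj_cong refl) (simp add: info less_imp_le)
qed

lemma nonadaptive_cost_queried:
  assumes "nonadaptive A"
  shows "cost A g = cost A f" "queried A g = queried A f"
proof -
  have s: "stop A (info A g n) = stop A (info A f n)" "query A (info A g n) = query A (info A f n)" for n
    using assms unfolding nonadaptive_def by (metis length_info)+
  show c: "cost A g = cost A f" unfolding cost_def s ..
  show "queried A g = queried A f" unfolding queried_def c s ..
qed

text \<open>
  The supremum over all inputs is at least the average over a finite family, and after
  exchanging sum and integral it suffices to argue about deterministic algorithms. For those, an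
  inequality of the form error \<open>+ c \<sqdot>\<close> cost \<open>\<ge> d\<close> is required. It is linear in the cost, so it can be
  integrated, and bounds on the expected cost are enough. The cost may use up half of \<open>d\<close>. The inputs on which the cost is
  measured may differ from those on which the error is measured.
\<close>

lemma min_error_ge:
  fixes S :: "'f \<Rightarrow> 'g::{banach, second_countable_topology}"
  assumes T: "finite T" "T \<noteq> {}" "\<And>t. t \<in> T \<Longrightarrow> fam t \<in> F" and T': "finite T'" "\<And>t. t \<in> T' \<Longrightarrow> fam' t \<in> F"
    and det: "\<And>A. det_algorithm \<Lambda> A \<Longrightarrow> P A \<Longrightarrow> ennreal (real (card T) * d)
      \<le> (\<Sum>t\<in>T. ennreal (norm (S (fam t) - result A (fam t)))) + ennreal c * (\<Sum>t\<in>T'. ennreal_of_enat (cost A (fam' t)))"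
    and c: "0 \<le> c" "c * real (card T') * real n \<le> real (card T) * d / 2" and d: "0 \<le> d"
  shows "ennreal (d / 2) \<le> min_error P S F \<Lambda> n"
  unfolding min_error_def
proof (rule Inf_greatest, clarify)
  fix M :: "('f, 'k, 'g) algorithm measure" and A
  assume ran: "randomized_algorithm F \<Lambda> M A" and P: "\<forall>\<omega>\<in>space M. P (A \<omega>)"
    and ec: "expected_cost F M A \<le> of_nat n"
  let ?E = "expected_error S F M A"
  interpret prob_space M using ran by (simp add: randomized_algorithm_def)
  have mcost: "(\<lambda>\<omega>. ennreal_of_enat (cost (A \<omega>) f)) \<in> borel_measurable M" if "f \<in> F" for f
  proof -
    have "(\<lambda>\<omega>. cost (A \<omega>) f) \<in> measurable M (count_space UNIV)"
      using ran that by (simp add: randomized_algorithm_def)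
    then show ?thesis using measurable_compose[of _ M "count_space UNIV" ennreal_of_enat borel] by simp
  qed
  have merr: "(\<lambda>\<omega>. ennreal (norm (S f - result (A \<omega>) f))) \<in> borel_measurable M" if "f \<in> F" for f
  proof -
    have "(\<lambda>\<omega>. result (A \<omega>) f) \<in> borel_measurable M"
      using ran that by (simp add: randomized_algorithm_def)
    then show ?thesis by measurable
  qed
  have m1: "(\<lambda>\<omega>. \<Sum>t\<in>T. ennreal (norm (S (fam t) - result (A \<omega>) (fam t)))) \<in> borel_measurable M"
    by (intro borel_measurable_sum merr T(3))
  have m2: "(\<lambda>\<omega>. \<Sum>t\<in>T'. ennreal_of_enat (cost (A \<omega>) (fam' t))) \<in> borel_measurable M"
    by (intro borel_measurable_sum mcost T'(2))
  have m3: "(\<lambda>\<omega>. ennreal c * (\<Sum>t\<in>T'. ennreal_of_enat (cost (A \<omega>) (fam' t)))) \<in> borel_measurable M"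
    by (rule borel_measurable_times_ennreal[OF borel_measurable_const m2])
  have "ennreal (real (card T) * d) = (\<integral>\<^sup>+\<omega>. ennreal (real (card T) * d) \<partial>M)"
    by (simp add: emeasure_space_1)
  also have "\<dots> \<le> (\<integral>\<^sup>+\<omega>. (\<Sum>t\<in>T. ennreal (norm (S (fam t) - result (A \<omega>) (fam t))))
      + ennreal c * (\<Sum>t\<in>T'. ennreal_of_enat (cost (A \<omega>) (fam' t))) \<partial>M)"
    using ran P by (intro nn_integral_mono det) (auto simp: randomized_algorithm_def)
  also have "\<dots> = (\<integral>\<^sup>+\<omega>. (\<Sum>t\<in>T. ennreal (norm (S (fam t) - result (A \<omega>) (fam t)))) \<partial>M)
      + ennreal c * (\<integral>\<^sup>+\<omega>. (\<Sum>t\<in>T'. ennreal_of_enat (cost (A \<omega>) (fam' t))) \<partial>M)"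
    unfolding nn_integral_add[OF m1 m3] nn_integral_cmult[OF m2] ..
  also have "(\<integral>\<^sup>+\<omega>. (\<Sum>t\<in>T. ennreal (norm (S (fam t) - result (A \<omega>) (fam t)))) \<partial>M)
      = (\<Sum>t\<in>T. \<integral>\<^sup>+\<omega>. ennreal (norm (S (fam t) - result (A \<omega>) (fam t))) \<partial>M)"
    by (intro nn_integral_sum merr T(3))
  also have "(\<integral>\<^sup>+\<omega>. (\<Sum>t\<in>T'. ennreal_of_enat (cost (A \<omega>) (fam' t))) \<partial>M)
      = (\<Sum>t\<in>T'. \<integral>\<^sup>+\<omega>. ennreal_of_enat (cost (A \<omega>) (fam' t)) \<partial>M)"
    by (intro nn_integral_sum mcost T'(2))
  also have "(\<Sum>t\<in>T. \<integral>\<^sup>+\<omega>. ennreal (norm (S (fam t) - result (A \<omega>) (fam t))) \<partial>M)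
      + ennreal c * (\<Sum>t\<in>T'. \<integral>\<^sup>+\<omega>. ennreal_of_enat (cost (A \<omega>) (fam' t)) \<partial>M)
      \<le> (\<Sum>t\<in>T. ?E) + ennreal c * (\<Sum>t\<in>T'. of_nat n)"
  proof (intro add_mono sum_mono mult_left_mono)
    show "(\<integral>\<^sup>+\<omega>. ennreal (norm (S (fam t) - result (A \<omega>) (fam t))) \<partial>M) \<le> ?E" if "t \<in> T" for t
      unfolding expected_error_def by (rule SUP_upper[OF T(3)[OF that]])
    show "(\<integral>\<^sup>+\<omega>. ennreal_of_enat (cost (A \<omega>) (fam' t)) \<partial>M) \<le> of_nat n" if "t \<in> T'" for t
      by (rule order_trans[OF SUP_upper[OF T'(2)[OF that]] ec[unfolded expected_cost_def]])
  qed simp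
  also have "\<dots> = of_nat (card T) * ?E + ennreal (c * real (card T') * real n)"
    using c by (simp add: ennreal_mult ennreal_of_nat_eq_real_of_nat mult.assoc)
  also have "\<dots> \<le> of_nat (card T) * ?E + ennreal (real (card T) * d / 2)"
    by (intro add_left_mono ennreal_leI c)
  finally have main: "ennreal (real (card T) * d) \<le> of_nat (card T) * ?E + ennreal (real (card T) * d / 2)" .
  have cT: "0 < card T" using T by (simp add: card_gt_0_iff)
  show "ennreal (d / 2) \<le> ?E"
  proof (cases ?E rule: ennreal_cases)
    case (real e)
    have "ennreal (real (card T) * d) \<le> ennreal (real (card T) * e + real (card T) * d / 2)"
      using main real d by (simp add: ennreal_of_nat_eq_real_of_nat ennreal_mult ennreal_plus)
    then have "real (card T) * d \<le> real (card T) * e + real (card T) * d / 2"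
      using real d by (subst (asm) ennreal_le_iff) auto
    then have "real (card T) * (d / 2) \<le> real (card T) * e" by simp
    then have "d / 2 \<le> e" using cT by simp
    then show ?thesis using real by (simp add: ennreal_leI)
  qed simp
qed

text \<open>
  Signs of size \<open>v\<close> on the part \<open>D\<close> of level \<open>k\<close>, positive exactly on \<open>T\<close>.
\<close>

definition sign_array :: "nat \<Rightarrow> (nat \<times> nat) set \<Rightarrow> real \<Rightarrow> (nat \<times> nat) set \<Rightarrow> 'k::{real_normed_field} array_seq" where
  "sign_array k D v T = (\<lambda>k' i j. if k' = k then
     (if (i, j) \<in> D then of_real (if (i, j) \<in> T then v else - v) else 0) else 0)"

lemma I_op_sign_array:
  assumes "D \<subseteq> {1..2^k} \<times> {1..2^k}"
  shows "I_op \<alpha> (sign_array k D v T :: 'k::{real_normed_field, banach} array_seq)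
    = of_real (2 powr (- \<alpha> * real k) / 4 ^ k * v * sign_sum D T)"
proof -
  have "(\<Sum>i=1..2^k. \<Sum>j=1..2^k. if (i, j) \<in> D then of_real (if (i, j) \<in> T then v else - v) else 0 :: 'k)
      = (\<Sum>x\<in>{1..2^k} \<times> {1..2^k}. if x \<in> D then of_real (if x \<in> T then v else - v) else 0)"
    unfolding sum.cartesian_product by (intro sum.cong) (auto simp: case_prod_unfold)
  also have "\<dots> = (\<Sum>x\<in>D. of_real (if x \<in> T then v else - v))"
    using assms by (simp add: sum.inter_filter[symmetric] Int_absorb1 Int_def[symmetric] sum.If_cases)
  also have "\<dots> = of_real (v * sign_sum D T)"
    unfolding sign_sum_def sum_distrib_left of_real_sum by (intro sum.cong) auto
  finally show ?thesis
    unfolding sign_array_def I_op_single_level by (simp add: scaleR_conv_of_real mult.assoc)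
qed

lemma sign_array_in_X_ball:
  assumes "1 \<le> p" "1 \<le> u" "1 \<le> p1" "I \<subseteq> {1..2^k}" "J \<subseteq> {1..2^k}" "0 \<le> v"
    "v * (real (card J) / 2^k) powr (1 / enn2real u) * (real (card I) / 2^k) powr (1 / enn2real p) \<le> 1"
  shows "sign_array k (I \<times> J) v T \<in> X_ball p u p1"
  unfolding sign_array_def by (rule rectangle_in_X_ball[OF assms(1-6) _ assms(7)]) (use assms in auto)

text \<open>
  Pairing with \<open>1\<close> reduces the error to a real one without increasing it, so that real and complex
  scalars are treated alike; then \<open>sum_abs_adaptive_ge\<close> applies.
\<close>

lemma sum_sign_array_error_ge:
  fixes A :: "('k::{real_normed_field, euclidean_space} array_seq, 'k, 'k) algorithm" and \<alpha> :: real
  assumes A: "det_algorithm std_info A" and D: "D \<subseteq> {1..2^k} \<times> {1..2^k}" and v: "0 < v"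
  defines "w \<equiv> 2 powr (- \<alpha> * real k) / 4 ^ k * v"
  shows "w / 4 * (\<Sum>T\<in>Pow D. sqrt (real (card (D - {y. (k, y) \<in> queried A (sign_array k D v T)}))))
    \<le> (\<Sum>T\<in>Pow D. norm (I_op \<alpha> (sign_array k D v T) - result A (sign_array k D v T)))"
proof -
  let ?f = "\<lambda>T. sign_array k D v T :: 'k array_seq"
  define Q where "Q T = D \<inter> {y. (k, y) \<in> queried A (?f T)}" for T
  have w: "0 < w" using v by (simp add: w_def)
  have finD: "finite D" using D finite_subset by blast
  have agree: "queried A (?f T') = queried A (?f T) \<and> result A (?f T') = result A (?f T)"
    if "T' \<inter> Q T = T \<inter> Q T" for T T'
  proof -
    have "entry x (?f T') = entry x (?f T)" if x: "x \<in> queried A (?f T)" for x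
    proof (cases x)
      case (fields k' i j)
      show ?thesis
      proof (cases "k' = k \<and> (i, j) \<in> D")
        case True
        then have "(i, j) \<in> Q T" using x fields by (simp add: Q_def)
        then have "(i, j) \<in> T' \<longleftrightarrow> (i, j) \<in> T" using \<open>T' \<inter> Q T = T \<inter> Q T\<close> by blast
        then show ?thesis by (simp add: fields sign_array_def)
      qed (auto simp: fields sign_array_def)
    qed
    then show ?thesis using indistinguishable[OF A, of "?f T" "?f T'"] by blast
  qed
  define r where "r T = (result A (?f T) \<bullet> 1) / w" for T
  have pt: "w * \<bar>sign_sum D T - r T\<bar> \<le> norm (I_op \<alpha> (?f T) - result A (?f T))" for T
  proof -
    have one: "(1::'k) \<bullet> 1 = 1" using power2_norm_eq_inner[of "1::'k"] by simp
    have "(of_real (w * sign_sum D T) - result A (?f T)) \<bullet> 1 = w * (sign_sum D T - r T)"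
      using w by (simp add: r_def inner_diff_left of_real_def one right_diff_distrib)
    then have "\<bar>w * (sign_sum D T - r T)\<bar> \<le> norm (of_real (w * sign_sum D T) - result A (?f T)) * norm (1::'k)"
      using Cauchy_Schwarz_ineq2[of "of_real (w * sign_sum D T) - result A (?f T)" "1::'k"] by simp
    then show ?thesis
      using w unfolding I_op_sign_array[OF D] w_def[symmetric] by (simp add: abs_mult)
  qed
  have "(\<Sum>T\<in>Pow D. sqrt (real (card (D - Q T))) / 4) \<le> (\<Sum>T\<in>Pow D. \<bar>sign_sum D T - r T\<bar>)"
  proof (rule sum_abs_adaptive_ge[OF finD])
    show "Q T' = Q T \<and> r T' = r T" if "T' \<inter> Q T = T \<inter> Q T" for T T'
      using agree[OF that] by (simp add: Q_def r_def)
  qed (auto simp: Q_def)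
  then have "w * (\<Sum>T\<in>Pow D. sqrt (real (card (D - Q T))) / 4) \<le> w * (\<Sum>T\<in>Pow D. \<bar>sign_sum D T - r T\<bar>)"
    using w by (intro mult_left_mono) auto
  also have "\<dots> \<le> (\<Sum>T\<in>Pow D. norm (I_op \<alpha> (?f T) - result A (?f T)))"
    unfolding sum_distrib_left by (intro sum_mono pt)
  finally have "w / 4 * (\<Sum>T\<in>Pow D. sqrt (real (card (D - Q T))))
      \<le> (\<Sum>T\<in>Pow D. norm (I_op \<alpha> (?f T) - result A (?f T)))"
    by (simp add: sum_divide_distrib[symmetric])
  moreover have "D - Q T = D - {y. (k, y) \<in> queried A (?f T)}" for T
    by (auto simp: Q_def)
  ultimately show ?thesis by simp
qed

text \<open>
  Every query reads at most one point of \<open>D\<close>. As an inequality of extended reals the bound also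
  covers runs that never stop.
\<close>

lemma unqueried_plus_cost_ge:
  assumes D: "finite D" and c: "0 < c"
  shows "ennreal (c * real (card D)) \<le> ennreal (c * real (card (D - {y. (k, y) \<in> queried A f})))
    + ennreal c * ennreal_of_enat (cost A f)"
proof (cases "cost A f")
  case (enat m)
  let ?Q = "{y. (k, y) \<in> queried A f}"
  have fin: "finite (queried A f)" "card (queried A f) \<le> m" using card_queried_le[OF enat] by auto
  have "card (D \<inter> ?Q) \<le> card (queried A f)"
    by (rule card_inj_on_le[of "Pair k"]) (use fin in \<open>auto simp: inj_on_def\<close>)
  moreover have "card D = card (D - ?Q) + card (D \<inter> ?Q)"
    using card_Int_Diff[OF D, of ?Q] by simp
  ultimately have "real (card D) \<le> real (card (D - ?Q)) + real m" using fin by linarith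
  then have "c * real (card D) \<le> c * (real (card (D - ?Q)) + real m)" using c by (intro mult_left_mono) auto
  then have "ennreal (c * real (card D)) \<le> ennreal (c * real (card (D - ?Q)) + c * real m)"
    by (intro ennreal_leI) (simp add: distrib_left)
  then show ?thesis
    using c by (simp add: enat ennreal_plus ennreal_mult ennreal_of_nat_eq_real_of_nat)
qed (use c in \<open>simp add: ennreal_mult_top\<close>)

context
  fixes p u p1 :: ennreal and a b \<alpha> :: real
  assumes p: "1 \<le> p" "p < 2" and u: "2 < u" and p1: "1 \<le> p1"
  defines "a \<equiv> 1 / enn2real p" and "b \<equiv> 1 / enn2real u"
begin

lemma u_ge_1: "1 \<le> u"
  using u by (auto intro: order_trans[of _ 2])

lemma zero_in_X_ball: "sign_array k ({} \<times> {}) 0 {} \<in> X_ball p u p1"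
  using p u_ge_1 p1 by (intro sign_array_in_X_ball) auto

text \<open>
  Of the \<open>N\<^sup>2\<close> signs about half remain unread, and \<open>sqrt m \<ge> m / N\<close> for the number \<open>m \<le> N\<^sup>2\<close> of unread
  signs makes the resulting error bound linear in the cost.
\<close>

lemma adaptive_lower_bound_signs:
  assumes n: "2 * real n \<le> 4 ^ k"
  shows "ennreal (2 powr ((- 1 - \<alpha>) * real k) / 8)
    \<le> e_ran (I_op \<alpha>) (X_ball p u p1 :: 'k::{real_normed_field, euclidean_space} array_seq set) std_info n"
proof -
  define D :: "(nat \<times> nat) set" where "D = {1..2^k} \<times> {1..2^k}"
  define w where "w = 2 powr (- \<alpha> * real k) / 4 ^ k * 1"
  define c where "c = w / (4 * 2 ^ k)"
  define d where "d = c * 4 ^ k"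
  let ?f = "\<lambda>T. sign_array k D 1 T :: 'k array_seq"
  have D: "finite D" "card D = 4 ^ k" by (auto simp: D_def power_mult_distrib[symmetric])
  have c: "0 < c" by (simp add: c_def w_def)
  have "ennreal (d / 2) \<le> e_ran (I_op \<alpha>) (X_ball p u p1 :: 'k array_seq set) std_info n"
    unfolding e_ran_def
  proof (rule min_error_ge[where T = "Pow D" and T' = "Pow D" and fam = ?f and fam' = ?f and c = c])
    show "?f T \<in> X_ball p u p1" for T
      unfolding D_def using p u_ge_1 p1 by (intro sign_array_in_X_ball) auto
    then show "?f T \<in> X_ball p u p1" for T .
    fix A :: "('k array_seq, 'k, 'k) algorithm" assume A: "det_algorithm std_info A"
    let ?U = "\<lambda>T. real (card (D - {y. (k, y) \<in> queried A (?f T)}))"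
    have "(\<Sum>T\<in>Pow D. c * ?U T) \<le> (\<Sum>T\<in>Pow D. w / 4 * sqrt (?U T))"
    proof (rule sum_mono)
      fix T
      have "?U T \<le> 4 ^ k" using card_mono[of D "D - {y. (k, y) \<in> queried A (?f T)}"] D by simp
      then have "sqrt (?U T) \<le> sqrt ((2 ^ k)\<^sup>2)"
        by (intro real_sqrt_le_mono) (simp add: power2_eq_square power_mult_distrib[symmetric])
      then have "sqrt (?U T) * sqrt (?U T) \<le> 2 ^ k * sqrt (?U T)" by (intro mult_right_mono) auto
      then have "w / (4 * 2 ^ k) * ?U T \<le> w / (4 * 2 ^ k) * (2 ^ k * sqrt (?U T))"
        by (intro mult_left_mono) (auto simp: w_def)
      then show "c * ?U T \<le> w / 4 * sqrt (?U T)" by (simp add: c_def)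
    qed
    also have "\<dots> \<le> (\<Sum>T\<in>Pow D. norm (I_op \<alpha> (?f T) - result A (?f T)))"
      unfolding sum_distrib_left[symmetric] w_def
      by (rule sum_sign_array_error_ge[OF A]) (auto simp: D_def)
    finally have err: "(\<Sum>T\<in>Pow D. ennreal (c * ?U T)) \<le> (\<Sum>T\<in>Pow D. ennreal (norm (I_op \<alpha> (?f T) - result A (?f T))))"
      using c by (simp add: sum_ennreal ennreal_leI)
    have "ennreal (real (card (Pow D)) * d) = (\<Sum>T\<in>Pow D. ennreal (c * real (card D)))"
      using c by (simp add: d_def D ennreal_mult ennreal_of_nat_eq_real_of_nat)
    also have "\<dots> \<le> (\<Sum>T\<in>Pow D. ennreal (c * ?U T) + ennreal c * ennreal_of_enat (cost A (?f T)))"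
      by (intro sum_mono unqueried_plus_cost_ge D c)
    also have "\<dots> = (\<Sum>T\<in>Pow D. ennreal (c * ?U T)) + ennreal c * (\<Sum>T\<in>Pow D. ennreal_of_enat (cost A (?f T)))"
      unfolding sum.distrib sum_distrib_left ..
    also have "\<dots> \<le> (\<Sum>T\<in>Pow D. ennreal (norm (I_op \<alpha> (?f T) - result A (?f T))))
        + ennreal c * (\<Sum>T\<in>Pow D. ennreal_of_enat (cost A (?f T)))"
      by (intro add_right_mono err)
    finally show "ennreal (real (card (Pow D)) * d) \<le> \<dots>" .
  next
    have "c * real (card (Pow D)) * (2 * real n) \<le> c * real (card (Pow D)) * 4 ^ k"
      using n c by (intro mult_left_mono) auto
    then show "c * real (card (Pow D)) * real n \<le> real (card (Pow D)) * d / 2"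
      by (simp add: d_def mult_ac)
  qed (use D c in \<open>auto simp: d_def\<close>)
  moreover have "d = 2 powr ((- 1 - \<alpha>) * real k) / 4"
    by (simp add: d_def c_def w_def two_powr powr_diff left_diff_distrib powr_minus_divide)
  ultimately show ?thesis by simp
qed

text \<open>
  The cost is measured on the zero input. A spike at a point that is not read there goes
  unnoticed, and then the two spikes of opposite sign receive the same output.
\<close>

lemma adaptive_lower_bound_spike:
  assumes n: "2 * real n \<le> 4 ^ k"
  shows "ennreal (2 powr ((a + b - 2 - \<alpha>) * real k) / 2)
    \<le> e_ran (I_op \<alpha>) (X_ball p u p1 :: 'k::{real_normed_field, euclidean_space} array_seq set) std_info n"
proof -
  define D :: "(nat \<times> nat) set" where "D = {1..2^k} \<times> {1..2^k}"
  define v where "v = 2 powr ((a + b) * real k)"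
  define w where "w = 2 powr (- \<alpha> * real k) / 4 ^ k * v"
  let ?z = "sign_array k ({} \<times> {}) 0 {} :: 'k array_seq"
  let ?f = "\<lambda>(x, s). sign_array k {x} v (if s then {x} else {}) :: 'k array_seq"
  have D: "finite D" "card D = 4 ^ k" by (auto simp: D_def power_mult_distrib[symmetric])
  have w: "0 < w" by (simp add: w_def v_def)
  have "ennreal (w / 2) \<le> e_ran (I_op \<alpha>) (X_ball p u p1 :: 'k array_seq set) std_info n"
    unfolding e_ran_def
  proof (rule min_error_ge[where T = "D \<times> (UNIV :: bool set)" and T' = "{()}" and fam = ?f and fam' = "\<lambda>_. ?z" and c = "2 * w"])
    show "?f t \<in> X_ball p u p1" if tD: "t \<in> D \<times> UNIV" for t
    proof -
      obtain x s where xs: "t = (x, s)" "x \<in> D" using tD by (cases t) simp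
      then obtain i j where "x = (i, j)" "i \<in> {1..2^k}" "j \<in> {1..2^k}"
        unfolding D_def by blast
      with xs have t: "t = ((i, j), s)" "i \<in> {1..2^k}" "j \<in> {1..2^k}" by auto
      have "v * (1 / 2 ^ k) powr b * (1 / 2 ^ k) powr a = 1"
        by (simp add: v_def two_powr powr_divide powr_powr powr_add algebra_simps)
      moreover have "{(i, j)} = {i} \<times> {j}" by simp
      ultimately show ?thesis
        unfolding t prod.case using t p u_ge_1 p1
        by (simp only:) (intro sign_array_in_X_ball, auto simp: a_def b_def v_def)
    qed
    show "?z \<in> X_ball p u p1" by (rule zero_in_X_ball)
    fix A :: "('k array_seq, 'k, 'k) algorithm" assume A: "det_algorithm std_info A"
    let ?Q = "{y. (k, y) \<in> queried A ?z}"
    have miss: "2 * w \<le> (\<Sum>s\<in>UNIV. norm (I_op \<alpha> (?f (x, s)) - result A (?f (x, s))))" if x: "x \<in> D - ?Q" for x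
    proof -
      have same: "result A (?f (x, s)) = result A ?z" for s
      proof (rule indistinguishable[OF A])
        fix y assume y: "y \<in> queried A ?z"
        obtain k' i j where "y = (k', i, j)" by (cases y)
        then show "entry y (?f (x, s)) = entry y ?z"
          using y x by (auto simp: sign_array_def)
      qed
      have "{x} \<subseteq> {1..2^k} \<times> {1..2^k}" using x by (auto simp: D_def)
      then have I: "I_op \<alpha> (?f (x, s)) = of_real (w * (if s then 1 else - 1))" for s
        by (simp add: I_op_sign_array sign_sum_def w_def)
      let ?r = "result A ?z"
      have "2 * w = norm ((of_real w - ?r) - (of_real (- w) - ?r))"
        using w by (simp flip: of_real_add mult_2)
      also have "\<dots> \<le> norm (of_real w - ?r) + norm (of_real (- w) - ?r)" by (rule norm_triangle_ineq4)
      also have "\<dots> = (\<Sum>s\<in>UNIV. norm (of_real (w * (if s then 1 else - 1)) - ?r))"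
        by (simp add: UNIV_bool)
      also have "\<dots> = (\<Sum>s\<in>UNIV. norm (I_op \<alpha> (?f (x, s)) - result A (?f (x, s))))"
        unfolding I same ..
      finally show ?thesis .
    qed
    have "ennreal (2 * w * real (card (D - ?Q))) = ennreal (\<Sum>x\<in>D - ?Q. 2 * w)" by (simp add: mult.commute)
    also have "\<dots> \<le> ennreal (\<Sum>x\<in>D - ?Q. \<Sum>s\<in>UNIV. norm (I_op \<alpha> (?f (x, s)) - result A (?f (x, s))))"
      by (intro ennreal_leI sum_mono miss)
    also have "\<dots> \<le> ennreal (\<Sum>x\<in>D. \<Sum>s\<in>UNIV. norm (I_op \<alpha> (?f (x, s)) - result A (?f (x, s))))"
      using D by (intro ennreal_leI sum_mono2) (auto intro!: sum_nonneg)
    also have "\<dots> = (\<Sum>t\<in>D \<times> UNIV. ennreal (norm (I_op \<alpha> (?f t) - result A (?f t))))"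
    proof -
      have "(\<Sum>x\<in>D. \<Sum>s\<in>UNIV. norm (I_op \<alpha> (?f (x, s)) - result A (?f (x, s))))
          = (\<Sum>t\<in>D \<times> UNIV. norm (I_op \<alpha> (?f t) - result A (?f t)))"
        unfolding sum.cartesian_product by (intro sum.cong) auto
      then show ?thesis by (simp add: sum_ennreal)
    qed
    finally have err: "ennreal (2 * w * real (card (D - ?Q))) \<le> \<dots>" .
    have "ennreal (real (card (D \<times> (UNIV :: bool set))) * w) = ennreal (2 * w * real (card D))"
      by (simp add: card_cartesian_product mult_ac)
    also have "\<dots> \<le> ennreal (2 * w * real (card (D - ?Q))) + ennreal (2 * w) * ennreal_of_enat (cost A ?z)"
      using w by (intro unqueried_plus_cost_ge D) auto
    also have "\<dots> \<le> (\<Sum>t\<in>D \<times> UNIV. ennreal (norm (I_op \<alpha> (?f t) - result A (?f t))))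
        + ennreal (2 * w) * ennreal_of_enat (cost A ?z)"
      by (intro add_right_mono err)
    finally show "ennreal (real (card (D \<times> (UNIV :: bool set))) * w)
      \<le> (\<Sum>t\<in>D \<times> UNIV. ennreal (norm (I_op \<alpha> (?f t) - result A (?f t))))
        + ennreal (2 * w) * (\<Sum>t\<in>{()}. ennreal_of_enat (cost A ?z))" by simp
  next
    have "w * (2 * real n) \<le> w * 4 ^ k" using n w by (intro mult_left_mono) auto
    then show "2 * w * real (card {()}) * real n \<le> real (card (D \<times> (UNIV :: bool set))) * w / 2"
      by (simp add: card_cartesian_product D mult_ac)
  qed (use D w in \<open>auto simp: D_def\<close>)
  moreover have "w = 2 powr ((a + b - 2 - \<alpha>) * real k)"
    by (simp add: w_def v_def four_powr powr_diff[symmetric] powr_add[symmetric] algebra_simps)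
  ultimately show ?thesis by simp
qed

text \<open>
  The points read do not depend on the input, so they can be counted on the zero input. Averaged
  over the rows \<open>D i\<close>, the number of unread points of a row is at least \<open>N - cost/N\<close>, and
  \<open>sqrt m \<ge> m / sqrt N\<close> for \<open>m \<le> N\<close> makes the bound linear.
\<close>

lemma nonadaptive_lower_bound:
  assumes n: "2 * real n \<le> 4 ^ k"
  shows "ennreal (2 powr ((a - 3 / 2 - \<alpha>) * real k) / 8)
    \<le> e_ran_non (I_op \<alpha>) (X_ball p u p1 :: 'k::{real_normed_field, euclidean_space} array_seq set) std_info n"
proof -
  define N :: nat where "N = 2 ^ k"
  define D where "D i = {i} \<times> {1..N}" for i :: nat
  define v where "v = 2 powr (a * real k)"
  define w where "w = 2 powr (- \<alpha> * real k) / 4 ^ k * v"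
  define c where "c = w / (4 * sqrt (real N)) * 2 ^ N"
  define d where "d = w / 4 * sqrt (real N)"
  define T where "T = (SIGMA i:{1..N}. Pow (D i))"
  let ?z = "sign_array k ({} \<times> {}) 0 {} :: 'k array_seq"
  let ?f = "\<lambda>(i, R). sign_array k (D i) v R :: 'k array_seq"
  have N: "1 \<le> N" "real N * real N = 4 ^ k" by (auto simp: N_def power_mult_distrib[symmetric])
  have w: "0 < w" by (simp add: w_def v_def)
  have c: "0 < c" using w N by (simp add: c_def)
  have D: "finite (D i)" "card (D i) = N" for i by (auto simp: D_def card_cartesian_product)
  have cardT: "real (card T) = real N * 2 ^ N"
    unfolding T_def using D by (subst card_SigmaI) (auto simp: card_Pow)
  have Td: "real (card T) * d = c * 4 ^ k"
  proof -
    have "real N / sqrt (real N) = sqrt (real N)" using real_div_sqrt by simp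
    moreover have "c * 4 ^ k = w / 4 * 2 ^ N * real N * (real N / sqrt (real N))"
      by (simp add: c_def N(2)[symmetric])
    ultimately show ?thesis unfolding cardT d_def by simp
  qed
  have "ennreal (d / 2) \<le> e_ran_non (I_op \<alpha>) (X_ball p u p1 :: 'k array_seq set) std_info n"
    unfolding e_ran_non_def
  proof (rule min_error_ge[where T = T and T' = "{()}" and fam = ?f and fam' = "\<lambda>_. ?z" and c = c])
    show "?f t \<in> X_ball p u p1" if tT: "t \<in> T" for t
    proof -
      obtain i R where t: "t = (i, R)" "i \<in> {1..2^k}" using tT by (cases t) (simp add: T_def N_def)
      have "v * (1 / 2 ^ k) powr a = 1"
        by (simp add: v_def two_powr powr_divide powr_powr mult.commute)
      then show ?thesis
        unfolding t prod.case D_def N_def using t p u_ge_1 p1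
        by (intro sign_array_in_X_ball) (auto simp: a_def v_def)
    qed
    show "?z \<in> X_ball p u p1" by (rule zero_in_X_ball)
    fix A :: "('k array_seq, 'k, 'k) algorithm" assume A: "det_algorithm std_info A" and non: "nonadaptive A"
    let ?Q = "{y. (k, y) \<in> queried A ?z}"
    have row: "w / (4 * sqrt (real N)) * 2 ^ N * real (card (D i - ?Q))
      \<le> (\<Sum>R\<in>Pow (D i). norm (I_op \<alpha> (?f (i, R)) - result A (?f (i, R))))" if i: "i \<in> {1..N}" for i
    proof -
      let ?m = "real (card (D i - ?Q))"
      have "?m \<le> real N" using card_mono[of "D i" "D i - ?Q"] D by simp
      then have "sqrt ?m * sqrt ?m \<le> sqrt (real N) * sqrt ?m" by (intro mult_right_mono) auto
      then have "?m / sqrt (real N) \<le> sqrt ?m" using N(1) by (simp add: pos_divide_le_eq mult.commute)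
      then have "w / 4 * 2 ^ N * (?m / sqrt (real N)) \<le> w / 4 * 2 ^ N * sqrt ?m"
        using w by (intro mult_left_mono) auto
      also have "\<dots> = w / 4 * (\<Sum>R\<in>Pow (D i). sqrt (real (card (D i - {y. (k, y) \<in> queried A (?f (i, R))}))))"
      proof -
        have "queried A (?f (i, R)) = queried A ?z" for R
          by (rule nonadaptive_cost_queried(2)[OF non])
        then show ?thesis using D by (simp only: sum_constant) (simp add: card_Pow)
      qed
      also have "\<dots> \<le> (\<Sum>R\<in>Pow (D i). norm (I_op \<alpha> (?f (i, R)) - result A (?f (i, R))))"
        unfolding prod.case w_def using i
        by (intro sum_sign_array_error_ge[OF A]) (auto simp: D_def N_def v_def)
      finally show ?thesis by (simp add: mult_ac)
    qed
    let ?S = "{1..N} \<times> {1..N}"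
    have S: "finite ?S" "card ?S = 4 ^ k"
      by (auto simp: N_def power_mult_distrib[symmetric])
    have "card (?S - ?Q) = card (SIGMA i:{1..N}. {j \<in> {1..N}. (i, j) \<notin> ?Q})"
      by (rule arg_cong[where f = card]) auto
    also have "\<dots> = (\<Sum>i=1..N. card (D i - ?Q))"
    proof (subst card_SigmaI)
      have "card (D i - ?Q) = card {j \<in> {1..N}. (i, j) \<notin> ?Q}" for i
        by (rule bij_betw_same_card[of snd], rule bij_betw_byWitness[where f' = "Pair i"])
           (auto simp: D_def)
      then show "(\<Sum>i\<in>{1..N}. card {j \<in> {1..N}. (i, j) \<notin> ?Q}) = (\<Sum>i=1..N. card (D i - ?Q))" by simp
    qed auto
    finally have "c * real (card (?S - ?Q)) = (\<Sum>i=1..N. w / (4 * sqrt (real N)) * 2 ^ N * real (card (D i - ?Q)))"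
      by (simp add: c_def sum_distrib_left)
    also have "\<dots> \<le> (\<Sum>i=1..N. \<Sum>R\<in>Pow (D i). norm (I_op \<alpha> (?f (i, R)) - result A (?f (i, R))))"
      by (intro sum_mono row)
    also have "\<dots> = (\<Sum>t\<in>T. norm (I_op \<alpha> (?f t) - result A (?f t)))"
      unfolding T_def using D by (subst sum.Sigma) (auto simp: case_prod_unfold)
    finally have err: "ennreal (c * real (card (?S - ?Q))) \<le> (\<Sum>t\<in>T. ennreal (norm (I_op \<alpha> (?f t) - result A (?f t))))"
      by (simp add: sum_ennreal ennreal_leI)
    have "ennreal (real (card T) * d) = ennreal (c * real (card ?S))"
      unfolding Td S by simp
    also have "\<dots> \<le> ennreal (c * real (card (?S - ?Q))) + ennreal c * ennreal_of_enat (cost A ?z)"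
      by (intro unqueried_plus_cost_ge S c)
    also have "\<dots> \<le> (\<Sum>t\<in>T. ennreal (norm (I_op \<alpha> (?f t) - result A (?f t)))) + ennreal c * ennreal_of_enat (cost A ?z)"
      by (intro add_right_mono err)
    finally show "ennreal (real (card T) * d)
      \<le> (\<Sum>t\<in>T. ennreal (norm (I_op \<alpha> (?f t) - result A (?f t)))) + ennreal c * (\<Sum>t\<in>{()}. ennreal_of_enat (cost A ?z))"
      by simp
  next
    show "c * real (card {()}) * real n \<le> real (card T) * d / 2"
      unfolding Td using mult_left_mono[OF n, of c] c by simp
    show "finite T" using D by (auto simp: T_def)
    have "(1, {}) \<in> T" using N(1) by (simp add: T_def)
    then show "T \<noteq> {}" by blast
  qed (use w c in \<open>auto simp: d_def\<close>)
  moreover have "d = 2 powr ((a - 3 / 2 - \<alpha>) * real k) / 4"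
  proof -
    have "sqrt (real N) = 2 powr (real k / 2)"
      by (simp add: N_def two_powr powr_half_sqrt[symmetric] powr_powr)
    then show ?thesis
      by (simp add: d_def w_def v_def four_powr powr_diff[symmetric] powr_add[symmetric] algebra_simps)
  qed
  ultimately show ?thesis by simp
qed

end

section \<open>Orders of growth and the ratio of the two errors\<close>

lemma level_for_budget:
  fixes y :: real
  assumes "1 \<le> y"
  obtains k :: nat where "4 ^ k \<le> y" "y < 4 * 4 ^ k"
proof -
  define k where "k = (LEAST k. y < 4 * 4 ^ k)"
  obtain m where "y < 4 ^ m" using real_arch_pow[of 4 y] by auto
  also have "(4::real) ^ m \<le> 4 * 4 ^ m" by simp
  finally have k: "y < 4 * 4 ^ k" unfolding k_def by (rule LeastI)
  have "4 ^ k \<le> y"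
  proof (cases k)
    case (Suc j)
    then have "\<not> y < 4 * 4 ^ j" using not_less_Least[of j "\<lambda>k. y < 4 * 4 ^ k"] by (simp add: k_def)
    then show ?thesis using Suc by simp
  qed (use assms in simp)
  with k show ?thesis using that by blast
qed

lemma powr_level_le:
  assumes "0 < g" "0 < y" "y < 4 * 4 ^ k"
  shows "2 powr (- g * real k) \<le> (y / 4) powr (- (g / 2))"
proof -
  have "2 powr (- g * real k) = (4 ^ k) powr (- (g / 2))"
    by (simp add: four_powr powr_powr mult.commute)
  also have "\<dots> \<le> (y / 4) powr (- (g / 2))"
    using assms by (intro powr_mono2') auto
  finally show ?thesis .
qed

lemma powr_level_ge:
  assumes "0 < g" "4 ^ k \<le> y"
  shows "y powr (- (g / 2)) \<le> 2 powr (- g * real k)"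
proof -
  have "y powr (- (g / 2)) \<le> (4 ^ k) powr (- (g / 2))"
    using assms by (intro powr_mono2') auto
  also have "\<dots> = 2 powr (- g * real k)"
    by (simp add: four_powr powr_powr mult.commute)
  finally show ?thesis .
qed

text \<open>
  Bounds in terms of levels become bounds in terms of \<open>n\<close>: for the upper bound the largest \<open>k\<close> with
  \<open>C 4^k \<le> n\<close> is chosen, for the lower bound the smallest one with \<open>4^k \<ge> 2 n\<close>; in both cases \<open>2^k\<close> is
  comparable with \<open>sqrt n\<close>.
\<close>

lemma order_of_growth:
  fixes e :: "nat \<Rightarrow> ennreal" and g :: "'i \<Rightarrow> real"
  assumes I: "finite I" "\<And>i. i \<in> I \<Longrightarrow> 0 < g i" and pos: "0 < C" "0 < U" "0 < L"
    and upper: "\<And>k n. C * 4 ^ k \<le> real n \<Longrightarrow> e n \<le> ennreal (U * (\<Sum>i\<in>I. 2 powr (- g i * real k)))"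
    and lower: "\<And>k n. 2 * real n \<le> 4 ^ k \<Longrightarrow> ennreal (L * (\<Sum>i\<in>I. 2 powr (- g i * real k))) \<le> e n"
  obtains c1 c2 :: real and n0 :: nat where "0 < c1" "0 < c2" "1 \<le> n0"
    "\<And>n. n0 \<le> n \<Longrightarrow> c1 * (\<Sum>i\<in>I. real n powr (- (g i / 2))) \<le> enn2real (e n)
        \<and> enn2real (e n) \<le> c2 * (\<Sum>i\<in>I. real n powr (- (g i / 2)))"
proof
  define s where "s = (\<lambda>n. \<Sum>i\<in>I. real n powr (- (g i / 2)))"
  define m1 where "m1 = Min (insert 1 ((\<lambda>i. 8 powr (- (g i / 2))) ` I))"
  define m2 where "m2 = Max (insert 1 ((\<lambda>i. (1 / (4 * C)) powr (- (g i / 2))) ` I))"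
  define n0 where "n0 = max 1 (nat \<lceil>C\<rceil>)"
  have m1: "0 < m1" "i \<in> I \<Longrightarrow> m1 \<le> 8 powr (- (g i / 2))" for i
    using I unfolding m1_def by (auto simp: Min_gr_iff)
  have m2: "1 \<le> m2" "i \<in> I \<Longrightarrow> (1 / (4 * C)) powr (- (g i / 2)) \<le> m2" for i
    using I unfolding m2_def by (auto intro!: Max_ge)
  show "0 < L * m1" "0 < U * m2" "1 \<le> n0" using pos m1 m2 by (auto simp: n0_def)
  fix n assume n: "n0 \<le> n"
  then have n1: "1 \<le> real n" and nC: "C \<le> real n"
    using real_nat_ceiling_ge[of C] by (auto simp: n0_def)
  obtain k where k: "4 ^ k \<le> real n / C" "real n / C < 4 * 4 ^ k"
    using level_for_budget[of "real n / C"] nC pos by auto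
  have up: "e n \<le> ennreal (U * m2 * s n)"
  proof -
    have "2 powr (- g i * real k) \<le> m2 * real n powr (- (g i / 2))" if i: "i \<in> I" for i
    proof -
      have "2 powr (- g i * real k) \<le> (real n / C / 4) powr (- (g i / 2))"
        using n1 pos by (intro powr_level_le I k i) auto
      also have "\<dots> = (1 / (4 * C)) powr (- (g i / 2)) * real n powr (- (g i / 2))"
        using n1 pos by (simp add: powr_mult[symmetric] mult.commute)
      also have "\<dots> \<le> m2 * real n powr (- (g i / 2))"
        by (intro mult_right_mono m2 i) auto
      finally show ?thesis .
    qed
    then have "(\<Sum>i\<in>I. 2 powr (- g i * real k)) \<le> m2 * s n"
      unfolding s_def sum_distrib_left by (rule sum_mono)
    then have "ennreal (U * (\<Sum>i\<in>I. 2 powr (- g i * real k))) \<le> ennreal (U * (m2 * s n))"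
      using pos by (intro ennreal_leI mult_left_mono) auto
    moreover have "e n \<le> ennreal (U * (\<Sum>i\<in>I. 2 powr (- g i * real k)))"
      using k pos by (intro upper) (simp add: pos_le_divide_eq mult.commute)
    ultimately show ?thesis by (simp add: mult.assoc)
  qed
  obtain j where j: "4 ^ j \<le> 2 * real n" "2 * real n < 4 * 4 ^ j"
    using level_for_budget[of "2 * real n"] n1 by auto
  have low: "ennreal (L * m1 * s n) \<le> e n"
  proof -
    \<comment> \<open>If \<open>j\<close> is the largest level with \<open>4^j \<le> 2 n\<close>, then \<open>2 n < 4^(j+1) \<le> 8 n\<close>.\<close>
    have "m1 * real n powr (- (g i / 2)) \<le> 2 powr (- g i * real (Suc j))" if i: "i \<in> I" for i
    proof -
      have "m1 * real n powr (- (g i / 2)) \<le> 8 powr (- (g i / 2)) * real n powr (- (g i / 2))"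
        by (intro mult_right_mono m1 i) auto
      also have "\<dots> = (8 * real n) powr (- (g i / 2))" using n1 by (simp add: powr_mult)
      also have "\<dots> \<le> 2 powr (- g i * real (Suc j))"
        using j by (intro powr_level_ge I i) simp
      finally show ?thesis .
    qed
    then have "m1 * s n \<le> (\<Sum>i\<in>I. 2 powr (- g i * real (Suc j)))"
      unfolding s_def sum_distrib_left by (rule sum_mono)
    then have "ennreal (L * (m1 * s n)) \<le> ennreal (L * (\<Sum>i\<in>I. 2 powr (- g i * real (Suc j))))"
      using pos by (intro ennreal_leI mult_left_mono) auto
    also have "\<dots> \<le> e n" using j by (intro lower) simp
    finally show ?thesis by (simp add: mult.assoc)
  qed
  have s0: "0 \<le> s n" unfolding s_def by (intro sum_nonneg) auto
  have "e n < \<top>" using up by (rule order_le_less_trans) simp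
  then have "L * m1 * s n \<le> enn2real (e n)"
    using enn2real_mono[OF low] s0 m1 pos by simp
  moreover have "enn2real (e n) \<le> U * m2 * s n"
    using up s0 m2 pos by (intro enn2real_leI) auto
  ultimately show "L * m1 * (\<Sum>i\<in>I. real n powr (- (g i / 2))) \<le> enn2real (e n)
        \<and> enn2real (e n) \<le> U * m2 * (\<Sum>i\<in>I. real n powr (- (g i / 2)))"
    by (simp add: s_def)
qed

lemma error_ratio_bounds:
  fixes p u p1 :: ennreal and \<alpha> :: real
  assumes p: "1 \<le> p" "p < 2" and u: "2 < u" and p1: "1 \<le> p1" and \<alpha>: "1 < \<alpha>"
  defines "a \<equiv> 1 / enn2real p" and "b \<equiv> 1 / enn2real u"
  defines "e \<equiv> e_ran (I_op \<alpha>) (X_ball p u p1 :: 'k::{real_normed_field, euclidean_space} array_seq set) std_info"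
    and "e_non \<equiv> e_ran_non (I_op \<alpha>) (X_ball p u p1 :: 'k array_seq set) std_info"
  obtains c1 c2 :: real and n0 :: nat where "0 < c1" "0 < c2" "1 \<le> n0"
    "\<And>n. n0 \<le> n \<Longrightarrow>
        c1 * (real n powr (b / 2 - 1 / 4) + real n powr (1 / 4 - a / 2)) \<le> enn2real (e n) / enn2real (e_non n)
      \<and> enn2real (e n) / enn2real (e_non n) \<le> c2 * (real n powr (b / 2 - 1 / 4) + real n powr (1 / 4 - a / 2))"
proof -
  note exps = exponents[OF p u p1, folded a_def b_def]
  define G where "G = 1 / (1 - 2 powr - ((\<alpha> - 1) / 2))"
  have G: "0 < G" unfolding G_def using G_pos[OF p u p1 \<alpha>] .
  define g where "g s = (if s then 1 + \<alpha> else 2 + \<alpha> - a - b)" for s :: bool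
  have sum_g: "(\<Sum>s\<in>UNIV. 2 powr (- g s * real k))
      = 2 powr ((- 1 - \<alpha>) * real k) + 2 powr ((a + b - 2 - \<alpha>) * real k)" for k
    by (simp add: UNIV_bool g_def algebra_simps)
  have ran_low: "ennreal (1 / 16 * (\<Sum>s\<in>UNIV. 2 powr (- g s * real k))) \<le> e n" if n: "2 * real n \<le> 4 ^ k" for k n
  proof -
    let ?A = "2 powr ((- 1 - \<alpha>) * real k)" and ?B = "2 powr ((a + b - 2 - \<alpha>) * real k)"
    have "ennreal (max (?A / 8) (?B / 2)) \<le> e n"
      using adaptive_lower_bound_signs[OF p u p1 n, of \<alpha>] adaptive_lower_bound_spike[OF p u p1 n, of \<alpha>]
      unfolding e_def a_def b_def by (auto simp: max_def)
    moreover have "1 / 16 * (?A + ?B) \<le> max (?A / 8) (?B / 2)"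
    proof -
      have "?A / 8 \<le> max (?A / 8) (?B / 2)" "?B / 2 \<le> max (?A / 8) (?B / 2)" "0 \<le> ?A" "0 \<le> ?B" by simp_all
      then show ?thesis by argo
    qed
    ultimately show ?thesis unfolding sum_g by (meson ennreal_leI order_trans)
  qed
  have ran_up: "e n \<le> ennreal ((sqrt (18 * G) + 1) * (\<Sum>s\<in>UNIV. 2 powr (- g s * real k)))"
    if "4 * (2 + G) * 4 ^ k \<le> real n" for k n
    unfolding sum_g e_def a_def b_def G_def
    by (rule adaptive_upper_bound[OF p u p1 \<alpha>]) (use that in \<open>simp only: G_def\<close>)
  have g0: "0 < g s" for s using exps \<alpha> by (simp add: g_def)
  have C: "0 < 4 * (2 + G)" "0 < sqrt (18 * G) + 1" "0 < 2 * (2 + G)" "0 < sqrt G + 1"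
    using G by (simp_all add: add_pos_pos)
  obtain c1 c2 n1 where ran: "0 < c1" "0 < c2" "1 \<le> n1"
    "\<And>n. n1 \<le> n \<Longrightarrow> c1 * (\<Sum>s\<in>UNIV. real n powr (- (g s / 2))) \<le> enn2real (e n)
        \<and> enn2real (e n) \<le> c2 * (\<Sum>s\<in>UNIV. real n powr (- (g s / 2)))"
    by (rule order_of_growth[OF finite_class.finite_UNIV g0 C(1,2) _ ran_up ran_low]) (auto intro: that)
  have non_low: "ennreal (1 / 8 * (\<Sum>s\<in>{()}. 2 powr (- (3 / 2 + \<alpha> - a) * real k))) \<le> e_non n" if n: "2 * real n \<le> 4 ^ k" for k n
    using nonadaptive_lower_bound[OF p u p1 n, of \<alpha>] unfolding e_non_def a_def by (simp add: algebra_simps)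
  have non_up: "e_non n \<le> ennreal ((sqrt G + 1) * (\<Sum>s\<in>{()}. 2 powr (- (3 / 2 + \<alpha> - a) * real k)))"
    if "2 * (2 + G) * 4 ^ k \<le> real n" for k n
    using nonadaptive_upper_bound[OF p u p1 \<alpha>, of k n] that
    unfolding e_non_def a_def G_def by (simp add: algebra_simps)
  have g1: "0 < 3 / 2 + \<alpha> - a" using exps \<alpha> by simp
  obtain d1 d2 n2 where non: "0 < d1" "0 < d2" "1 \<le> n2"
    "\<And>n. n2 \<le> n \<Longrightarrow> d1 * (\<Sum>s\<in>{()}. real n powr (- ((3 / 2 + \<alpha> - a) / 2))) \<le> enn2real (e_non n)
        \<and> enn2real (e_non n) \<le> d2 * (\<Sum>s\<in>{()}. real n powr (- ((3 / 2 + \<alpha> - a) / 2)))"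
    by (rule order_of_growth[where I = "{()}", OF _ g1 C(3,4) _ non_up non_low]) (auto intro: that)
  show ?thesis
  proof (rule that[of "c1 / d2" "c2 / d1" "max n1 n2"])
    fix n assume n: "max n1 n2 \<le> n"
    define h where "h = real n powr (- ((3 / 2 + \<alpha> - a) / 2))"
    define s where "s = real n powr (b / 2 - 1 / 4) + real n powr (1 / 4 - a / 2)"
    have n_pos: "0 < real n" using n ran(3) by simp
    have h: "0 < h" using n_pos by (simp add: h_def)
    have s: "0 < s" using n_pos by (simp add: s_def add_pos_pos)
    have "(\<Sum>s\<in>UNIV. real n powr (- (g s / 2))) = s * h"
    proof -
      have "b / 2 - 1 / 4 + - ((3 / 2 + \<alpha> - a) / 2) = - (g False / 2)"
        "1 / 4 - a / 2 + - ((3 / 2 + \<alpha> - a) / 2) = - (g True / 2)"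
        by (simp_all add: g_def field_simps)
      then have "s * h = real n powr (- (g False / 2)) + real n powr (- (g True / 2))"
        unfolding s_def h_def distrib_right powr_add[symmetric] by simp
      then show ?thesis by (simp add: UNIV_bool)
    qed
    then have E: "c1 * (s * h) \<le> enn2real (e n)" "enn2real (e n) \<le> c2 * (s * h)"
      using ran(4)[of n] n by auto
    have F: "d1 * h \<le> enn2real (e_non n)" "enn2real (e_non n) \<le> d2 * h"
      using non(4)[of n] n by (auto simp: h_def)
    have F0: "0 < enn2real (e_non n)" using F(1) non(1) h by (meson mult_pos_pos less_le_trans)
    have "c1 / d2 * s = c1 * (s * h) / (d2 * h)" using h by simp
    also have "\<dots> \<le> enn2real (e n) / enn2real (e_non n)"
      using E F F0 by (intro frac_le) auto
    finally have 1: "c1 / d2 * s \<le> enn2real (e n) / enn2real (e_non n)" .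
    have "enn2real (e n) / enn2real (e_non n) \<le> c2 * (s * h) / (d1 * h)"
      using E F non(1) h s ran(2) by (intro frac_le) auto
    also have "\<dots> = c2 / d1 * s" using h by simp
    finally show "c1 / d2 * (real n powr (b / 2 - 1 / 4) + real n powr (1 / 4 - a / 2)) \<le> enn2real (e n) / enn2real (e_non n)
      \<and> enn2real (e n) / enn2real (e_non n) \<le> c2 / d1 * (real n powr (b / 2 - 1 / 4) + real n powr (1 / 4 - a / 2))"
      using 1 by (simp add: s_def)
  qed (use ran non in auto)
qed

text \<open>
  The bounds of \<open>error_ratio_bounds\<close> in the form with logarithms, and their reciprocals for
  \<open>a = 1\<close>, \<open>b = 0\<close>, where both powers of \<open>n\<close> coincide.
\<close>

lemma error_ratio:
  fixes p u p1 :: ennreal and \<alpha> :: real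
  assumes p: "1 \<le> p" "p < 2" and u: "2 < u" and p1: "1 \<le> p1" and \<alpha>: "1 < \<alpha>"
  defines "e \<equiv> e_ran (I_op \<alpha>) (X_ball p u p1 :: 'k::{real_normed_field, euclidean_space} array_seq set) std_info"
    and "e_non \<equiv> e_ran_non (I_op \<alpha>) (X_ball p u p1 :: 'k array_seq set) std_info"
  shows "\<exists>n0::nat. n0 \<ge> 1 \<and>
      (\<exists>c1>0. \<exists>c2>0. \<forall>n\<ge>n0.
         c1 * real n powr (enn2real (1 / (2 * u)) - 1 / 4)
           + c1 * real n powr (1 / 4 - enn2real (1 / (2 * p)))
         \<le> enn2real (e n) / enn2real (e_non n) \<and>
         enn2real (e n) / enn2real (e_non n)
         \<le> c2 * real n powr (enn2real (1 / (2 * u)) - 1 / 4)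
                * log 2 (real n + 1) powr (1 - enn2real (1 / u))
           + c2 * real n powr (1 / 4 - enn2real (1 / (2 * p))) * log 2 (real n + 1) powr (1 / 2)) \<and>
      (p = 1 \<and> u = \<infinity> \<longrightarrow>
        (\<exists>c1>0. \<exists>c2>0. \<forall>n\<ge>n0.
           c1 * real n powr (1 / 4) * log 2 (real n + 1) powr (- 1)
           \<le> enn2real (e_non n) / enn2real (e n) \<and>
           enn2real (e_non n) / enn2real (e n) \<le> c2 * real n powr (1 / 4)))"
proof -
  obtain c1 c2 n0 where c: "0 < c1" "0 < c2" "1 \<le> n0"
    and ratio: "\<And>n. n0 \<le> n \<Longrightarrow>
        c1 * (real n powr (1 / enn2real u / 2 - 1 / 4) + real n powr (1 / 4 - 1 / enn2real p / 2))
          \<le> enn2real (e n) / enn2real (e_non n)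
      \<and> enn2real (e n) / enn2real (e_non n)
          \<le> c2 * (real n powr (1 / enn2real u / 2 - 1 / 4) + real n powr (1 / 4 - 1 / enn2real p / 2))"
    using error_ratio_bounds[OF p u p1 \<alpha>, where 'k = 'k, folded e_def e_non_def] by blast
  have inv: "enn2real (1 / x) = 1 / enn2real x" for x
    by (cases x rule: ennreal_cases) (auto simp: divide_ennreal_def inverse_ennreal_def enn2real_mult inverse_eq_divide)
  have half: "enn2real (1 / (2 * x)) = 1 / enn2real x / 2" for x
    unfolding inv by (simp add: enn2real_mult)
  note exps = exponents[OF p u p1]
  have log_ge: "1 \<le> log 2 (real n + 1)" if "n0 \<le> n" for n
    using c(3) that by (simp add: le_log_iff)
  show ?thesis
  proof (intro exI[of _ n0] conjI impI)
    show "1 \<le> n0" by (rule c(3))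
    show "\<exists>c1>0. \<exists>c2>0. \<forall>n\<ge>n0.
         c1 * real n powr (enn2real (1 / (2 * u)) - 1 / 4)
           + c1 * real n powr (1 / 4 - enn2real (1 / (2 * p)))
         \<le> enn2real (e n) / enn2real (e_non n) \<and>
         enn2real (e n) / enn2real (e_non n)
         \<le> c2 * real n powr (enn2real (1 / (2 * u)) - 1 / 4)
                * log 2 (real n + 1) powr (1 - enn2real (1 / u))
           + c2 * real n powr (1 / 4 - enn2real (1 / (2 * p))) * log 2 (real n + 1) powr (1 / 2)"
    proof (rule exI[of _ c1], intro conjI exI[of _ c2] allI impI)
      fix n assume n: "n0 \<le> n"
      let ?x = "real n powr (1 / enn2real u / 2 - 1 / 4)" and ?y = "real n powr (1 / 4 - 1 / enn2real p / 2)"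
      let ?l = "log 2 (real n + 1)"
      show "c1 * real n powr (enn2real (1 / (2 * u)) - 1 / 4)
           + c1 * real n powr (1 / 4 - enn2real (1 / (2 * p))) \<le> enn2real (e n) / enn2real (e_non n)"
        unfolding half using ratio[OF n] by (simp add: distrib_left)
      have "1 \<le> ?l powr (1 - 1 / enn2real u)" "1 \<le> ?l powr (1 / 2)"
        using exps log_ge[OF n] by (auto intro!: ge_one_powr_ge_zero)
      then have "c2 * ?x * 1 + c2 * ?y * 1 \<le> c2 * ?x * ?l powr (1 - 1 / enn2real u) + c2 * ?y * ?l powr (1 / 2)"
        using c(2) by (intro add_mono mult_left_mono) auto
      then show "enn2real (e n) / enn2real (e_non n)
         \<le> c2 * real n powr (enn2real (1 / (2 * u)) - 1 / 4) * ?l powr (1 - enn2real (1 / u))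
           + c2 * real n powr (1 / 4 - enn2real (1 / (2 * p))) * ?l powr (1 / 2)"
        unfolding half unfolding inv using ratio[OF n] by (simp add: distrib_left)
    qed (use c in auto)
    assume pu: "p = 1 \<and> u = \<infinity>"
    show "\<exists>c1>0. \<exists>c2>0. \<forall>n\<ge>n0.
           c1 * real n powr (1 / 4) * log 2 (real n + 1) powr (- 1)
           \<le> enn2real (e_non n) / enn2real (e n) \<and>
           enn2real (e_non n) / enn2real (e n) \<le> c2 * real n powr (1 / 4)"
    proof (rule exI[of _ "1 / (2 * c2)"], intro conjI exI[of _ "1 / (2 * c1)"] allI impI)
      fix n assume n: "n0 \<le> n"
      define r where "r = enn2real (e n) / enn2real (e_non n)"
      define z where "z = real n powr (1 / 4)"
      have z: "0 < z" using n c(3) by (simp add: z_def)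
      have "real n powr (- (1 / 4)) = 1 / z" by (simp add: z_def powr_minus_divide)
      then have bounds: "2 * c1 / z \<le> r" "r \<le> 2 * c2 / z"
        using ratio[OF n] pu unfolding r_def by (auto simp: algebra_simps)
      have "0 < 2 * c1 / z" using z c by simp
      with bounds have r0: "0 < r" by linarith
      have inv_r: "enn2real (e_non n) / enn2real (e n) = 1 / r" by (simp add: r_def)
      have "1 / r \<le> 1 / (2 * c1 / z)" using bounds \<open>0 < 2 * c1 / z\<close> r0 by (intro divide_left_mono mult_pos_pos) auto
      then show "enn2real (e_non n) / enn2real (e n) \<le> 1 / (2 * c1) * real n powr (1 / 4)"
        unfolding inv_r by (simp add: z_def)
      have "log 2 (real n + 1) powr (- 1) \<le> 1"
        using log_ge[OF n] by (simp add: powr_minus_divide)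
      then have "1 / (2 * c2) * z * log 2 (real n + 1) powr (- 1) \<le> 1 / (2 * c2) * z * 1"
        using c z by (intro mult_left_mono) auto
      also have "\<dots> = 1 / (2 * c2 / z)" by simp
      also have "\<dots> \<le> 1 / r" using bounds r0 z c by (intro divide_left_mono mult_pos_pos) auto
      finally show "1 / (2 * c2) * real n powr (1 / 4) * log 2 (real n + 1) powr (- 1)
          \<le> enn2real (e_non n) / enn2real (e n)"
        unfolding inv_r z_def .
    qed (use c in auto)
  qed
qed

theorem corollary5p3:
  fixes p u p1 :: ennreal and \<alpha> :: real
  assumes "1 \<le> p" "p < 2" "2 < u" "1 \<le> p1" "1 < \<alpha>"
  shows "\<forall>(e, e_non) \<in>
      {(e_ran (I_op \<alpha> :: real array_seq \<Rightarrow> real) (X_ball p u p1) std_info,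
        e_ran_non (I_op \<alpha> :: real array_seq \<Rightarrow> real) (X_ball p u p1) std_info),
       (e_ran (I_op \<alpha> :: complex array_seq \<Rightarrow> complex) (X_ball p u p1) std_info,
        e_ran_non (I_op \<alpha> :: complex array_seq \<Rightarrow> complex) (X_ball p u p1) std_info)}.
    \<exists>n0::nat. n0 \<ge> 1 \<and>
      (\<exists>c1>0. \<exists>c2>0. \<forall>n\<ge>n0.
         c1 * real n powr (enn2real (1 / (2 * u)) - 1 / 4)
           + c1 * real n powr (1 / 4 - enn2real (1 / (2 * p)))
         \<le> enn2real (e n) / enn2real (e_non n) \<and>
         enn2real (e n) / enn2real (e_non n)
         \<le> c2 * real n powr (enn2real (1 / (2 * u)) - 1 / 4)
                * log 2 (real n + 1) powr (1 - enn2real (1 / u))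
           + c2 * real n powr (1 / 4 - enn2real (1 / (2 * p))) * log 2 (real n + 1) powr (1 / 2)) \<and>
      (p = 1 \<and> u = \<infinity> \<longrightarrow>
        (\<exists>c1>0. \<exists>c2>0. \<forall>n\<ge>n0.
           c1 * real n powr (1 / 4) * log 2 (real n + 1) powr (- 1)
           \<le> enn2real (e_non n) / enn2real (e n) \<and>
           enn2real (e_non n) / enn2real (e n) \<le> c2 * real n powr (1 / 4)))"
proof (intro ballI, elim insertE emptyE, goal_cases)
  case (1 x)
  show ?case
    unfolding 1 prod.case by (rule error_ratio[OF assms])
next
  case (2 x)
  show ?case
    unfolding 2 prod.case by (rule error_ratio[OF assms])
qed

end
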